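(* Consider a society with rich players $N_r$ and poor players $N_p$ ($N=N_r\sqcup N_p$), with costs of providing a favor $c_r<c_p$, substitutable favors, and transfers available exactly to rich players ($\tilde N=N_r$). Let $B^*(c)$ be the cooperation bound of a homogeneous society with cost $c$, and let $\tilde c_r=\inf\{c\in[0,c_p]: B^*(c)=B^*(c_p)\}$. (1) If $c_r>\tilde c_r$, then all networks in which all players have $B^*$ links, where $B^*=B^*(c_r)=B^*(c_p)$, are strongly stable with transfers. (2) If $c_r<\tilde c_r$ and $g$ is strongly stable with transfers, then at $g$ all rich players have $B^*(c_r)$ links, no rich player is linked with a poor player, and all poor players have at most $B^*(c_p)$ links. (3) If $c_r<\tilde c_r$, then in any strongly stable network, as $N\to\infty$ (the number of players grows without bound), the fraction of rich players who have $B^*(c_r)$ links, the fraction of poor players who have $B^*(c_p)$ links, and the fraction of players who only have links with their own group all go to $1$.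
   Context: A network $g$ is an undirected simple graph on the finite player set $N$, viewed as its set of links; $N_i(g)=\{j: ij\in g\}$, $d_i(g)=|N_i(g)|$; $g-ij$ is $g$ with link $ij$ deleted. Fixed parameters: $\alpha\in(0,1]$, $p\in(0,1)$, $\delta\in(0,1)$ (discount factor), $v$ (value of a favor), $\gamma\ge0$ (penalty for refusing). Player $i$'s cost of providing a favor is $c_i=c_r$ if $i\in N_r$ and $c_i=c_p$ if $i\in N_p$; all costs $c$ considered satisfy $\gamma<c<v$. Favor exchange game (substitutable favors). Time is $t=0,1,2,\dots$; $g_t$ is the network at the beginning of period $t$, and $g_0=g$ is common knowledge. In each period: (i) players decide, for each of their links, to keep or remove it; (ii) any player needs a favor with probability $\alpha$ (for simplicity at most one player requires a favor in a given period, which is said not to affect the results); (iii) each other player is independently able to provide the favor in that period with probability $p$; (iv) if some current neighbors of the requester $i$ are able, one of them, $j$, is selected uniformly at random; (v) $j$ chooses $C$ (payoff $v$ to $i$, $-c_j$ to $j$) or $D$ (payoff $0$ to $i$, $-\gamma$ to $j$). All other payoffs are $0$. Player $i$ observes with whom she plays, the action profiles in periods in which she plays, and $N_i(g_t)$, but not $g_t$. A strategy $\sigma_i(h_{t,i},j)$ gives, for each private history $h_{t,i}$ and $j\ne i$, a distribution over decisions toward $j$. The bilateral history $h_{t,ij}$ contains only the periods and action profiles of past interactions between $i$ and $j$; $\sigma$ is measurable with respect to bilateral histories if $\sigma_i(h_{t,i},j)=\sigma_i(h'_{t,i},j)$ whenever $h_{t,ij}=h'_{t,ij}$. $(g,\sigma)$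 is a bilateral equilibrium if $\sigma$ is measurable with respect to bilateral histories and is part of a sequential equilibrium of the game with $g_0=g$. A network $g$ is stable if there is a bilateral equilibrium $(g,\sigma)$ in which on the equilibrium path all favors are provided and all links are kept. Per-period payoff when all favors are provided: with $w(x,g)=\frac{\alpha(1-(1-p)^{d_x(g)})}{d_x(g)}$, $u_i(g)=\alpha v\big(1-(1-p)^{d_i(g)}\big)-c_i\sum_{j\in N_i(g)}w(j,g)$. Cooperation bound: $B^*(c)$ is the non-negative integer such that $\delta\alpha v(1-p)^{m-1}p-\delta\alpha c\frac{1-(1-p)^m}{m}\ge(1-\delta)(c-\gamma)$ holds for all positive integers $m\le B^*(c)$ and fails for all $m>B^*(c)$. In the definition of $\tilde c_r$ only costs $c\in[0,c_p]$ with $c>\gamma$ are considered. Sustainability: a link $ij\in g$ is sustainable at $g$ if $\frac{\delta}{1-\delta}(u_x(g)-u_x(g-ij))\ge c_x-\gamma$ for both $x\in\{i,j\}$. For transfers $t=(t_i,t_j)$, $t_i,t_j\ge0$, with $t_x>0$ only if $x\in\tilde N$ ($x$ pays $t_x$ to the other each time the other provides $x$ a favor), put $\tilde u_i(g,j,t_i,t_j)=u_i(g)-w(i,g)t_i+w(j,g)t_j$, and symmetrically for $j$; $ij$ is sustainable at $g$ with transfers $t$ if $\frac{\delta}{1-\delta}(\tilde u_i(g,j,t_i,t_j)-u_i(g-ij))\ge c_i-\gamma$ and $\frac{\delta}{1-\delta}(\tilde u_j(g,i,t_j,t_i)-u_j(g-ij))\ge c_j-\gamma$. Strong stability: $g'$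 is obtainable from $g$ via deviations by $\{i,j\}$ if every link in $g'\setminus g$ equals $ij$ and every link in $g\setminus g'$ involves $i$ or $j$. A stable $g$ is strongly stable if there are no $i,j$ and $g'$ obtainable from $g$ via deviations by $\{i,j\}$ with $ij\in g'$, $ij\notin g$, $ij$ sustainable at $g'$, and $u_i(g')\ge u_i(g)$, $u_j(g')\ge u_j(g)$ with at least one strict. A stable $g$ is strongly stable with transfers if there are no $i,j$, admissible transfers $t$, and $g'$ obtainable from $g$ via deviations by $\{i,j\}$ with $ij\in g'$, $ij\notin g$, $ij$ sustainable at $g'$ with transfers $t$, and $\tilde u_i(g',j,t_i,t_j)\ge u_i(g)$, $\tilde u_j(g',i,t_j,t_i)\ge u_j(g)$ with at least one strict.
   Formalization: In (2), if there are rich players, their number is assumed to exceed B*(c_r); in (3), the limits for the fractions of rich and of poor players are each stated when the number of players in that group itself tends to infinity, since both claims fail for, e.g., a single rich player. *)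

theory Defs
  imports "HOL-Probability.Probability"
begin

section \<open>Networks\<close>

type_synonym 'a network = "'a set set"

definition network_on :: "'a set \<Rightarrow> 'a network \<Rightarrow> bool" where
  "network_on N g \<longleftrightarrow> g \<subseteq> {{i, j} | i j. i \<in> N \<and> j \<in> N \<and> i \<noteq> j}"

definition nbrs :: "'a network \<Rightarrow> 'a \<Rightarrow> 'a set" where
  "nbrs g i = {j. {i, j} \<in> g \<and> j \<noteq> i}"

definition deg :: "'a network \<Rightarrow> 'a \<Rightarrow> nat" where
  "deg g i = card (nbrs g i)"

section \<open>Primitives\<close>

record favor_params =
  need_prob :: real
  able_prob :: real
  discount  :: real
  benefit   :: real
  penalty   :: real

definition valid_params :: "'z favor_params_scheme \<Rightarrow> bool" where
  "valid_params P \<longleftrightarrow>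
     0 < need_prob P \<and> need_prob P \<le> 1 \<and>
     0 < able_prob P \<and> able_prob P < 1 \<and>
     0 < discount P \<and> discount P < 1 \<and>
     0 \<le> penalty P"

text \<open>
  The field \<open>request_law\<close> is the joint law of the set of players who need a favor in a period.
  Only its marginals are prescribed: every player needs a favor with probability \<open>need_prob\<close>.
  The law concentrated on sets with at most one element is an instance whenever
  \<open>need_prob * card players \<le> 1\<close>; without this restriction on the law, societies of every size
  exist for a fixed \<open>need_prob\<close>.
\<close>

record 'a society = favor_params +
  players :: "'a set"
  cost :: "'a \<Rightarrow> real"
  request_law :: "'a set pmf"

definition valid_society :: "'a society \<Rightarrow> bool" where
  "valid_society S \<longleftrightarrow>
     valid_params S \<and> finite (players S) \<and>
     (\<forall>i\<in>players S. penalty S < cost S i \<and> cost S i < benefit S) \<and>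
     set_pmf (request_law S) \<subseteq> Pow (players S) \<and>
     (\<forall>i\<in>players S. measure_pmf.prob (request_law S) {R. i \<in> R} = need_prob S)"

section \<open>The favor exchange game\<close>

text \<open>
  \<open>kept (i, j)\<close>: \<open>i\<close> decides to keep the link with \<open>j\<close> (\<open>True\<close> where there is no such link).
  \<open>provider k = Some j\<close>: \<open>k\<close> needs a favor and \<open>j\<close> is selected to provide it.
  \<open>coop k\<close>: the selected provider chooses C (\<open>False\<close> where nobody is selected).
\<close>

datatype 'a period =
  Period (kept: "'a \<times> 'a \<Rightarrow> bool") (provider: "'a \<Rightarrow> 'a option") (coop: "'a \<Rightarrow> bool")

text \<open>Histories list the completed periods, the most recent one first.\<close>

type_synonym 'a history = "'a period list"

definition remaining :: "'a network \<Rightarrow> ('a \<times> 'a \<Rightarrow> bool) \<Rightarrow> 'a network" where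
  "remaining g k = g - {{i, j} | i j. \<not> k (i, j)}"

fun current_network :: "'a network \<Rightarrow> 'a history \<Rightarrow> 'a network" where
  "current_network g [] = g"
| "current_network g (x # H) = remaining (current_network g H) (kept x)"

datatype 'a node =
    Link_node "'a history"
  | Favor_node "'a history" "'a \<times> 'a \<Rightarrow> bool" "'a \<Rightarrow> 'a option"

subsection \<open>Information\<close>

text \<open>
  What a player observes of a completed period: her own link decisions, her neighborhood at the
  beginning of the next period, and the favors in which she is requester or provider.
\<close>

datatype 'a obs =
  Obs (own_kept: "'a \<Rightarrow> bool") (own_nbrs: "'a set") (own_favors: "'a \<Rightarrow> ('a \<times> bool) option")

definition own_plays :: "'a \<Rightarrow> ('a \<Rightarrow> 'a option) \<Rightarrow> 'a \<Rightarrow> 'a option" where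
  "own_plays i f = (\<lambda>k. if k = i \<or> f k = Some i then f k else None)"

fun private_history :: "'a network \<Rightarrow> 'a \<Rightarrow> 'a history \<Rightarrow> 'a obs list" where
  "private_history g i [] = []"
| "private_history g i (x # H) =
     Obs (\<lambda>j. kept x (i, j))
         (nbrs (current_network g (x # H)) i)
         (\<lambda>k. map_option (\<lambda>j. (j, coop x k)) (own_plays i (provider x) k))
     # private_history g i H"

text \<open>
  At the favor stage a player also knows her own link decisions of the current period and with whom
  she plays in it.
\<close>

datatype 'a info =
    Link_info "'a obs list"
  | Favor_info "'a obs list" "'a \<Rightarrow> bool" "'a \<Rightarrow> 'a option"

fun info_of :: "'a network \<Rightarrow> 'a \<Rightarrow> 'a node \<Rightarrow> 'a info" where
  "info_of g i (Link_node H) = Link_info (private_history g i H)"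
| "info_of g i (Favor_node H k f) =
     Favor_info (private_history g i H) (\<lambda>j. k (i, j)) (own_plays i f)"

fun to_move :: "'a network \<Rightarrow> 'a \<Rightarrow> 'a node \<Rightarrow> bool" where
  "to_move g i (Link_node H) \<longleftrightarrow> nbrs (current_network g H) i \<noteq> {}"
| "to_move g i (Favor_node H k f) \<longleftrightarrow> (\<exists>r. f r = Some i)"

text \<open>
  Per period: the action of \<open>j\<close> in a favor to \<open>i\<close>, and the action of \<open>i\<close> in a favor to \<open>j\<close>.
  Since there is one entry per past period, equal bilateral histories have equal dates.
\<close>

definition bilateral_history ::
  "'a \<Rightarrow> 'a \<Rightarrow> 'a obs list \<Rightarrow> (bool option \<times> bool option) list" where
  "bilateral_history i j h = map (\<lambda>ob.
     (case own_favors ob i of Some (l, a) \<Rightarrow> if l = j then Some a else None | None \<Rightarrow> None,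
      case own_favors ob j of Some (l, a) \<Rightarrow> if l = i then Some a else None | None \<Rightarrow> None)) h"

subsection \<open>Strategies and play\<close>

text \<open>
  \<open>\<sigma> i I j\<close> is the decision of \<open>i\<close> toward \<open>j\<close> at the information \<open>I\<close>: at the link stage \<open>True\<close> is to
  keep the link, at the favor stage \<open>True\<close> is to choose C when \<open>j\<close> requests the favor.
\<close>

type_synonym 'a strategy = "'a info \<Rightarrow> 'a \<Rightarrow> bool pmf"
type_synonym 'a profile = "'a \<Rightarrow> 'a strategy"

definition link_decisions ::
  "'a network \<Rightarrow> 'a profile \<Rightarrow> 'a history \<Rightarrow> ('a \<times> 'a \<Rightarrow> bool) pmf" where
  "link_decisions g \<sigma> H =
     Pi_pmf {(i, j). j \<in> nbrs (current_network g H) i} True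
       (\<lambda>(i, j). \<sigma> i (info_of g i (Link_node H)) j)"

definition provider_law :: "'a society \<Rightarrow> 'a network \<Rightarrow> 'a \<Rightarrow> 'a option pmf" where
  "provider_law S g i =
     bind_pmf (Pi_pmf (players S - {i}) False (\<lambda>_. bernoulli_pmf (able_prob S)))
       (\<lambda>able. let A = {j \<in> nbrs g i. able j} in
          if A = {} then return_pmf None else map_pmf Some (pmf_of_set A))"

text \<open>Distinct favors of the same period are served independently.\<close>

definition nature :: "'a society \<Rightarrow> 'a network \<Rightarrow> ('a \<Rightarrow> 'a option) pmf" where
  "nature S g = bind_pmf (request_law S) (\<lambda>R. Pi_pmf R None (provider_law S g))"

definition favor_decisions ::
  "'a network \<Rightarrow> 'a profile \<Rightarrow> 'a history \<Rightarrow> ('a \<times> 'a \<Rightarrow> bool) \<Rightarrow> ('a \<Rightarrow> 'a option)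
     \<Rightarrow> ('a \<Rightarrow> bool) pmf" where
  "favor_decisions g \<sigma> H k f =
     Pi_pmf (dom f) False (\<lambda>r. \<sigma> (the (f r)) (info_of g (the (f r)) (Favor_node H k f)) r)"

definition to_favor_node :: "'a society \<Rightarrow> 'a network \<Rightarrow> 'a profile \<Rightarrow> 'a history \<Rightarrow> 'a node pmf" where
  "to_favor_node S g \<sigma> H =
     bind_pmf (link_decisions g \<sigma> H) (\<lambda>k.
       map_pmf (Favor_node H k) (nature S (remaining (current_network g H) k)))"

text \<open>Law of the history at the end of the period to which a node belongs.\<close>

fun finish_favor :: "'a network \<Rightarrow> 'a profile \<Rightarrow> 'a node \<Rightarrow> 'a history pmf" where
  "finish_favor g \<sigma> (Favor_node H k f) =
     map_pmf (\<lambda>a. Period k f a # H) (favor_decisions g \<sigma> H k f)"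
| "finish_favor g \<sigma> (Link_node H) = return_pmf H"

fun finish_period :: "'a society \<Rightarrow> 'a network \<Rightarrow> 'a profile \<Rightarrow> 'a node \<Rightarrow> 'a history pmf" where
  "finish_period S g \<sigma> (Link_node H) = bind_pmf (to_favor_node S g \<sigma> H) (finish_favor g \<sigma>)"
| "finish_period S g \<sigma> (Favor_node H k f) = finish_favor g \<sigma> (Favor_node H k f)"

fun advance ::
  "'a society \<Rightarrow> 'a network \<Rightarrow> 'a profile \<Rightarrow> nat \<Rightarrow> 'a history pmf \<Rightarrow> 'a history pmf" where
  "advance S g \<sigma> 0 M = M"
| "advance S g \<sigma> (Suc n) M =
     bind_pmf (advance S g \<sigma> n M) (\<lambda>H. finish_period S g \<sigma> (Link_node H))"

definition outcome :: "'a society \<Rightarrow> 'a network \<Rightarrow> 'a profile \<Rightarrow> nat \<Rightarrow> 'a history pmf" where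
  "outcome S g \<sigma> t = advance S g \<sigma> t (return_pmf [])"

definition stage_payoff :: "'a society \<Rightarrow> 'a \<Rightarrow> 'a period \<Rightarrow> real" where
  "stage_payoff S i x =
     (if provider x i \<noteq> None \<and> coop x i then benefit S else 0) +
     (\<Sum>r | r \<in> players S \<and> provider x r = Some i. if coop x r then - cost S i else - penalty S)"

text \<open>
  Expected discounted payoff from a random node on, discounted to the period of that node.
\<close>

definition continuation_payoff ::
  "'a society \<Rightarrow> 'a network \<Rightarrow> 'a profile \<Rightarrow> 'a \<Rightarrow> 'a node pmf \<Rightarrow> real" where
  "continuation_payoff S g \<sigma> i M =
     (\<Sum>n. discount S ^ n *
        measure_pmf.expectation (advance S g \<sigma> n (bind_pmf M (finish_period S g \<sigma>)))
          (\<lambda>H. stage_payoff S i (hd H)))"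

subsection \<open>Sequential equilibrium\<close>

fun node_law :: "'a society \<Rightarrow> 'a network \<Rightarrow> 'a profile \<Rightarrow> 'a info \<Rightarrow> 'a node pmf" where
  "node_law S g \<sigma> (Link_info h) = map_pmf Link_node (outcome S g \<sigma> (length h))"
| "node_law S g \<sigma> (Favor_info h k f) =
     bind_pmf (outcome S g \<sigma> (length h)) (to_favor_node S g \<sigma>)"

definition info_sets :: "'a society \<Rightarrow> 'a network \<Rightarrow> 'a \<Rightarrow> 'a info set" where
  "info_sets S g i =
     {I. \<exists>\<sigma> x. x \<in> set_pmf (node_law S g \<sigma> I) \<and> info_of g i x = I \<and> to_move g i x}"

type_synonym 'a beliefs = "'a \<Rightarrow> 'a info \<Rightarrow> 'a node pmf"

definition completely_mixed :: "'a profile \<Rightarrow> bool" where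
  "completely_mixed \<sigma> \<longleftrightarrow> (\<forall>i I j b. 0 < pmf (\<sigma> i I j) b)"

text \<open>
  Kreps--Wilson consistency. The horizon is infinite but each information set has finitely many
  nodes; convergence of strategies and of beliefs is pointwise over information sets.
\<close>

definition consistent :: "'a society \<Rightarrow> 'a network \<Rightarrow> 'a profile \<Rightarrow> 'a beliefs \<Rightarrow> bool" where
  "consistent S g \<sigma> \<mu> \<longleftrightarrow>
     (\<exists>\<tau>. (\<forall>n. completely_mixed (\<tau> n)) \<and>
       (\<forall>i I j b. (\<lambda>n. pmf (\<tau> n i I j) b) \<longlonglongrightarrow> pmf (\<sigma> i I j) b) \<and>
       (\<forall>i\<in>players S. \<forall>I\<in>info_sets S g i. \<forall>x.
          (\<lambda>n. pmf (cond_pmf (node_law S g (\<tau> n) I) {y. info_of g i y = I}) x) \<longlonglongrightarrow> pmf (\<mu> i I) x))"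

definition sequentially_rational ::
  "'a society \<Rightarrow> 'a network \<Rightarrow> 'a profile \<Rightarrow> 'a beliefs \<Rightarrow> bool" where
  "sequentially_rational S g \<sigma> \<mu> \<longleftrightarrow>
     (\<forall>i\<in>players S. \<forall>I\<in>info_sets S g i. \<forall>s :: 'a strategy.
        continuation_payoff S g (\<sigma>(i := s)) i (\<mu> i I) \<le> continuation_payoff S g \<sigma> i (\<mu> i I))"

definition sequential_equilibrium ::
  "'a society \<Rightarrow> 'a network \<Rightarrow> 'a profile \<Rightarrow> 'a beliefs \<Rightarrow> bool" where
  "sequential_equilibrium S g \<sigma> \<mu> \<longleftrightarrow> sequentially_rational S g \<sigma> \<mu> \<and> consistent S g \<sigma> \<mu>"

definition bilaterally_measurable :: "'a profile \<Rightarrow> bool" where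
  "bilaterally_measurable \<sigma> \<longleftrightarrow>
     (\<forall>i j h h'. j \<noteq> i \<longrightarrow> bilateral_history i j h = bilateral_history i j h' \<longrightarrow>
        \<sigma> i (Link_info h) j = \<sigma> i (Link_info h') j \<and>
        (\<forall>k f k' f'. \<sigma> i (Favor_info h k f) j = \<sigma> i (Favor_info h' k' f') j))"

definition bilateral_equilibrium :: "'a society \<Rightarrow> 'a network \<Rightarrow> 'a profile \<Rightarrow> bool" where
  "bilateral_equilibrium S g \<sigma> \<longleftrightarrow>
     bilaterally_measurable \<sigma> \<and> (\<exists>\<mu>. sequential_equilibrium S g \<sigma> \<mu>)"

definition stable :: "'a society \<Rightarrow> 'a network \<Rightarrow> bool" where
  "stable S g \<longleftrightarrow> network_on (players S) g \<and>
     (\<exists>\<sigma>. bilateral_equilibrium S g \<sigma> \<and>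
        (\<forall>t. \<forall>H\<in>set_pmf (outcome S g \<sigma> t).
           current_network g H = g \<and>
           (\<forall>x\<in>set H. \<forall>r. provider x r \<noteq> None \<longrightarrow> coop x r)))"

section \<open>Sustainability and strong stability\<close>

text \<open>
  Given that all favors are provided, the probability per period that a given neighbor provides \<open>x\<close>
  a favor.
\<close>

definition favor_prob :: "'a society \<Rightarrow> 'a network \<Rightarrow> 'a \<Rightarrow> real" where
  "favor_prob S g x = need_prob S * (1 - (1 - able_prob S) ^ deg g x) / real (deg g x)"

definition payoff :: "'a society \<Rightarrow> 'a network \<Rightarrow> 'a \<Rightarrow> real" where
  "payoff S g i = need_prob S * benefit S * (1 - (1 - able_prob S) ^ deg g i)
             - cost S i * (\<Sum>j\<in>nbrs g i. favor_prob S g j)"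

definition payoff_with_transfers :: "'a society \<Rightarrow> 'a network \<Rightarrow> 'a \<Rightarrow> 'a \<Rightarrow> real \<Rightarrow> real \<Rightarrow> real" where
  "payoff_with_transfers S g i j t\<^sub>i t\<^sub>j = payoff S g i - favor_prob S g i * t\<^sub>i + favor_prob S g j * t\<^sub>j"

definition sustainable :: "'a society \<Rightarrow> 'a network \<Rightarrow> 'a \<Rightarrow> 'a \<Rightarrow> bool" where
  "sustainable S g i j \<longleftrightarrow> {i, j} \<in> g \<and>
     (\<forall>x\<in>{i, j}. discount S / (1 - discount S) * (payoff S g x - payoff S (g - {{i, j}}) x)
        \<ge> cost S x - penalty S)"

definition sustainable_with_transfers ::
  "'a society \<Rightarrow> 'a network \<Rightarrow> 'a \<Rightarrow> 'a \<Rightarrow> real \<Rightarrow> real \<Rightarrow> bool" where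
  "sustainable_with_transfers S g i j t\<^sub>i t\<^sub>j \<longleftrightarrow> {i, j} \<in> g \<and>
     discount S / (1 - discount S) * (payoff_with_transfers S g i j t\<^sub>i t\<^sub>j - payoff S (g - {{i, j}}) i)
       \<ge> cost S i - penalty S \<and>
     discount S / (1 - discount S) * (payoff_with_transfers S g j i t\<^sub>j t\<^sub>i - payoff S (g - {{i, j}}) j)
       \<ge> cost S j - penalty S"

text \<open>\<open>N'\<close> is the set of players who are able to make transfers.\<close>

definition admissible_transfers :: "'a set \<Rightarrow> 'a \<Rightarrow> 'a \<Rightarrow> real \<Rightarrow> real \<Rightarrow> bool" where
  "admissible_transfers N' i j t\<^sub>i t\<^sub>j \<longleftrightarrow>
     0 \<le> t\<^sub>i \<and> 0 \<le> t\<^sub>j \<and> (0 < t\<^sub>i \<longrightarrow> i \<in> N') \<and> (0 < t\<^sub>j \<longrightarrow> j \<in> N')"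

definition obtainable :: "'a network \<Rightarrow> 'a \<Rightarrow> 'a \<Rightarrow> 'a network \<Rightarrow> bool" where
  "obtainable g i j g' \<longleftrightarrow>
     (\<forall>l\<in>g' - g. l = {i, j}) \<and> (\<forall>l\<in>g - g'. i \<in> l \<or> j \<in> l)"

definition strongly_stable :: "'a society \<Rightarrow> 'a network \<Rightarrow> bool" where
  "strongly_stable S g \<longleftrightarrow> stable S g \<and>
     \<not> (\<exists>i\<in>players S. \<exists>j\<in>players S. \<exists>g'.
          network_on (players S) g' \<and> obtainable g i j g' \<and>
          {i, j} \<in> g' \<and> {i, j} \<notin> g \<and> sustainable S g' i j \<and>
          payoff S g' i \<ge> payoff S g i \<and> payoff S g' j \<ge> payoff S g j \<and>
          (payoff S g' i > payoff S g i \<or> payoff S g' j > payoff S g j))"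

definition strongly_stable_with_transfers :: "'a society \<Rightarrow> 'a set \<Rightarrow> 'a network \<Rightarrow> bool" where
  "strongly_stable_with_transfers S N' g \<longleftrightarrow> stable S g \<and>
     \<not> (\<exists>i\<in>players S. \<exists>j\<in>players S. \<exists>t\<^sub>i t\<^sub>j g'.
          admissible_transfers N' i j t\<^sub>i t\<^sub>j \<and>
          network_on (players S) g' \<and> obtainable g i j g' \<and>
          {i, j} \<in> g' \<and> {i, j} \<notin> g \<and> sustainable_with_transfers S g' i j t\<^sub>i t\<^sub>j \<and>
          payoff_with_transfers S g' i j t\<^sub>i t\<^sub>j \<ge> payoff S g i \<and> payoff_with_transfers S g' j i t\<^sub>j t\<^sub>i \<ge> payoff S g j \<and>
          (payoff_with_transfers S g' i j t\<^sub>i t\<^sub>j > payoff S g i \<or> payoff_with_transfers S g' j i t\<^sub>j t\<^sub>i > payoff S g j))"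

section \<open>Cooperation bound and the two-class society\<close>

definition cooperation_ineq :: "favor_params \<Rightarrow> real \<Rightarrow> nat \<Rightarrow> bool" where
  "cooperation_ineq P c m \<longleftrightarrow>
     discount P * need_prob P * benefit P * (1 - able_prob P) ^ (m - 1) * able_prob P
       - discount P * need_prob P * c * ((1 - (1 - able_prob P) ^ m) / real m)
     \<ge> (1 - discount P) * (c - penalty P)"

definition cooperation_bound :: "favor_params \<Rightarrow> real \<Rightarrow> nat" where
  "cooperation_bound P c =
     (THE B. (\<forall>m. 1 \<le> m \<and> m \<le> B \<longrightarrow> cooperation_ineq P c m) \<and>
             (\<forall>m>B. \<not> cooperation_ineq P c m))"

definition c_tilde :: "favor_params \<Rightarrow> real \<Rightarrow> real" where
  "c_tilde P c\<^sub>p =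
     Inf {c \<in> {0..c\<^sub>p}. penalty P < c \<and> cooperation_bound P c = cooperation_bound P c\<^sub>p}"

definition rich_poor_society ::
  "favor_params \<Rightarrow> real \<Rightarrow> real \<Rightarrow> 'a set \<Rightarrow> 'a set \<Rightarrow> 'a society \<Rightarrow> bool" where
  "rich_poor_society P c\<^sub>r c\<^sub>p N\<^sub>r N\<^sub>p S \<longleftrightarrow>
     valid_society S \<and> favor_params.truncate S = P \<and>
     players S = N\<^sub>r \<union> N\<^sub>p \<and> N\<^sub>r \<inter> N\<^sub>p = {} \<and>
     (\<forall>i\<in>N\<^sub>r. cost S i = c\<^sub>r) \<and> (\<forall>i\<in>N\<^sub>p. cost S i = c\<^sub>p)"

end

(*
Deleting a link ij changes the payoff of i by alpha (v q^(d_i - 1) p - c_i share d_j), where q = 1 - p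
and share d = (1 - q^d)/d, since only the degree of j enters the rate at which j asks i for favors.

Necessity. In a bilateral equilibrium i may refuse the first favor to j and drop the link; every other
pair of players then sees bilateral histories that also occur on the equilibrium path and keeps
cooperating, so every link of a stable network is sustainable. As surplus c a b decreases in a and
increases in b, the larger of the two degrees at a link is at most the cooperation bound of its owner.

Sufficiency. If all degrees equal B, bilateral grim trigger strategies form an equilibrium. Beliefs are
limits under equally likely independent trembles, hence supported on the nodes that need the fewest
trembles; in those nodes no link among the other players has been damaged, so all remaining partners
have degree B, and the number of own links in good standing is the state of a decision problem in
which cooperating is optimal.

Strong stability. Two unlinked rich players can gain jointly from linking (after dropping at most one
link each) unless both have B(c_r) links, all to players with B(c_r) links; transfers divide the gain.
Without transfers the same argument applies to unlinked players of equal cost with equal degrees, so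
the exceptional players fall into boundedly many cliques of bounded size.
*)

theory Submission
  imports Defs
begin

section \<open>The cooperation bound\<close>

text \<open>Necessity is argued in period 0 only. There the information set that is reached keeps
  positive probability in the limit, so every consistent belief can be pinned down: trembles at the
  link stage vanish.

  The obstacle to sufficiency is that a player does not observe the other links of her partners, on
  which their request rates depend. It is met by comparing a node with its replica in which nothing
  happened outside the player's own links: the information is the same, and the replica needs no
  more trembles. Since several players may ask at once, many refusals in one period have to be
  weighed against many lost bonds; it is enough that each further lost bond costs at least
  \<open>c - \<gamma>\<close>.

  The cost order enters through the payers: their cost is lowest, so none of them can afford to
  compensate a partner who exceeds degree B. For two players of equal cost the crossed gains from a
  link have the same sum as the diagonal ones, so with transfers unequal degrees do not prevent a
  joint gain. Without transfers the comparison needs equal degrees, which is where the exceptional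
  players come from.\<close>

locale favor_exchange =
  fixes P :: "'z favor_params_scheme"
  assumes valid: "valid_params P"
begin

abbreviation "\<alpha> \<equiv> need_prob P"
abbreviation "p \<equiv> able_prob P"
abbreviation "q \<equiv> 1 - able_prob P"
abbreviation "\<delta> \<equiv> discount P"
abbreviation "v \<equiv> benefit P"
abbreviation "\<gamma> \<equiv> penalty P"

lemma params: "0 < \<alpha>" "\<alpha> \<le> 1" "0 < p" "p < 1" "0 < \<delta>" "\<delta> < 1" "0 \<le> \<gamma>"
  using valid by (auto simp: valid_params_def)

section \<open>Request rates and the net value of a single link\<close>

definition share :: "nat \<Rightarrow> real" where
  "share d = (1 - q ^ d) / real d"

text \<open>Discounted flow lost with one link minus the one-time saving from a refusal, multiplied
  by \<open>1 - \<delta>\<close> to avoid a quotient. The owner's degree \<open>a\<close> sets her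
  marginal benefit, the partner's degree \<open>b\<close> the rate of requests; the diagonal
  \<open>a = b\<close> is \<open>cooperation_ineq\<close>.\<close>

definition surplus :: "real \<Rightarrow> nat \<Rightarrow> nat \<Rightarrow> real" where
  "surplus c a b = \<delta> * (\<alpha> * (v * q ^ (a - 1) * p - c * share b)) - (1 - \<delta>) * (c - \<gamma>)"

lemma geometric_sum: "1 - q ^ d = p * (\<Sum>k<d. q ^ k)"
  using one_diff_power_eq[of q d] by simp

lemma power_Suc_diff: "q ^ d - q ^ Suc d = q ^ d * p"
  by (simp add: algebra_simps)

lemma mult_share: "real d * share d = 1 - q ^ d"
  by (cases "d = 0") (auto simp: share_def)

lemma share_pos: "0 < d \<Longrightarrow> 0 < share d"
  using params power_strict_decreasing[of 0 d q] by (auto simp: share_def intro!: divide_pos_pos)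

lemma share_nonneg: "0 \<le> share d"
  using share_pos[of d] by (cases "d = 0") (auto simp: share_def)

text \<open>Up to the factor \<open>p\<close>, \<open>share d\<close> is the mean of the first
  \<open>d\<close> powers of \<open>q\<close>; the next power lies below all of them and lowers the
  mean.\<close>

lemma share_Suc_less:
  assumes "0 < d"
  shows "share (Suc d) < share d"
proof -
  have "real d * q ^ d < (\<Sum>k<d. q ^ k)"
  proof -
    have "(\<Sum>k<d. q ^ d) < (\<Sum>k<d. q ^ k)"
      using assms params by (intro sum_strict_mono) (auto intro!: power_strict_decreasing)
    then show ?thesis by simp
  qed
  then have "real d * (\<Sum>k<Suc d. q ^ k) < real (Suc d) * (\<Sum>k<d. q ^ k)"
    by (simp add: algebra_simps)
  then have "p * (real d * (\<Sum>k<Suc d. q ^ k)) < p * (real (Suc d) * (\<Sum>k<d. q ^ k))"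
    using params by (simp del: sum.lessThan_Suc)
  then have "(1 - q ^ Suc d) * real d < (1 - q ^ d) * real (Suc d)"
    unfolding geometric_sum by (simp add: algebra_simps del: sum.lessThan_Suc)
  then show ?thesis
    using assms unfolding share_def by (simp add: divide_simps del: power_Suc of_nat_Suc)
qed

lemma share_strict_antimono:
  assumes "0 < a" "a < b"
  shows "share b < share a"
  using assms(2)
proof (induction b)
  case (Suc b)
  then show ?case
    using share_Suc_less[of b] assms(1) by (cases "a = b") auto
qed simp

lemma share_antimono: "0 < a \<Longrightarrow> a \<le> b \<Longrightarrow> share b \<le> share a"
  using share_strict_antimono[of a b] by (cases "a = b") auto

lemma surplus_mono_right:
  assumes "0 \<le> c" "0 < b" "b \<le> b'"
  shows "surplus c a b \<le> surplus c a b'"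
  using share_antimono[OF assms(2,3)] params assms
  by (auto simp: surplus_def intro!: mult_left_mono)

lemma surplus_antimono_left:
  assumes "a \<le> a'" "0 \<le> v"
  shows "surplus c a' b \<le> surplus c a b"
proof -
  have "q ^ (a' - 1) \<le> q ^ (a - 1)"
    using assms params by (intro power_decreasing) auto
  then show ?thesis
    using params assms by (auto simp: surplus_def intro!: mult_left_mono mult_right_mono)
qed

lemma surplus_antimono_cost:
  assumes "c \<le> c'"
  shows "surplus c' a b \<le> surplus c a b"
proof -
  have "c * share b \<le> c' * share b" "(1 - \<delta>) * (c - \<gamma>) \<le> (1 - \<delta>) * (c' - \<gamma>)"
    using assms share_nonneg params by (auto intro: mult_left_mono mult_right_mono)
  then have "\<delta> * (\<alpha> * (v * q ^ (a - 1) * p - c' * share b)) \<le> \<delta> * (\<alpha> * (v * q ^ (a - 1) * p - c * share b))"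
    using params by (auto intro!: mult_left_mono)
  then show ?thesis using \<open>(1 - \<delta>) * (c - \<gamma>) \<le> _\<close> by (simp add: surplus_def)
qed

lemma surplus_nonneg_iff:
  "0 \<le> surplus c a b \<longleftrightarrow> (1 - \<delta>) / \<delta> * (c - \<gamma>) \<le> \<alpha> * (v * q ^ (a - 1) * p - c * share b)"
  using params by (simp add: surplus_def field_simps)

lemma cooperation_ineq_iff:
  "cooperation_ineq (favor_params.truncate P) c m \<longleftrightarrow> 0 \<le> surplus c m m"
  by (simp add: cooperation_ineq_def surplus_def share_def favor_params.truncate_def algebra_simps)

text \<open>Monotonicity alone does not decide the sign: at the smaller degree the own marginal
  benefit is larger, but the partner also asks more often. Nonnegativity at \<open>Suc m\<close>
  puts benefit above cost there. Passing to \<open>m\<close> then raises the benefit by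
  \<open>v * q ^ (m - 1) * p * p\<close> and the cost by at most
  \<open>c * p * share (Suc m)\<close>, which is no more.\<close>

lemma surplus_diag_pred:
  assumes "\<gamma> < c" "0 < m" "0 \<le> surplus c (Suc m) (Suc m)"
  shows "0 \<le> surplus c m m"
proof -
  define \<Sigma> where "\<Sigma> = (\<Sum>k<m. q ^ k)"
  have c: "0 < c" using assms params by linarith
  have \<Sigma>0: "0 \<le> \<Sigma>" unfolding \<Sigma>_def using params by (auto intro!: sum_nonneg)
  have "(1 - \<delta>) / \<delta> * (c - \<gamma>) > 0" using assms params by simp
  with assms(3) have "0 < \<alpha> * (v * q ^ (Suc m - 1) * p - c * share (Suc m))"
    unfolding surplus_nonneg_iff by linarith
  then have A: "c * share (Suc m) < v * q ^ m * p"
    using params by (simp add: zero_less_mult_iff)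
  have "q ^ m \<ge> 0" using params by simp
  have sh: "share m = p * \<Sigma> / m" "share (Suc m) = p * (\<Sigma> + q ^ m) / (real m + 1)"
    unfolding share_def geometric_sum by (simp_all add: \<Sigma>_def)
  \<comment> \<open>In terms of \<open>share\<close> this bounds the change in one step by
    \<open>p * share (Suc m)\<close>. Termwise, \<open>q ^ k - q ^ m\<close> is \<open>q ^ k\<close>
    times \<open>1 - q ^ (m - k)\<close>, and Bernoulli's inequality bounds the second factor by
    \<open>p * m\<close>.\<close>
  have B: "\<Sigma> - real m * q ^ m \<le> p * (real m * \<Sigma>)"
  proof -
    have "\<Sigma> - real m * q ^ m = (\<Sum>k<m. q ^ k - q ^ m)" by (simp add: \<Sigma>_def sum_subtractf)
    also have "\<dots> \<le> (\<Sum>k<m. p * (real m * q ^ k))"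
    proof (rule sum_mono)
      fix k assume k: "k \<in> {..<m}"
      have "q ^ k - q ^ m = q ^ k * (1 - q ^ (m - k))"
        using k by (simp add: algebra_simps flip: power_add)
      also have "1 - q ^ (m - k) \<le> p * real (m - k)"
      proof -
        have "(\<Sum>j<m-k. q ^ j) \<le> (\<Sum>j<m-k. 1)"
          using params by (intro sum_mono power_le_one) auto
        then show ?thesis unfolding geometric_sum using params by (intro mult_left_mono) auto
      qed
      also have "p * real (m - k) \<le> p * real m" using params by simp
      finally show "q ^ k - q ^ m \<le> p * (real m * q ^ k)"
        using params by (simp add: mult_left_mono algebra_simps)
    qed
    also have "\<dots> = p * (real m * \<Sigma>)" by (simp add: \<Sigma>_def sum_distrib_left)
    finally show ?thesis .
  qed
  have "share m - share (Suc m) = p * ((\<Sigma> - real m * q ^ m) / (real m * (real m + 1)))"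
    unfolding sh using assms by (simp add: field_simps)
  also have "\<dots> \<le> p * (p * (real m * \<Sigma>) / (real m * (real m + 1)))"
    using B params by (intro mult_left_mono divide_right_mono) auto
  also have "\<dots> = p * (p * \<Sigma> / (real m + 1))" using assms by simp
  also have "\<dots> \<le> p * share (Suc m)"
    unfolding sh using params \<open>q ^ m \<ge> 0\<close> by (intro mult_left_mono divide_right_mono) auto
  finally have C: "share m - share (Suc m) \<le> p * share (Suc m)" .
  obtain k where k: "m = Suc k" using assms by (cases m) auto
  have "v * q ^ k * p * q > c * share (Suc m)" using A k by (simp add: mult_ac)
  moreover have "c * share (Suc m) \<ge> c * share (Suc m) * q"
    using c share_nonneg[of "Suc m"] params by (intro mult_right_le_one_le) auto
  ultimately have "v * q ^ k * p * q > c * share (Suc m) * q" by linarith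
  then have "v * q ^ k * p > c * share (Suc m)"
    using params by (simp add: mult_less_cancel_right)
  then have "v * q ^ k * p * p \<ge> c * (p * share (Suc m))"
    using params by (simp add: mult_ac)
  also have "c * (p * share (Suc m)) \<ge> c * (share m - share (Suc m))"
    using C c by (intro mult_left_mono) auto
  finally have "v * q ^ k * p - c * share m \<ge> v * q ^ m * p - c * share (Suc m)"
    by (simp add: k algebra_simps)
  then have "\<alpha> * (v * q ^ (m - 1) * p - c * share m) \<ge> \<alpha> * (v * q ^ (Suc m - 1) * p - c * share (Suc m))"
    using params k by (intro mult_left_mono) auto
  then show ?thesis using assms(3) unfolding surplus_nonneg_iff by linarith
qed

text \<open>The marginal benefit decays geometrically while
  \<open>(1 - \<delta>) * (c - \<gamma>)\<close> stays a positive constant; the strict inequality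
  \<open>\<gamma> < c\<close> is what makes the bound finite.\<close>

lemma surplus_diag_eventually_neg:
  assumes "\<gamma> < c"
  shows "\<forall>\<^sub>F m in sequentially. surplus c m m < 0"
proof -
  have "(\<lambda>m. \<delta> * (\<alpha> * (v * q ^ m * p))) \<longlonglongrightarrow> \<delta> * (\<alpha> * (v * 0 * p))"
    using params by (intro tendsto_intros LIMSEQ_power_zero) auto
  moreover have "0 < (1 - \<delta>) * (c - \<gamma>)" using assms params by simp
  ultimately have "\<forall>\<^sub>F m in sequentially. \<delta> * (\<alpha> * (v * q ^ m * p)) < (1 - \<delta>) * (c - \<gamma>)"
    using order_tendstoD(2)[of _ "\<delta> * (\<alpha> * (v * 0 * p))"] by force
  then have "\<forall>\<^sub>F m in sequentially. surplus c (Suc m) (Suc m) < 0"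
  proof eventually_elim
    case (elim m)
    have "0 \<le> \<delta> * (\<alpha> * (c * share (Suc m)))"
      using share_nonneg[of "Suc m"] params assms by simp
    then show ?case using elim by (simp add: surplus_def algebra_simps)
  qed
  then show ?thesis by (rule eventually_sequentially_Suc[THEN iffD1])
qed

definition bound :: "real \<Rightarrow> nat" where
  "bound c = cooperation_bound (favor_params.truncate P) c"

text \<open>By \<open>surplus_diag_pred\<close> and eventual negativity the nonnegative indices form
  a finite initial segment, so the definite description in \<open>cooperation_bound\<close> denotes
  its end.\<close>

lemma surplus_diag_nonneg_iff:
  assumes "\<gamma> < c" "0 < m"
  shows "0 \<le> surplus c m m \<longleftrightarrow> m \<le> bound c"
proof -
  \<comment> \<open>Zero is counted in so that \<open>Greatest\<close> is meaningful even if no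
    positive degree qualifies; the bound is then 0.\<close>
  define Q where "Q m \<longleftrightarrow> m = 0 \<or> 0 \<le> surplus c m m" for m
  obtain M where M: "\<And>m. M \<le> m \<Longrightarrow> surplus c m m < 0"
    using surplus_diag_eventually_neg[OF assms(1)] unfolding eventually_sequentially by blast
  have bdd: "Q m \<Longrightarrow> m \<le> M" for m using M[of m] unfolding Q_def by force
  define B where "B = Greatest Q"
  have QB: "Q B" unfolding B_def using bdd by (intro GreatestI_nat[of Q 0 M]) (auto simp: Q_def)
  have le: "Q m \<Longrightarrow> m \<le> B" for m unfolding B_def using bdd by (intro Greatest_le_nat[of Q m M]) auto
  have down: "Q (Suc m) \<Longrightarrow> Q m" for m
    using surplus_diag_pred[OF assms(1), of m] unfolding Q_def by auto
  have QI: "Q m" if "m \<le> B" for m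
    using that QB by (induction rule: inc_induct) (auto intro: down)
  have "bound c = B"
    unfolding bound_def cooperation_bound_def cooperation_ineq_iff
  proof (rule the_equality)
    show "(\<forall>m. 1 \<le> m \<and> m \<le> B \<longrightarrow> 0 \<le> surplus c m m) \<and> (\<forall>m>B. \<not> 0 \<le> surplus c m m)"
      using QI le unfolding Q_def by force
    fix B' assume B': "(\<forall>m. 1 \<le> m \<and> m \<le> B' \<longrightarrow> 0 \<le> surplus c m m) \<and> (\<forall>m>B'. \<not> 0 \<le> surplus c m m)"
    show "B' = B"
    proof (rule ccontr)
      assume "B' \<noteq> B"
      then consider "B' < B" | "B < B'" by linarith
      then show False
      proof cases
        case 1 then show ?thesis using B' QB unfolding Q_def by force
      next
        case 2 then show ?thesis using B' le[of B'] unfolding Q_def by force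
      qed
    qed
  qed
  then show ?thesis using QI[of m] le[of m] assms(2) unfolding Q_def by auto
qed

section \<open>Dependence of the bound on the cost\<close>

lemma bound_antimono:
  assumes "\<gamma> < c" "c \<le> c'"
  shows "bound c' \<le> bound c"
proof (cases "bound c' = 0")
  case False
  then have "0 \<le> surplus c' (bound c') (bound c')"
    using surplus_diag_nonneg_iff[of c' "bound c'"] assms by auto
  also have "\<dots> \<le> surplus c (bound c') (bound c')"
    by (rule surplus_antimono_cost) (use assms in auto)
  finally show ?thesis using surplus_diag_nonneg_iff[of c "bound c'"] False assms by auto
qed simp

text \<open>The infimum supplies a cost \<open>x\<close> below \<open>c\<close> whose bound is that
  of \<open>c'\<close>. As \<open>c\<close> lies between \<open>x\<close> and \<open>c'\<close>,
  antitonicity leaves no other value.\<close>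

lemma bound_eq_of_c_tilde_less:
  assumes "\<gamma> < c" "c < c'" "c_tilde (favor_params.truncate P) c' < c"
  shows "bound c = bound c'"
proof -
  let ?X = "{c \<in> {0..c'}. \<gamma> < c \<and> bound c = bound c'}"
  have "c_tilde (favor_params.truncate P) c' = Inf ?X"
    by (simp add: c_tilde_def bound_def favor_params.truncate_def)
  moreover have "?X \<noteq> {}" using assms params by (auto intro!: exI[of _ c'])
  ultimately obtain x where "x \<in> ?X" "x < c"
    using assms(3) cInf_lessD[of ?X c] by auto
  then show ?thesis using bound_antimono[of x c] bound_antimono[of c c'] assms by auto
qed

lemma bound_less_of_less_c_tilde:
  assumes "\<gamma> < c" "c < c'" "c < c_tilde (favor_params.truncate P) c'"
  shows "bound c' < bound c"
proof -
  let ?X = "{c \<in> {0..c'}. \<gamma> < c \<and> bound c = bound c'}"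
  have "c_tilde (favor_params.truncate P) c' = Inf ?X"
    by (simp add: c_tilde_def bound_def favor_params.truncate_def)
  moreover have "bdd_below ?X" by (rule bdd_belowI[of _ 0]) auto
  ultimately have "c \<notin> ?X" using assms(3) cInf_lower[of c ?X] by auto
  then have "bound c \<noteq> bound c'" using assms params by auto
  then show ?thesis using bound_antimono[of c c'] assms by auto
qed

end

lemma truncate_favor_params [simp]: "favor_params.truncate (P :: favor_params) = P"
  by (simp add: favor_params.truncate_def)

section \<open>Networks\<close>

lemma mem_nbrs_iff: "j \<in> nbrs g i \<longleftrightarrow> {i, j} \<in> g \<and> j \<noteq> i"
  by (simp add: nbrs_def)

lemma mem_nbrs_commute: "j \<in> nbrs g i \<longleftrightarrow> i \<in> nbrs g j"
  by (auto simp: nbrs_def insert_commute)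

lemma network_on_mono: "network_on N g \<Longrightarrow> h \<subseteq> g \<Longrightarrow> network_on N h"
  by (auto simp: network_on_def)

lemma network_on_linkD: "network_on N g \<Longrightarrow> {i, j} \<in> g \<Longrightarrow> i \<in> N \<and> j \<in> N \<and> i \<noteq> j"
  unfolding network_on_def by (force simp: doubleton_eq_iff)

lemma network_on_linkE:
  assumes "network_on N g" "l \<in> g"
  obtains i j where "l = {i, j}" "i \<in> N" "j \<in> N" "i \<noteq> j"
  using assms unfolding network_on_def by blast

lemma nbrs_subset: "network_on N g \<Longrightarrow> nbrs g i \<subseteq> N - {i}"
  using network_on_linkD[of N g i] by (auto simp: nbrs_def)

lemma finite_nbrs: "network_on N g \<Longrightarrow> finite N \<Longrightarrow> finite (nbrs g i)"
  using nbrs_subset[of N g i] finite_subset by blast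

lemma nbrs_mono: "g \<subseteq> h \<Longrightarrow> nbrs g i \<subseteq> nbrs h i"
  by (auto simp: nbrs_def)

lemma network_eqI:
  assumes "network_on N g" "network_on N h" "\<And>i. i \<in> N \<Longrightarrow> nbrs g i = nbrs h i"
  shows "g = h"
proof (intro set_eqI iffI)
  fix l assume "l \<in> g"
  then show "l \<in> h" using assms
    by (metis mem_nbrs_iff network_on_linkE[OF assms(1)])
next
  fix l assume "l \<in> h"
  then show "l \<in> g" using assms
    by (metis mem_nbrs_iff network_on_linkE[OF assms(2)])
qed

lemma link_remaining_iff: "{a, b} \<in> remaining g k \<longleftrightarrow> {a, b} \<in> g \<and> k (a, b) \<and> k (b, a)"
  unfolding remaining_def by (auto simp: doubleton_eq_iff)

lemma remaining_subset: "remaining g k \<subseteq> g"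
  by (auto simp: remaining_def)

lemma nbrs_remaining: "nbrs (remaining g k) i = {j \<in> nbrs g i. k (i, j) \<and> k (j, i)}"
  by (auto simp: nbrs_def link_remaining_iff)

lemma remaining_True [simp]: "remaining g (\<lambda>_. True) = g"
  by (simp add: remaining_def)

lemma current_network_subset: "current_network g H \<subseteq> g"
  by (induction H) (use remaining_subset in fastforce)+

lemma network_on_current: "network_on N g \<Longrightarrow> network_on N (current_network g H)"
  using network_on_mono current_network_subset by blast

lemma network_on_remaining: "network_on N g \<Longrightarrow> network_on N (remaining g k)"
  using network_on_mono remaining_subset by blast

section \<open>Requests and favors\<close>

lemma expectation_bind_pmf:
  fixes f :: "'b \<Rightarrow> real"
  assumes "\<And>y. \<bar>f y\<bar> \<le> C"
  shows "measure_pmf.expectation (bind_pmf M N) f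
    = measure_pmf.expectation M (\<lambda>x. measure_pmf.expectation (N x) f)"
  unfolding measure_pmf_bind
  by (rule integral_bind[where K = "count_space UNIV" and B = C and B' = 1])
     (use assms in \<open>auto simp: measure_pmf.finite_measure_axioms measure_pmf_in_subprob_algebra measure_pmf.emeasure_le_1\<close>)

lemma integrable_bounded_pmf:
  fixes f :: "'b \<Rightarrow> real"
  assumes "\<And>y. \<bar>f y\<bar> \<le> C"
  shows "integrable (measure_pmf M) f"
  by (rule measure_pmf.integrable_const_bound[where B = C]) (use assms in auto)

lemma expectation_of_bool: "measure_pmf.expectation M (\<lambda>x. of_bool (Q x) :: real) = measure_pmf.prob M {x. Q x}"
proof -
  have "(\<lambda>x. of_bool (Q x) :: real) = indicator {x. Q x}" by (auto simp: fun_eq_iff)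
  then show ?thesis by simp
qed

locale favor_society =
  fixes S :: "'a society"
  assumes valid_society: "valid_society S"
begin

sublocale favor_exchange S
  using valid_society by unfold_locales (simp add: valid_society_def)

lemma finite_players: "finite (players S)"
  using valid_society by (simp add: valid_society_def)

lemma cost_bounds: "i \<in> players S \<Longrightarrow> \<gamma> < cost S i \<and> cost S i < v"
  using valid_society by (simp add: valid_society_def)

lemma request_subset: "R \<in> set_pmf (request_law S) \<Longrightarrow> R \<subseteq> players S"
  using valid_society by (auto simp: valid_society_def)

lemma request_prob: "i \<in> players S \<Longrightarrow> measure_pmf.prob (request_law S) {R. i \<in> R} = \<alpha>"
  using valid_society by (auto simp: valid_society_def)

lemma favor_prob_eq: "favor_prob S g x = \<alpha> * share (deg g x)"
  by (simp add: favor_prob_def share_def)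

abbreviation network :: "'a network \<Rightarrow> bool" where
  "network g \<equiv> network_on (players S) g"

lemmas nbrs_finite = finite_nbrs[OF _ finite_players]

section \<open>Law of the selected provider\<close>

abbreviation "able_law i \<equiv> Pi_pmf (players S - {i}) False (\<lambda>_. bernoulli_pmf p)"

lemma pmf_provider_None:
  assumes "network g"
  shows "pmf (provider_law S g i) None = q ^ deg g i"
proof -
  let ?N = "nbrs g i"
  have fin: "finite (players S - {i})" "finite ?N" and sub: "?N \<subseteq> players S - {i}"
    using finite_players nbrs_finite[OF assms] nbrs_subset[OF assms] by auto
  have "pmf (provider_law S g i) None
      = measure_pmf.expectation (able_law i) (\<lambda>able. of_bool (\<forall>j\<in>?N. \<not> able j))"
    unfolding provider_law_def pmf_bind
    by (rule Bochner_Integration.integral_cong)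
       (auto simp: Let_def pmf_eq_0_set_pmf fin set_pmf_of_set)
  also have "\<dots> = measure_pmf.prob (able_law i)
      (Pi (players S - {i}) (\<lambda>j. if j \<in> ?N then {False} else UNIV))"
    unfolding expectation_of_bool
    by (rule arg_cong[where f = "measure_pmf.prob _"]) (use sub in \<open>auto simp: Pi_def\<close>)
  also have "\<dots> = (\<Prod>j\<in>players S - {i}. if j \<in> ?N then q else 1)"
    unfolding measure_Pi_pmf_Pi[OF fin(1)]
    by (rule prod.cong) (use params in \<open>auto simp: measure_pmf_single\<close>)
  also have "\<dots> = (\<Prod>j\<in>?N. q)"
    by (subst prod.inter_restrict[OF fin(1), symmetric]) (use sub in \<open>simp add: Int_absorb1\<close>)
  finally show ?thesis by (simp add: deg_def)
qed

lemma set_provider_subset: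
  assumes "network g"
  shows "set_pmf (provider_law S g i) \<subseteq> insert None (Some ` nbrs g i)"
  using nbrs_finite[OF assms] by (auto simp: provider_law_def Let_def set_pmf_of_set split: if_splits)

text \<open>Transposing two neighbors preserves both the law of abilities and the uniform choice.
  Together with the probability that nobody is able, this symmetry yields \<open>share\<close>
  without a sum over all sets of able players.\<close>

lemma pmf_provider_exchange:
  assumes "network g" "j \<in> nbrs g i" "j' \<in> nbrs g i"
  shows "pmf (provider_law S g i) (Some j) = pmf (provider_law S g i) (Some j')"
proof -
  define \<pi> where "\<pi> = Transposition.transpose j j'"
  let ?N = "nbrs g i" let ?A = "\<lambda>able. {j \<in> ?N. able j}"
  have jj: "j \<in> players S - {i}" "j' \<in> players S - {i}"
    using assms nbrs_subset by fast+
  have fin: "finite ?N" using nbrs_finite[OF assms(1)] .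
  have "able_law i = map_pmf (\<lambda>able. able \<circ> \<pi>) (able_law i)"
  proof (rule Pi_pmf_bij_betw)
    show "bij_betw \<pi> (players S - {i}) (players S - {i})"
      by (rule bij_betw_byWitness[where f' = \<pi>])
         (use jj in \<open>auto simp: \<pi>_def Transposition.transpose_def\<close>)
  qed (use jj finite_players in \<open>auto simp: \<pi>_def Transposition.transpose_def split: if_splits\<close>)
  then have "provider_law S g i = bind_pmf (map_pmf (\<lambda>able. able \<circ> \<pi>) (able_law i)) (\<lambda>able.
      if ?A able = {} then return_pmf None else map_pmf Some (pmf_of_set (?A able)))"
    unfolding provider_law_def Let_def by simp
  also have "\<dots> = map_pmf (map_option \<pi>) (provider_law S g i)"
    unfolding provider_law_def Let_def map_bind_pmf bind_map_pmf
  proof (rule bind_pmf_cong[OF refl])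
    fix able
    have A: "?A (able \<circ> \<pi>) = \<pi> ` ?A able"
    proof (intro set_eqI iffI)
      fix x assume "x \<in> ?A (able \<circ> \<pi>)"
      then have "\<pi> x \<in> ?A able" "x = \<pi> (\<pi> x)"
        using assms by (auto simp: \<pi>_def Transposition.transpose_def)
      then show "x \<in> \<pi> ` ?A able" by blast
    qed (use assms in \<open>auto simp: \<pi>_def Transposition.transpose_def\<close>)
    show "(if ?A (able \<circ> \<pi>) = {} then return_pmf None else map_pmf Some (pmf_of_set (?A (able \<circ> \<pi>))))
      = map_pmf (map_option \<pi>)
          (if ?A able = {} then return_pmf None else map_pmf Some (pmf_of_set (?A able)))"
    proof (cases "?A able = {}")
      case False
      have "inj_on \<pi> (?A able)" by (auto simp: \<pi>_def inj_on_def transpose_eq_iff)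
      then have "map_pmf \<pi> (pmf_of_set (?A able)) = pmf_of_set (\<pi> ` ?A able)"
        using False fin by (intro map_pmf_of_set_inj) auto
      then have "map_pmf Some (pmf_of_set (\<pi> ` ?A able)) = map_pmf (\<lambda>x. Some (\<pi> x)) (pmf_of_set (?A able))"
        by (metis map_pmf_comp)
      moreover have "\<pi> ` ?A able \<noteq> {}" using False by blast
      ultimately show ?thesis using False unfolding A by (simp only: if_False map_pmf_comp option.map)
    qed (simp only: A image_empty simp_thms if_True map_return_pmf option.map)
  qed
  finally have "pmf (provider_law S g i) (Some j')
      = pmf (map_pmf (map_option \<pi>) (provider_law S g i)) (map_option \<pi> (Some j))"
    by (simp add: \<pi>_def)
  also have "\<dots> = pmf (provider_law S g i) (Some j)"
    by (rule pmf_map_inj') (auto intro!: option.inj_map simp: \<pi>_def)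
  finally show ?thesis ..
qed

lemma pmf_provider_Some:
  assumes "network g" "j \<in> nbrs g i"
  shows "pmf (provider_law S g i) (Some j) = share (deg g i)"
proof -
  have fin: "finite (nbrs g i)" using nbrs_finite[OF assms(1)] .
  have "1 = (\<Sum>x\<in>insert None (Some ` nbrs g i). pmf (provider_law S g i) x)"
    by (rule sum_pmf_eq_1[symmetric]) (use fin set_provider_subset[OF assms(1)] in auto)
  also have "\<dots> = q ^ deg g i + (\<Sum>j'\<in>nbrs g i. pmf (provider_law S g i) (Some j'))"
    using fin by (simp add: pmf_provider_None[OF assms(1)] sum.reindex)
  also have "\<dots> = q ^ deg g i + real (deg g i) * pmf (provider_law S g i) (Some j)"
    using pmf_provider_exchange[OF assms(1) _ assms(2)] by (simp add: deg_def)
  finally have "real (deg g i) * pmf (provider_law S g i) (Some j) = 1 - q ^ deg g i" by simp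
  moreover have "0 < deg g i" using assms fin by (auto simp: deg_def card_gt_0_iff)
  ultimately show ?thesis unfolding share_def by (simp add: eq_divide_eq mult.commute)
qed

lemma set_provider_law:
  assumes "network g"
  shows "set_pmf (provider_law S g i) = insert None (Some ` nbrs g i)"
proof -
  have "Some j \<in> set_pmf (provider_law S g i)" if "j \<in> nbrs g i" for j
  proof -
    have "0 < deg g i" using that nbrs_finite[OF assms] by (auto simp: deg_def card_gt_0_iff)
    then show ?thesis
      using pmf_provider_Some[OF assms that] share_pos[of "deg g i"] by (simp add: set_pmf_iff)
  qed
  moreover have "None \<in> set_pmf (provider_law S g i)"
    using pmf_provider_None[OF assms] params by (simp add: set_pmf_iff)
  ultimately show ?thesis using set_provider_subset[OF assms] by auto
qed

section \<open>Joint realizations of the favors of one period\<close>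

lemma set_nature:
  assumes "network g"
  shows "f \<in> set_pmf (nature S g) \<longleftrightarrow>
    (\<exists>R\<in>set_pmf (request_law S). dom f \<subseteq> R \<and> (\<forall>r j. f r = Some j \<longrightarrow> j \<in> nbrs g r))"
proof -
  have fin: "finite R" if "R \<in> set_pmf (request_law S)" for R
    using request_subset[OF that] finite_players finite_subset by blast
  have "f \<in> PiE_dflt R None (set_pmf \<circ> provider_law S g) \<longleftrightarrow>
      dom f \<subseteq> R \<and> (\<forall>r j. f r = Some j \<longrightarrow> j \<in> nbrs g r)" for R
    unfolding PiE_dflt_def o_def set_provider_law[OF assms] mem_Collect_eq
  proof (intro iffI conjI allI impI subsetI)
    fix r j assume *: "\<forall>x. (x \<in> R \<longrightarrow> f x \<in> insert None (Some ` nbrs g x)) \<and> (x \<notin> R \<longrightarrow> f x = None)"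
    { assume "f r = Some j"
      with * have "Some j \<in> insert None (Some ` nbrs g r)" by (metis option.distinct(1))
      then show "j \<in> nbrs g r" by auto }
    { assume "r \<in> dom f" with * show "r \<in> R" by (cases "r \<in> R") auto }
  next
    fix r assume *: "dom f \<subseteq> R \<and> (\<forall>r j. f r = Some j \<longrightarrow> j \<in> nbrs g r)"
    then show "f r \<in> insert None (Some ` nbrs g r)" by (cases "f r") auto
    show "f r = None" if "r \<notin> R" using that * by (cases "f r") auto
  qed
  then show ?thesis using fin unfolding nature_def set_bind_pmf by (simp add: set_Pi_pmf)
qed

text \<open>A requester may always find no able neighbor, because \<open>able_prob\<close> is below
  1. This allows a possible realization to be thinned out when a history is replaced by one in which
  some favors never arose.\<close>

lemma nature_erase:
  assumes "network g" "f \<in> set_pmf (nature S g)" "\<And>r. f' r = f r \<or> f' r = None"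
  shows "f' \<in> set_pmf (nature S g)"
proof -
  have eq: "f r = Some j" if "f' r = Some j" for r j using assms(3)[of r] that by auto
  then have "dom f' \<subseteq> dom f" by auto
  then show ?thesis using assms(2) eq unfolding set_nature[OF assms(1)] by (meson order_trans)
qed

lemma nature_mono:
  assumes "network g" "h \<subseteq> g" "f \<in> set_pmf (nature S h)"
  shows "f \<in> set_pmf (nature S g)"
  using assms(3) nbrs_mono[OF assms(2)]
  unfolding set_nature[OF assms(1)] set_nature[OF network_on_mono[OF assms(1,2)]] by (meson subsetD)

lemma nature_request:
  assumes "network g" "f \<in> set_pmf (nature S g)" "f r = Some j"
  shows "r \<in> players S" "j \<in> nbrs g r" "r \<in> nbrs g j" "j \<in> players S" "r \<noteq> j"
proof -
  show 1: "r \<in> players S"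
    using assms(2,3) request_subset unfolding set_nature[OF assms(1)] by (meson domI subsetD)
  show 2: "j \<in> nbrs g r"
    using assms(2,3) unfolding set_nature[OF assms(1)] by auto
  then show 3: "r \<in> nbrs g j" "r \<noteq> j" by (auto simp: mem_nbrs_commute mem_nbrs_iff)
  show "j \<in> players S" using 2 nbrs_subset[OF assms(1)] by auto
qed

lemma nature_dom_finite:
  assumes "network g" "f \<in> set_pmf (nature S g)"
  shows "finite (dom f)"
  by (rule finite_subset[OF _ finite_players]) (use nature_request(1)[OF assms] in blast)

lemma prob_nature:
  assumes "network g" "r \<in> players S"
  shows "measure_pmf.prob (nature S g) {f. f r = Some j} = (if j \<in> nbrs g r then \<alpha> * share (deg g r) else 0)"
proof -
  have "map_pmf (\<lambda>f. f r) (nature S g) =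
      bind_pmf (request_law S) (\<lambda>R. if r \<in> R then provider_law S g r else return_pmf None)"
    unfolding nature_def map_bind_pmf
    by (rule bind_pmf_cong[OF refl], rule Pi_pmf_component)
       (use request_subset finite_players finite_subset in blast)
  moreover have "(\<lambda>R. pmf (if r \<in> R then provider_law S g r else return_pmf None) (Some j))
      = (\<lambda>R. of_bool (r \<in> R) * pmf (provider_law S g r) (Some j))"
    by auto
  ultimately have "pmf (map_pmf (\<lambda>f. f r) (nature S g)) (Some j) =
      measure_pmf.expectation (request_law S) (\<lambda>R. of_bool (r \<in> R) * pmf (provider_law S g r) (Some j))"
    by (simp only: pmf_bind)
  also have "\<dots> = \<alpha> * pmf (provider_law S g r) (Some j)"
    by (simp add: expectation_of_bool request_prob[OF assms(2)])
  also have "pmf (provider_law S g r) (Some j) = (if j \<in> nbrs g r then share (deg g r) else 0)"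
    using pmf_provider_Some[OF assms(1)] set_provider_law[OF assms(1), of r] by (auto simp: pmf_eq_0_set_pmf)
  finally show ?thesis by (simp add: pmf_map vimage_def)
qed

lemma exists_request:
  assumes "network g" "j \<in> nbrs g r"
  shows "\<exists>f\<in>set_pmf (nature S g). f r = Some j"
proof -
  have r: "r \<in> players S" using assms nbrs_subset by (fastforce simp: mem_nbrs_commute)
  have "0 < deg g r" using assms(2) nbrs_finite[OF assms(1)] by (auto simp: deg_def card_gt_0_iff)
  then have "measure_pmf.prob (nature S g) {f. f r = Some j} \<noteq> 0"
    using prob_nature[OF assms(1) r] assms(2) share_pos[of "deg g r"] params by simp
  then have "set_pmf (nature S g) \<inter> {f. f r = Some j} \<noteq> {}" by (simp add: measure_pmf_zero_iff)
  then show ?thesis by auto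
qed

definition coop_payoff :: "'a \<Rightarrow> ('a \<Rightarrow> 'a option) \<Rightarrow> real" where
  "coop_payoff i f = (if f i \<noteq> None then v else 0) - cost S i * real (card {r \<in> players S. f r = Some i})"

text \<open>Linearity of expectation reduces the claim to the single probabilities
  \<open>prob_nature\<close>, so the formula is valid for every joint law of the requests with the
  prescribed marginals.\<close>

lemma expectation_coop_payoff:
  assumes g: "network g" and i: "i \<in> players S"
  shows "measure_pmf.expectation (nature S g) (coop_payoff i) = payoff S g i"
proof -
  let ?E = "measure_pmf.expectation (nature S g)"
  have fin: "finite (nbrs g i)" using nbrs_finite[OF g] .
  have int: "integrable (measure_pmf (nature S g)) (\<lambda>f. of_bool (Q f) :: real)" for Q
    by (rule integrable_bounded_pmf[where C = 1]) auto
  have "?E (coop_payoff i) = ?E (\<lambda>f. v * (\<Sum>j\<in>nbrs g i. of_bool (f i = Some j))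
      - cost S i * (\<Sum>r\<in>players S. of_bool (f r = Some i)))"
  proof (rule integral_cong_AE)
    show "AE f in measure_pmf (nature S g). coop_payoff i f =
        v * (\<Sum>j\<in>nbrs g i. of_bool (f i = Some j)) - cost S i * (\<Sum>r\<in>players S. of_bool (f r = Some i))"
    proof (rule AE_pmfI)
      fix f assume f: "f \<in> set_pmf (nature S g)"
      have "(\<Sum>j\<in>nbrs g i. of_bool (f i = Some j)) = (if f i \<noteq> None then 1 else 0 :: real)"
      proof (cases "f i")
        case (Some l)
        then have "l \<in> nbrs g i" using nature_request(2)[OF g f] by blast
        then show ?thesis using Some fin by (simp add: of_bool_def)
      qed simp
      moreover have "(\<Sum>r\<in>players S. of_bool (f r = Some i)) = real (card {r \<in> players S. f r = Some i})"
        using finite_players by (simp add: of_bool_def sum.If_cases Int_def)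
      ultimately show "coop_payoff i f =
          v * (\<Sum>j\<in>nbrs g i. of_bool (f i = Some j)) - cost S i * (\<Sum>r\<in>players S. of_bool (f r = Some i))"
        by (simp add: coop_payoff_def)
    qed
  qed auto
  also have "\<dots> = v * (\<Sum>j\<in>nbrs g i. measure_pmf.prob (nature S g) {f. f i = Some j})
      - cost S i * (\<Sum>r\<in>players S. measure_pmf.prob (nature S g) {f. f r = Some i})"
    using int by (simp add: expectation_of_bool)
  also have "(\<Sum>j\<in>nbrs g i. measure_pmf.prob (nature S g) {f. f i = Some j}) = \<alpha> * (1 - q ^ deg g i)"
    by (simp add: prob_nature[OF g i] flip: mult_share) (simp add: deg_def)
  also have "(\<Sum>r\<in>players S. measure_pmf.prob (nature S g) {f. f r = Some i})
      = (\<Sum>r\<in>players S. if r \<in> nbrs g i then favor_prob S g r else 0)"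
    by (rule sum.cong) (auto simp: prob_nature[OF g] favor_prob_eq mem_nbrs_commute)
  also have "\<dots> = (\<Sum>r\<in>nbrs g i. favor_prob S g r)"
    using finite_players nbrs_subset[OF g, of i]
    by (intro sum.mono_neutral_cong_right) auto
  finally show ?thesis by (simp add: payoff_def)
qed

end

section \<open>Play and continuation payoffs\<close>

lemma expectation_abs_le:
  fixes h :: "'b \<Rightarrow> real"
  assumes "\<And>y. \<bar>h y\<bar> \<le> B"
  shows "\<bar>measure_pmf.expectation M h\<bar> \<le> B"
proof -
  have "integrable (measure_pmf M) (\<lambda>y. \<bar>h y\<bar>)"
    by (rule integrable_bounded_pmf[where C = B]) (use assms in auto)
  then have "\<bar>measure_pmf.expectation M h\<bar> \<le> measure_pmf.expectation M (\<lambda>_. B)"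
    using assms by (intro order_trans[OF integral_abs_bound] integral_mono) auto
  then show ?thesis by simp
qed

text \<open>Here \<open>b\<close> acts as a value function: by telescoping, the first
  \<open>N + 1\<close> terms together with \<open>d ^ Suc N * b N\<close> never exceed
  \<open>a 0 + d * b 0\<close>, and the remainder vanishes because \<open>b\<close> is
  bounded.\<close>

lemma discounted_sum_le:
  fixes a b :: "nat \<Rightarrow> real"
  assumes d: "0 < d" "d < 1" and a: "\<And>n. \<bar>a n\<bar> \<le> A" and b: "\<And>n. \<bar>b n\<bar> \<le> B"
    and step: "\<And>n. a (Suc n) + d * b (Suc n) \<le> b n"
  shows "summable (\<lambda>n. d ^ n * a n)" "(\<Sum>n. d ^ n * a n) \<le> a 0 + d * b 0"
proof -
  show sm: "summable (\<lambda>n. d ^ n * a n)"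
  proof (rule summable_comparison_test'[where N = 0])
    show "summable (\<lambda>n. d ^ n * A)" using d by (intro summable_mult2 summable_geometric) auto
    show "norm (d ^ n * a n) \<le> d ^ n * A" for n
      using a[of n] d by (auto simp: abs_mult intro!: mult_left_mono)
  qed
  have partial: "(\<Sum>n<Suc N. d ^ n * a n) + d ^ Suc N * b N \<le> a 0 + d * b 0" for N
  proof (induction N)
    case (Suc N)
    have "d ^ Suc N * (a (Suc N) + d * b (Suc N)) \<le> d ^ Suc N * b N"
      using step d by (intro mult_left_mono) auto
    then show ?case using Suc by (simp add: algebra_simps)
  qed simp
  have "(\<lambda>N. d ^ Suc N * b N) \<longlonglongrightarrow> 0"
  proof (rule Lim_null_comparison)
    show "\<forall>\<^sub>F N in sequentially. norm (d ^ Suc N * b N) \<le> d ^ Suc N * B"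
      using b d by (intro always_eventually allI) (auto simp: abs_mult intro!: mult_left_mono)
    show "(\<lambda>N. d ^ Suc N * B) \<longlonglongrightarrow> 0"
      using d by (intro tendsto_mult_left_zero LIMSEQ_Suc LIMSEQ_power_zero) auto
  qed
  moreover have "(\<lambda>N. \<Sum>n<Suc N. d ^ n * a n) \<longlonglongrightarrow> (\<Sum>n. d ^ n * a n)"
    using summable_LIMSEQ[OF sm] by (rule LIMSEQ_Suc)
  ultimately have "(\<lambda>N. (\<Sum>n<Suc N. d ^ n * a n) + d ^ Suc N * b N) \<longlonglongrightarrow> (\<Sum>n. d ^ n * a n) + 0"
    by (intro tendsto_add)
  then show "(\<Sum>n. d ^ n * a n) \<le> a 0 + d * b 0"
    using LIMSEQ_le_const2[of _ "(\<Sum>n. d ^ n * a n)" "a 0 + d * b 0"] partial by auto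
qed

lemma finish_period_Link:
  "finish_period S g \<sigma> (Link_node H) = bind_pmf (link_decisions g \<sigma> H) (\<lambda>k.
     bind_pmf (nature S (remaining (current_network g H) k)) (\<lambda>f.
       map_pmf (\<lambda>a. Period k f a # H) (favor_decisions g \<sigma> H k f)))"
  by (simp add: to_favor_node_def bind_assoc_pmf bind_map_pmf)

context favor_society
begin

section \<open>Supports of the decisions within a period\<close>

lemma finite_links: "network g \<Longrightarrow> finite {(i, j). j \<in> nbrs (current_network g H) i}"
  by (rule finite_subset[of _ "players S \<times> players S"])
     (use finite_players nbrs_subset[OF network_on_current] mem_nbrs_commute in fastforce)+

lemma set_link_decisions:
  assumes "network g"
  shows "k \<in> set_pmf (link_decisions g \<sigma> H) \<longleftrightarrow>
    (\<forall>i j. if j \<in> nbrs (current_network g H) i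
       then k (i, j) \<in> set_pmf (\<sigma> i (Link_info (private_history g i H)) j) else k (i, j))"
  unfolding link_decisions_def
  by (auto simp: set_Pi_pmf[OF finite_links[OF assms]] PiE_dflt_def split: if_splits)

lemma set_favor_decisions:
  assumes "finite (dom f)"
  shows "a \<in> set_pmf (favor_decisions g \<sigma> H k f) \<longleftrightarrow>
    (\<forall>r. f r = None \<longrightarrow> \<not> a r) \<and>
    (\<forall>r l. f r = Some l \<longrightarrow> a r \<in> set_pmf (\<sigma> l (info_of g l (Favor_node H k f)) r))"
  unfolding favor_decisions_def set_Pi_pmf[OF assms] PiE_dflt_def
  by (force simp: dom_def)

lemma set_finish_period:
  "H' \<in> set_pmf (finish_period S g \<sigma> (Link_node H)) \<longleftrightarrow>
    (\<exists>k f a. H' = Period k f a # H \<and> k \<in> set_pmf (link_decisions g \<sigma> H) \<and>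
      f \<in> set_pmf (nature S (remaining (current_network g H) k)) \<and>
      a \<in> set_pmf (favor_decisions g \<sigma> H k f))"
  unfolding finish_period_Link by auto

lemma set_outcome_induct:
  assumes "H \<in> set_pmf (outcome S g \<sigma> t)" "Q []"
    and "\<And>H H'. Q H \<Longrightarrow> H' \<in> set_pmf (finish_period S g \<sigma> (Link_node H)) \<Longrightarrow> Q H'"
  shows "Q H"
  using assms(1)
proof (induction t arbitrary: H)
  case (Suc t)
  then show ?case using assms(3) by (auto simp: outcome_def)
qed (simp add: outcome_def assms(2))

section \<open>Bellman inequalities for continuation payoffs\<close>

definition stage_bound :: "'a \<Rightarrow> real" where
  "stage_bound i = \<bar>v\<bar> + real (card (players S)) * (\<bar>cost S i\<bar> + \<bar>\<gamma>\<bar>)"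

lemma stage_payoff_bound: "\<bar>stage_payoff S i x\<bar> \<le> stage_bound i"
proof -
  let ?R = "{r. r \<in> players S \<and> provider x r = Some i}"
  have "\<bar>\<Sum>r\<in>?R. if coop x r then - cost S i else - \<gamma>\<bar> \<le> (\<Sum>r\<in>?R. \<bar>cost S i\<bar> + \<bar>\<gamma>\<bar>)"
    by (rule order_trans[OF sum_abs]) (rule sum_mono, auto)
  also have "\<dots> \<le> real (card (players S)) * (\<bar>cost S i\<bar> + \<bar>\<gamma>\<bar>)"
    using card_mono[OF finite_players, of ?R] by (auto intro!: mult_right_mono)
  finally show ?thesis unfolding stage_payoff_def stage_bound_def by (auto simp: abs_if split: if_splits)
qed

text \<open>The factor \<open>e\<close> covers both directions of the inequality.\<close>

lemma continuation_payoff_signed_le: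
  assumes \<Phi>: "\<And>H. \<bar>\<Phi> H\<bar> \<le> C" and e: "\<bar>e\<bar> = 1"
    and step: "\<And>H. Inv H \<Longrightarrow> e * measure_pmf.expectation (finish_period S g \<sigma> (Link_node H))
        (\<lambda>H'. stage_payoff S i (hd H') + \<delta> * \<Phi> H') \<le> e * \<Phi> H"
    and Inv: "\<And>H H'. Inv H \<Longrightarrow> H' \<in> set_pmf (finish_period S g \<sigma> (Link_node H)) \<Longrightarrow> Inv H'"
    and init: "\<And>H. H \<in> set_pmf (bind_pmf M (finish_period S g \<sigma>)) \<Longrightarrow> Inv H"
  shows "e * continuation_payoff S g \<sigma> i M
    \<le> e * measure_pmf.expectation (bind_pmf M (finish_period S g \<sigma>)) (\<lambda>H. stage_payoff S i (hd H) + \<delta> * \<Phi> H)"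
proof -
  define D where "D n = advance S g \<sigma> n (bind_pmf M (finish_period S g \<sigma>))" for n
  let ?st = "\<lambda>H. stage_payoff S i (hd H)"
  define a where "a n = measure_pmf.expectation (D n) ?st" for n
  define b where "b n = measure_pmf.expectation (D n) \<Phi>" for n
  have int: "integrable (measure_pmf N) ?st" "integrable (measure_pmf N) \<Phi>" for N
    by (auto intro: integrable_bounded_pmf stage_payoff_bound \<Phi>)
  have InvD: "Inv H" if "H \<in> set_pmf (D n)" for n H
    using that unfolding D_def
  proof (induction n arbitrary: H)
    case 0 then show ?case using init by simp
  next
    case (Suc n) then show ?case using Inv by auto
  qed
  have bound: "\<bar>stage_payoff S i (hd H) + \<delta> * \<Phi> H\<bar> \<le> stage_bound i + C" for H
  proof -
    have "\<delta> * \<bar>\<Phi> H\<bar> \<le> \<bar>\<Phi> H\<bar>" using params by (intro mult_left_le_one_le) auto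
    moreover have "\<bar>\<delta> * \<Phi> H\<bar> = \<delta> * \<bar>\<Phi> H\<bar>" using params by (simp add: abs_mult)
    ultimately show ?thesis
      using stage_payoff_bound[of i "hd H"] \<Phi>[of H] abs_triangle_ineq[of "stage_payoff S i (hd H)" "\<delta> * \<Phi> H"]
      by linarith
  qed
  have ab: "a n + \<delta> * b n = measure_pmf.expectation (D n) (\<lambda>H. stage_payoff S i (hd H) + \<delta> * \<Phi> H)" for n
    using int by (simp add: a_def b_def)
  \<comment> \<open>The Bellman inequality \<open>step\<close>, averaged over the histories reached
    after \<open>n\<close> periods, all of which satisfy \<open>Inv\<close>.\<close>
  have le: "e * a (Suc n) + \<delta> * (e * b (Suc n)) \<le> e * b n" for n
  proof -
    have "e * (a (Suc n) + \<delta> * b (Suc n)) = measure_pmf.expectation (D n)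
        (\<lambda>H. e * measure_pmf.expectation (finish_period S g \<sigma> (Link_node H)) (\<lambda>H'. stage_payoff S i (hd H') + \<delta> * \<Phi> H'))"
      unfolding ab by (simp add: D_def expectation_bind_pmf[OF bound] del: finish_period.simps)
    also have "\<dots> \<le> measure_pmf.expectation (D n) (\<lambda>H. e * \<Phi> H)"
    proof (rule integral_mono_AE)
      show "integrable (measure_pmf (D n)) (\<lambda>H. e * measure_pmf.expectation
          (finish_period S g \<sigma> (Link_node H)) (\<lambda>H'. stage_payoff S i (hd H') + \<delta> * \<Phi> H'))"
      proof (rule integrable_bounded_pmf)
        fix H
        show "\<bar>e * measure_pmf.expectation (finish_period S g \<sigma> (Link_node H))
            (\<lambda>H'. stage_payoff S i (hd H') + \<delta> * \<Phi> H')\<bar> \<le> stage_bound i + C"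
          using e expectation_abs_le[OF bound] by (simp add: abs_mult del: finish_period.simps)
      qed
      show "integrable (measure_pmf (D n)) (\<lambda>H. e * \<Phi> H)" using int by simp
      show "AE H in measure_pmf (D n). e * measure_pmf.expectation (finish_period S g \<sigma> (Link_node H))
          (\<lambda>H'. stage_payoff S i (hd H') + \<delta> * \<Phi> H') \<le> e * \<Phi> H"
        by (rule AE_pmfI) (rule step[OF InvD])
    qed
    finally show ?thesis using int by (simp add: b_def algebra_simps)
  qed
  have ea: "\<bar>e * a n\<bar> \<le> stage_bound i" and eb: "\<bar>e * b n\<bar> \<le> C" for n
    using e expectation_abs_le[OF stage_payoff_bound] expectation_abs_le[OF \<Phi>]
    by (simp_all add: abs_mult a_def b_def)
  have "(\<Sum>n. \<delta> ^ n * (e * a n)) \<le> e * a 0 + \<delta> * (e * b 0)"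
    using params by (intro discounted_sum_le(2)[where a = "\<lambda>n. e * a n" and b = "\<lambda>n. e * b n" and A = "stage_bound i" and B = C] ea eb le) auto
  moreover have "(\<Sum>n. \<delta> ^ n * (e * a n)) = e * continuation_payoff S g \<sigma> i M"
  proof -
    have "summable (\<lambda>n. \<delta> ^ n * (e * a n))"
      using params ea eb le
      by (intro discounted_sum_le(1)[where a = "\<lambda>n. e * a n" and b = "\<lambda>n. e * b n" and A = "stage_bound i" and B = C]) auto
    then have "summable (\<lambda>n. e * (\<delta> ^ n * (e * a n)))" by (rule summable_mult)
    moreover have "e * e = 1" using e by (auto simp: abs_if split: if_splits)
    then have "(\<lambda>n. e * (\<delta> ^ n * (e * a n))) = (\<lambda>n. \<delta> ^ n * a n)"
      by (auto simp: fun_eq_iff algebra_simps)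
    ultimately have "summable (\<lambda>n. \<delta> ^ n * a n)" by simp
    from suminf_mult[OF this, of e] show ?thesis
      by (simp add: continuation_payoff_def a_def D_def mult_ac)
  qed
  moreover have "e * a 0 + \<delta> * (e * b 0) = e * (a 0 + \<delta> * b 0)" by (simp add: algebra_simps)
  ultimately show ?thesis using ab[of 0] by (simp add: D_def)
qed

text \<open>Verification principle: a bounded solution of the Bellman equation on an invariant set
  of histories is the value of the play there. Boundedness excludes the spurious solutions of an
  infinite horizon.\<close>

lemma continuation_payoff_eq:
  assumes \<Phi>: "\<And>H. \<bar>\<Phi> H\<bar> \<le> C"
    and step: "\<And>H. Inv H \<Longrightarrow> measure_pmf.expectation (finish_period S g \<sigma> (Link_node H))
        (\<lambda>H'. stage_payoff S i (hd H') + \<delta> * \<Phi> H') = \<Phi> H"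
    and Inv: "\<And>H H'. Inv H \<Longrightarrow> H' \<in> set_pmf (finish_period S g \<sigma> (Link_node H)) \<Longrightarrow> Inv H'"
    and init: "\<And>H. H \<in> set_pmf (bind_pmf M (finish_period S g \<sigma>)) \<Longrightarrow> Inv H"
  shows "continuation_payoff S g \<sigma> i M
    = measure_pmf.expectation (bind_pmf M (finish_period S g \<sigma>)) (\<lambda>H. stage_payoff S i (hd H) + \<delta> * \<Phi> H)"
  using continuation_payoff_signed_le[where e = 1 and \<Phi> = \<Phi> and Inv = Inv and g = g and \<sigma> = \<sigma> and i = i, OF \<Phi> _ _ Inv init]
    continuation_payoff_signed_le[where e = "-1" and \<Phi> = \<Phi> and Inv = Inv and g = g and \<sigma> = \<sigma> and i = i, OF \<Phi> _ _ Inv init]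
    step
  by (intro antisym) (simp_all del: finish_period.simps)

lemma stage_payoff_coop:
  assumes "\<And>r. f r \<noteq> None \<Longrightarrow> r = i \<or> f r = Some i \<Longrightarrow> a r"
  shows "stage_payoff S i (Period k f a) = coop_payoff i f"
proof -
  have "(\<Sum>r | r \<in> players S \<and> f r = Some i. if a r then - cost S i else - \<gamma>)
      = (\<Sum>r | r \<in> players S \<and> f r = Some i. - cost S i)"
    using assms by (intro sum.cong) auto
  then show ?thesis using assms[of i] by (auto simp: stage_payoff_def coop_payoff_def)
qed

end

section \<open>Links of stable networks are sustainable\<close>

definition dealing :: "'a period \<Rightarrow> 'a \<Rightarrow> 'a \<Rightarrow> bool option" where
  "dealing x k l = (if provider x k = Some l then Some (coop x k) else None)"

lemma bilateral_history_eq: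
  assumes "k \<noteq> l"
  shows "bilateral_history k l (private_history g k H) = map (\<lambda>x. (dealing x k l, dealing x l k)) H"
  by (induction H) (use assms in \<open>auto simp: bilateral_history_def dealing_def own_plays_def split: option.splits\<close>)

lemma bilaterally_measurable_cong:
  assumes "bilaterally_measurable \<sigma>" "k \<noteq> l"
    and "map (\<lambda>x. (dealing x k l, dealing x l k)) H = map (\<lambda>x. (dealing x k l, dealing x l k)) H'"
  shows "\<sigma> k (Link_info (private_history g k H)) l = \<sigma> k (Link_info (private_history g k H')) l"
    and "\<sigma> k (Favor_info (private_history g k H) d f) l = \<sigma> k (Favor_info (private_history g k H') d' f') l"
proof -
  have "bilateral_history k l (private_history g k H) = bilateral_history k l (private_history g k H')"
    using assms(3) by (simp add: bilateral_history_eq[OF assms(2)])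
  then show "\<sigma> k (Link_info (private_history g k H)) l = \<sigma> k (Link_info (private_history g k H')) l"
      "\<sigma> k (Favor_info (private_history g k H) d f) l = \<sigma> k (Favor_info (private_history g k H') d' f') l"
    using assms(1) assms(2)[symmetric] unfolding bilaterally_measurable_def by blast+
qed

lemma expectation_cong:
  fixes f h :: "'b \<Rightarrow> real"
  assumes "\<And>x. x \<in> set_pmf M \<Longrightarrow> f x = h x"
  shows "measure_pmf.expectation M f = measure_pmf.expectation M h"
  by (rule integral_cong_AE) (auto intro!: AE_pmfI assms)

lemma ex_set_pmf: "\<exists>x. x \<in> set_pmf M"
  using set_pmf_not_empty[of M] by blast

lemma set_pmf_eq_TrueI:
  assumes "\<And>x. x \<in> set_pmf M \<Longrightarrow> x"
  shows "set_pmf M = {True}"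
  using assms ex_set_pmf[of M] by (metis (full_types) empty_iff insertI1 subsetI subset_singletonD)

abbreviation keep_all :: "'a \<times> 'a \<Rightarrow> bool" where
  "keep_all \<equiv> \<lambda>_. True"

context favor_society
begin

lemma pmf_to_favor_node:
  "pmf (to_favor_node S g \<sigma> H) (Favor_node H k f)
    = pmf (link_decisions g \<sigma> H) k * pmf (nature S (remaining (current_network g H) k)) f"
proof -
  have "pmf (map_pmf (Favor_node H k') (nature S (remaining (current_network g H) k'))) (Favor_node H k f)
      = indicator {k} k' * pmf (nature S (remaining (current_network g H) k)) f" for k'
  proof (cases "k' = k")
    case True
    then show ?thesis by (simp add: pmf_map_inj' inj_def)
  qed (auto simp: pmf_eq_0_set_pmf)
  then show ?thesis
    unfolding to_favor_node_def pmf_bind by (simp add: pmf.rep_eq)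
qed

lemma pmf_link_decisions:
  assumes "network g"
  shows "pmf (link_decisions g \<sigma> H) k =
    (if \<forall>i j. j \<notin> nbrs (current_network g H) i \<longrightarrow> k (i, j)
     then \<Prod>(i, j)\<in>{(i, j). j \<in> nbrs (current_network g H) i}.
       pmf (\<sigma> i (Link_info (private_history g i H)) j) (k (i, j)) else 0)"
  unfolding link_decisions_def
  by (subst pmf_Pi[OF finite_links[OF assms]]) (auto intro!: prod.cong)

lemma tendsto_link_decisions:
  assumes "network g" "\<And>i I j b. (\<lambda>n. pmf (\<tau> n i I j) b) \<longlonglongrightarrow> pmf (\<sigma> i I j) b"
  shows "(\<lambda>n. pmf (link_decisions g (\<tau> n) H) k) \<longlonglongrightarrow> pmf (link_decisions g \<sigma> H) k"
proof (cases "\<forall>i j. j \<notin> nbrs (current_network g H) i \<longrightarrow> k (i, j)")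
  case True
  then show ?thesis
    unfolding pmf_link_decisions[OF assms(1)] case_prod_beta if_P[OF True]
    by (intro tendsto_prod assms(2))
next
  case False
  show ?thesis unfolding pmf_link_decisions[OF assms(1)] if_not_P[OF False] by simp
qed

lemma link_decisions_pos:
  assumes "network g" "completely_mixed \<tau>" "\<And>i j. j \<notin> nbrs (current_network g H) i \<Longrightarrow> k (i, j)"
  shows "0 < pmf (link_decisions g \<tau> H) k"
  unfolding pmf_link_decisions[OF assms(1)]
  using assms(2,3) by (auto intro!: prod_pos simp: completely_mixed_def)

lemma coop_payoff_bound: "\<bar>coop_payoff i f\<bar> \<le> \<bar>v\<bar> + \<bar>cost S i\<bar> * real (card (players S))"
proof -
  let ?R = "{r \<in> players S. f r = Some i}"
  have "\<bar>cost S i * real (card ?R)\<bar> \<le> \<bar>cost S i\<bar> * real (card (players S))"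
    using card_mono[OF finite_players, of ?R] by (simp add: abs_mult mult_left_mono)
  moreover have "\<bar>if f i \<noteq> None then v else 0\<bar> \<le> \<bar>v\<bar>" by simp
  ultimately show ?thesis unfolding coop_payoff_def
    using abs_triangle_ineq4[of "if f i \<noteq> None then v else 0" "cost S i * real (card ?R)"] by linarith
qed

lemma coop_payoff_integrable: "integrable (measure_pmf M) (coop_payoff i)"
  by (rule integrable_bounded_pmf, rule coop_payoff_bound)

lemma node_payoff_integrable:
  "integrable (measure_pmf M) (\<lambda>x. case x of Favor_node _ _ f \<Rightarrow> coop_payoff i f | _ \<Rightarrow> 0)"
proof (rule integrable_bounded_pmf)
  show "\<bar>case x of Favor_node _ _ f \<Rightarrow> coop_payoff i f | _ \<Rightarrow> 0\<bar> \<le> \<bar>v\<bar> + \<bar>cost S i\<bar> * real (card (players S))" for x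
    using coop_payoff_bound by (cases x) (auto simp: add_nonneg_nonneg)
qed

text \<open>Cooperative histories are described without reference to a profile, so that membership
  survives the deletion of favors. That they have positive probability under a cooperative profile
  is \<open>full_history_outcome\<close>.\<close>

definition full_history :: "'a network \<Rightarrow> 'a history \<Rightarrow> bool" where
  "full_history g H \<longleftrightarrow>
    (\<forall>x\<in>set H. kept x = keep_all \<and> provider x \<in> set_pmf (nature S g) \<and> coop x = (\<lambda>r. provider x r \<noteq> None))"

lemma expectation_finish_period_coop:
  assumes h: "network h" and i: "i \<in> players S"
    and link: "\<And>k. k \<in> set_pmf (link_decisions g \<sigma> H) \<Longrightarrow> remaining (current_network g H) k = h"
    and favor: "\<And>k f a r. k \<in> set_pmf (link_decisions g \<sigma> H) \<Longrightarrow> f \<in> set_pmf (nature S h) \<Longrightarrow>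
        a \<in> set_pmf (favor_decisions g \<sigma> H k f) \<Longrightarrow> f r \<noteq> None \<Longrightarrow> a r"
  shows "measure_pmf.expectation (finish_period S g \<sigma> (Link_node H)) (\<lambda>H'. stage_payoff S i (hd H') + C)
    = payoff S h i + C"
proof -
  let ?E = "measure_pmf.expectation"
  let ?h = "\<lambda>H'. stage_payoff S i (hd H') + C"
  have b: "\<bar>?h H'\<bar> \<le> stage_bound i + \<bar>C\<bar>" for H'
    using stage_payoff_bound[of i "hd H'"] by linarith
  have "?E (finish_period S g \<sigma> (Link_node H)) ?h =
      ?E (link_decisions g \<sigma> H) (\<lambda>k. ?E (nature S (remaining (current_network g H) k))
        (\<lambda>f. ?E (favor_decisions g \<sigma> H k f) (\<lambda>a. stage_payoff S i (Period k f a) + C)))"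
    unfolding finish_period_Link expectation_bind_pmf[where f = ?h, OF b] by simp
  also have "\<dots> = ?E (link_decisions g \<sigma> H) (\<lambda>_. payoff S h i + C)"
  proof (rule expectation_cong)
    fix k assume k: "k \<in> set_pmf (link_decisions g \<sigma> H)"
    have "?E (nature S (remaining (current_network g H) k))
        (\<lambda>f. ?E (favor_decisions g \<sigma> H k f) (\<lambda>a. stage_payoff S i (Period k f a) + C))
      = ?E (nature S h) (\<lambda>f. coop_payoff i f + C)"
      unfolding link[OF k]
    proof (rule expectation_cong)
      fix f assume f: "f \<in> set_pmf (nature S h)"
      have "stage_payoff S i (Period k f a) = coop_payoff i f" if "a \<in> set_pmf (favor_decisions g \<sigma> H k f)" for a
        by (rule stage_payoff_coop, rule favor[OF k f that])
      then have "?E (favor_decisions g \<sigma> H k f) (\<lambda>a. stage_payoff S i (Period k f a) + C)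
          = ?E (favor_decisions g \<sigma> H k f) (\<lambda>a. coop_payoff i f + C)"
        by (intro expectation_cong) simp
      then show "?E (favor_decisions g \<sigma> H k f) (\<lambda>a. stage_payoff S i (Period k f a) + C) = coop_payoff i f + C"
        by simp
    qed
    also have "\<dots> = payoff S h i + C"
      using expectation_coop_payoff[OF h i] coop_payoff_integrable by simp
    finally show "?E (nature S (remaining (current_network g H) k))
      (\<lambda>f. ?E (favor_decisions g \<sigma> H k f) (\<lambda>a. stage_payoff S i (Period k f a) + C)) = payoff S h i + C" .
  qed
  finally show ?thesis by simp
qed

text \<open>One computation serves the equilibrium and the deviation: \<open>M\<close> is a belief
  at the favor stage of period 0, \<open>C\<close> the extra payoff collected in that period, and
  \<open>h\<close> the network on which all later favors are provided.\<close>

lemma continuation_from_first_favors: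
  assumes h: "network h" and i: "i \<in> players S"
    and M: "\<And>x. x \<in> set_pmf M \<Longrightarrow> \<exists>f. x = Favor_node [] keep_all f \<and>
      (\<forall>a\<in>set_pmf (favor_decisions g \<sigma> [] keep_all f).
         Inv [Period keep_all f a] \<and> stage_payoff S i (Period keep_all f a) = coop_payoff i f + C)"
    and link: "\<And>H k. Inv H \<Longrightarrow> k \<in> set_pmf (link_decisions g \<sigma> H) \<Longrightarrow> remaining (current_network g H) k = h"
    and favor: "\<And>H k f a. Inv H \<Longrightarrow> k \<in> set_pmf (link_decisions g \<sigma> H) \<Longrightarrow> f \<in> set_pmf (nature S h) \<Longrightarrow>
      a \<in> set_pmf (favor_decisions g \<sigma> H k f) \<Longrightarrow> Inv (Period k f a # H) \<and> (\<forall>r. f r \<noteq> None \<longrightarrow> a r)"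
  shows "continuation_payoff S g \<sigma> i M =
    measure_pmf.expectation M (\<lambda>x. case x of Favor_node _ _ f \<Rightarrow> coop_payoff i f | _ \<Rightarrow> 0)
      + C + \<delta> / (1 - \<delta>) * payoff S h i"
proof -
  let ?u = "payoff S h i / (1 - \<delta>)" and ?E = "measure_pmf.expectation"
  let ?h = "\<lambda>H. stage_payoff S i (hd H) + \<delta> * ?u"
  have "continuation_payoff S g \<sigma> i M = ?E (bind_pmf M (finish_period S g \<sigma>)) ?h"
  proof (rule continuation_payoff_eq[where Inv = Inv and C = "\<bar>?u\<bar>"])
    fix H assume H: "Inv H"
    have "?E (finish_period S g \<sigma> (Link_node H)) ?h = payoff S h i + \<delta> * ?u"
      by (rule expectation_finish_period_coop[OF h i]) (use link[OF H] favor[OF H] in blast)+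
    also have "\<dots> = ?u" using params by (simp add: field_simps)
    finally show "?E (finish_period S g \<sigma> (Link_node H)) ?h = ?u" .
    show "Inv H'" if "H' \<in> set_pmf (finish_period S g \<sigma> (Link_node H))" for H'
      using that link[OF H] favor[OF H] unfolding set_finish_period by metis
  next
    show "Inv H" if "H \<in> set_pmf (bind_pmf M (finish_period S g \<sigma>))" for H
      using that M by fastforce
  qed simp
  also have "\<dots> = ?E M (\<lambda>x. ?E (finish_period S g \<sigma> x) ?h)"
    by (rule expectation_bind_pmf[where C = "stage_bound i + \<bar>\<delta> * ?u\<bar>"])
       (use stage_payoff_bound[of i] abs_triangle_ineq order_trans add_right_mono in \<open>metis\<close>)
  also have "\<dots> = ?E M (\<lambda>x. (case x of Favor_node _ _ f \<Rightarrow> coop_payoff i f | _ \<Rightarrow> 0) + (C + \<delta> * ?u))"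
  proof (rule expectation_cong)
    fix x assume "x \<in> set_pmf M"
    then obtain f where f: "x = Favor_node [] keep_all f"
      "\<forall>a\<in>set_pmf (favor_decisions g \<sigma> [] keep_all f). stage_payoff S i (Period keep_all f a) = coop_payoff i f + C"
      using M by blast
    then have "?E (favor_decisions g \<sigma> [] keep_all f) (\<lambda>a. stage_payoff S i (Period keep_all f a) + \<delta> * ?u)
        = ?E (favor_decisions g \<sigma> [] keep_all f) (\<lambda>a. coop_payoff i f + (C + \<delta> * ?u))"
      by (intro expectation_cong) simp
    then show "?E (finish_period S g \<sigma> x) ?h = (case x of Favor_node _ _ f \<Rightarrow> coop_payoff i f | _ \<Rightarrow> 0) + (C + \<delta> * ?u)"
      by (simp add: f(1))
  qed
  also have "\<dots> = ?E M (\<lambda>x. case x of Favor_node _ _ f \<Rightarrow> coop_payoff i f | _ \<Rightarrow> 0) + (C + \<delta> * ?u)"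
    by (simp add: node_payoff_integrable)
  finally show ?thesis by simp
qed

lemma nature_None: "network h \<Longrightarrow> (\<lambda>_. None) \<in> set_pmf (nature S h)"
  using set_pmf_not_empty[of "nature S h"] nature_erase[of h _ "\<lambda>_. None"] by blast

end

section \<open>Choices forced along a cooperative path\<close>

locale cooperative_path = favor_society S for S :: "'a society" +
  fixes g :: "'a network" and \<sigma> :: "'a profile"
  assumes g: "network g" and meas: "bilaterally_measurable \<sigma>"
    and path: "\<And>t H. H \<in> set_pmf (outcome S g \<sigma> t) \<Longrightarrow>
      current_network g H = g \<and> (\<forall>x\<in>set H. \<forall>r. provider x r \<noteq> None \<longrightarrow> coop x r)"
begin

lemma outcome_Suc:
  assumes "H \<in> set_pmf (outcome S g \<sigma> t)" "k \<in> set_pmf (link_decisions g \<sigma> H)"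
    "f \<in> set_pmf (nature S (remaining g k))" "a \<in> set_pmf (favor_decisions g \<sigma> H k f)"
  shows "Period k f a # H \<in> set_pmf (outcome S g \<sigma> (Suc t))"
proof -
  have "Period k f a # H \<in> set_pmf (finish_period S g \<sigma> (Link_node H))"
    unfolding set_finish_period using assms path[OF assms(1)] by auto
  then show ?thesis using assms(1) by (auto simp: outcome_def simp del: finish_period.simps)
qed

text \<open>A removal would show in \<open>current_network\<close> one period later on a history of
  positive probability, since a period without any favor is always possible.\<close>

lemma path_link_decisions:
  assumes H: "H \<in> set_pmf (outcome S g \<sigma> t)" and k: "k \<in> set_pmf (link_decisions g \<sigma> H)"
  shows "k = keep_all"
proof
  fix ij :: "'a \<times> 'a" obtain i j where ij: "ij = (i, j)" by fastforce
  obtain a where a: "a \<in> set_pmf (favor_decisions g \<sigma> H k (\<lambda>_. None))"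
    by (rule exE[OF ex_set_pmf])
  have "current_network g (Period k (\<lambda>_. None) a # H) = g"
    using path[OF outcome_Suc[OF H k nature_None a]] network_on_remaining[OF g] by blast
  then have "remaining g k = g" using path[OF H] by simp
  then show "k ij = True"
    using k path[OF H] link_remaining_iff[of i j g k] unfolding set_link_decisions[OF g] ij
    by (metis mem_nbrs_iff)
qed

text \<open>Link decisions are independent, so any value in the support of one decision can be
  inserted into a possible joint decision; \<open>path_link_decisions\<close> then forces it to be
  \<open>True\<close>.\<close>

lemma path_keep:
  assumes H: "H \<in> set_pmf (outcome S g \<sigma> t)" and l: "l \<in> nbrs g k"
  shows "set_pmf (\<sigma> k (Link_info (private_history g k H)) l) = {True}"
proof -
  have "x" if x: "x \<in> set_pmf (\<sigma> k (Link_info (private_history g k H)) l)" for x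
  proof -
    obtain d where d: "d \<in> set_pmf (link_decisions g \<sigma> H)" by (rule exE[OF ex_set_pmf])
    have "d((k, l) := x) \<in> set_pmf (link_decisions g \<sigma> H)"
      using d x l path[OF H] unfolding set_link_decisions[OF g] by auto
    from path_link_decisions[OF H this] show x by (metis fun_upd_same)
  qed
  then show ?thesis by (rule set_pmf_eq_TrueI)
qed

lemma path_keep_all: "H \<in> set_pmf (outcome S g \<sigma> t) \<Longrightarrow> keep_all \<in> set_pmf (link_decisions g \<sigma> H)"
  using path_link_decisions ex_set_pmf by metis

text \<open>The choice is forced at a node where \<open>l\<close> really asks \<open>k\<close>;
  bilateral measurability then carries it over to arbitrary data \<open>d\<close> and
  \<open>f'\<close> of the current period.\<close>

lemma path_coop:
  assumes H: "H \<in> set_pmf (outcome S g \<sigma> t)" and l: "l \<in> nbrs g k"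
  shows "set_pmf (\<sigma> k (Favor_info (private_history g k H) d f') l) = {True}"
proof -
  obtain f where f: "f \<in> set_pmf (nature S g)" "f l = Some k"
    using exists_request[OF g] l by (metis mem_nbrs_commute)
  have fin: "finite (dom f)" using nature_dom_finite[OF g f(1)] .
  have "x" if x: "x \<in> set_pmf (\<sigma> k (info_of g k (Favor_node H keep_all f)) l)" for x
  proof -
    obtain a where a: "a \<in> set_pmf (favor_decisions g \<sigma> H keep_all f)" by (rule exE[OF ex_set_pmf])
    have "a(l := x) \<in> set_pmf (favor_decisions g \<sigma> H keep_all f)"
      using a x f(2) unfolding set_favor_decisions[OF fin] by auto
    then have "Period keep_all f (a(l := x)) # H \<in> set_pmf (outcome S g \<sigma> (Suc t))"
      using outcome_Suc[OF H path_keep_all[OF H]] f by simp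
    from path[OF this] f(2) show x by (auto dest: spec[of _ l])
  qed
  then have "set_pmf (\<sigma> k (info_of g k (Favor_node H keep_all f)) l) = {True}" by (rule set_pmf_eq_TrueI)
  moreover have "k \<noteq> l" using l by (auto simp: mem_nbrs_iff)
  ultimately show ?thesis
    using bilaterally_measurable_cong(2)[OF meas, of k l H H g d f'] by (metis info_of.simps(2))
qed

lemma full_history_outcome:
  assumes "full_history g H"
  shows "H \<in> set_pmf (outcome S g \<sigma> (length H))"
  using assms
proof (induction H)
  case (Cons x H)
  then have H: "H \<in> set_pmf (outcome S g \<sigma> (length H))" by (auto simp: full_history_def)
  obtain k f a where x: "x = Period k f a" by (cases x)
  have f: "f \<in> set_pmf (nature S g)" "k = keep_all" "a = (\<lambda>r. f r \<noteq> None)"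
    using Cons.prems by (auto simp: full_history_def x)
  have "a \<in> set_pmf (favor_decisions g \<sigma> H keep_all f)"
    unfolding set_favor_decisions[OF nature_dom_finite[OF g f(1)]] f(3)
    using path_coop[OF H] nature_request(3)[OF g f(1)] by (auto split: option.splits)
  then show ?case
    using outcome_Suc[OF H path_keep_all[OF H]] f x by simp
qed (simp add: outcome_def)

lemmas full_keep = path_keep[OF full_history_outcome]
lemmas full_coop = path_coop[OF full_history_outcome]

lemma full_finish:
  assumes H: "full_history g H"
  shows "current_network g H = g" "k \<in> set_pmf (link_decisions g \<sigma> H) \<Longrightarrow> k = keep_all"
    and "f \<in> set_pmf (nature S g) \<Longrightarrow> a \<in> set_pmf (favor_decisions g \<sigma> H k f) \<Longrightarrow> a = (\<lambda>r. f r \<noteq> None)"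
proof -
  show "current_network g H = g" using path[OF full_history_outcome[OF H]] by simp
  show "k \<in> set_pmf (link_decisions g \<sigma> H) \<Longrightarrow> k = keep_all"
    using path_link_decisions[OF full_history_outcome[OF H]] .
  assume f: "f \<in> set_pmf (nature S g)" and a: "a \<in> set_pmf (favor_decisions g \<sigma> H k f)"
  show "a = (\<lambda>r. f r \<noteq> None)"
  proof
    fix r show "a r = (f r \<noteq> None)"
    proof (cases "f r")
      case None
      then show ?thesis using a unfolding set_favor_decisions[OF nature_dom_finite[OF g f]] by (auto dest: spec[of _ r])
    next
      case (Some l)
      then have "a r \<in> set_pmf (\<sigma> l (info_of g l (Favor_node H k f)) r)"
        using a unfolding set_favor_decisions[OF nature_dom_finite[OF g f]] by (auto dest: spec[of _ r])
      then show ?thesis using full_coop[OF H nature_request(3)[OF g f Some]] Some by simp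
    qed
  qed
qed

lemma full_continuation:
  assumes i: "i \<in> players S"
    and M: "\<And>x. x \<in> set_pmf M \<Longrightarrow> \<exists>f\<in>set_pmf (nature S g). x = Favor_node [] keep_all f"
  shows "continuation_payoff S g \<sigma> i M =
    measure_pmf.expectation M (\<lambda>x. case x of Favor_node _ _ f \<Rightarrow> coop_payoff i f | _ \<Rightarrow> 0)
      + 0 + \<delta> / (1 - \<delta>) * payoff S g i"
proof (rule continuation_from_first_favors[OF g i, where Inv = "full_history g"])
  fix x assume "x \<in> set_pmf M"
  then obtain f where f: "f \<in> set_pmf (nature S g)" "x = Favor_node [] keep_all f" using M by blast
  have "full_history g [Period keep_all f a] \<and> stage_payoff S i (Period keep_all f a) = coop_payoff i f + 0"
    if "a \<in> set_pmf (favor_decisions g \<sigma> [] keep_all f)" for a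
  proof -
    have "a = (\<lambda>r. f r \<noteq> None)" using full_finish(3)[of "[]", OF _ f(1) that] by (simp add: full_history_def)
    then show ?thesis using f(1) stage_payoff_coop[of f i a] by (simp add: full_history_def)
  qed
  then show "\<exists>f. x = Favor_node [] keep_all f \<and> (\<forall>a\<in>set_pmf (favor_decisions g \<sigma> [] keep_all f).
      full_history g [Period keep_all f a] \<and> stage_payoff S i (Period keep_all f a) = coop_payoff i f + 0)"
    using f(2) by blast
next
  fix H k assume H: "full_history g H" and k: "k \<in> set_pmf (link_decisions g \<sigma> H)"
  show "remaining (current_network g H) k = g"
    unfolding full_finish(1)[OF H] full_finish(2)[OF H k] by simp
  fix f a assume f: "f \<in> set_pmf (nature S g)" and a: "a \<in> set_pmf (favor_decisions g \<sigma> H k f)"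
  show "full_history g (Period k f a # H) \<and> (\<forall>r. f r \<noteq> None \<longrightarrow> a r)"
    using H f full_finish(2)[OF H k] unfolding full_finish(3)[OF H f a] by (simp add: full_history_def)
qed

end

section \<open>Refusing one partner and removing the link\<close>

definition drop_partner :: "'a \<Rightarrow> 'a strategy" where
  "drop_partner j = (\<lambda>I l. return_pmf (l \<noteq> j))"

definition erase :: "'a \<Rightarrow> 'a \<Rightarrow> ('a \<Rightarrow> 'a option) \<Rightarrow> 'a \<Rightarrow> 'a option" where
  "erase i j f r = (if r = i \<and> f r = Some j \<or> r = j \<and> f r = Some i then None else f r)"

text \<open>
  After \<open>i\<close> drops \<open>j\<close>, every other pair sees a bilateral history that is also possible on the
  equilibrium path: the one in which nothing happened between \<open>i\<close> and \<open>j\<close>.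
\<close>

definition erased :: "'a \<Rightarrow> 'a \<Rightarrow> 'a history \<Rightarrow> 'a history" where
  "erased i j = map (\<lambda>x. Period keep_all (erase i j (provider x)) (\<lambda>r. erase i j (provider x) r \<noteq> None))"

context cooperative_path
begin

text \<open>Requests from \<open>i\<close> to \<open>j\<close> count as provided: after the
  deviation they can arise in period 0 only, before \<open>j\<close> has observed a refusal.\<close>

definition dropping :: "'a \<Rightarrow> 'a \<Rightarrow> 'a history \<Rightarrow> bool" where
  "dropping i j H \<longleftrightarrow> (\<forall>x\<in>set H. provider x \<in> set_pmf (nature S g) \<and>
     (\<forall>r. coop x r \<longleftrightarrow> provider x r \<noteq> None \<and> \<not> (r = j \<and> provider x r = Some i)))"

lemma full_history_erased: "dropping i j H \<Longrightarrow> full_history g (erased i j H)"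
proof -
  assume H: "dropping i j H"
  have "erase i j f \<in> set_pmf (nature S g)" if "f \<in> set_pmf (nature S g)" for f
    by (rule nature_erase[OF g that]) (simp add: erase_def)
  then show ?thesis using H by (simp add: full_history_def erased_def dropping_def)
qed

lemma dealing_erased:
  assumes "dropping i j H" "{k, l} \<noteq> {i, j}"
  shows "map (\<lambda>x. (dealing x k l, dealing x l k)) H = map (\<lambda>x. (dealing x k l, dealing x l k)) (erased i j H)"
  using assms by (auto simp: erased_def dealing_def erase_def dropping_def doubleton_eq_iff)

context
  fixes i j h
  assumes link: "{i, j} \<in> g" and h_eq: "h = g - {{i, j}}"
begin

abbreviation "\<sigma>' \<equiv> \<sigma>(i := drop_partner j)"

lemma h: "network h" and ij: "i \<noteq> j" "i \<in> players S" "j \<in> players S" and h_sub: "h \<subseteq> g"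
  using network_on_mono[OF g, of h] network_on_linkD[OF g link] h_eq by auto

lemma mem_nbrs_h: "b \<in> nbrs h a \<longleftrightarrow> b \<in> nbrs g a \<and> {a, b} \<noteq> {i, j}"
  by (auto simp: mem_nbrs_iff h_eq)

lemma dropping_keeps:
  assumes H: "dropping i j H" and b: "b \<in> nbrs g a" "{a, b} \<noteq> {i, j}"
  shows "set_pmf (\<sigma>' a (Link_info (private_history g a H)) b) = {True}"
proof (cases "a = i")
  case True
  then show ?thesis using b by (auto simp: drop_partner_def)
next
  case False
  have "a \<noteq> b" using b by (auto simp: mem_nbrs_iff)
  then show ?thesis
    using False full_keep[OF full_history_erased[OF H] b(1)]
      bilaterally_measurable_cong(1)[OF meas _ dealing_erased[OF H b(2)]] by simp
qed

lemma dropping_coops: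
  assumes H: "dropping i j H" and b: "b \<in> nbrs g a" "{a, b} \<noteq> {i, j}"
  shows "set_pmf (\<sigma>' a (Favor_info (private_history g a H) d f) b) = {True}"
proof (cases "a = i")
  case True
  then show ?thesis using b by (auto simp: drop_partner_def)
next
  case False
  have "a \<noteq> b" using b by (auto simp: mem_nbrs_iff)
  then show ?thesis
    using False full_coop[OF full_history_erased[OF H] b(1)]
      bilaterally_measurable_cong(2)[OF meas \<open>a \<noteq> b\<close> dealing_erased[OF H b(2)], of g d f d f] by simp
qed

text \<open>The disjunction in \<open>cur\<close> reflects the timing: the network is still
  \<open>g\<close> at the end of period 0 and \<open>h\<close> after the next link stage. In both
  cases \<open>i\<close> removes the link to \<open>j\<close> if it is there, and all other pairs
  keep theirs as on the path.\<close>

lemma dropping_remaining: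
  assumes H: "dropping i j H" and cur: "current_network g H = g \<or> current_network g H = h"
    and k: "k \<in> set_pmf (link_decisions g \<sigma>' H)"
  shows "remaining (current_network g H) k = h"
proof (rule network_eqI[OF network_on_remaining[OF network_on_current[OF g]] h])
  fix a
  let ?c = "current_network g H"
  have keeps: "k (a, b)" if "b \<in> nbrs ?c a" "{a, b} \<noteq> {i, j}" for a b
  proof -
    have "b \<in> nbrs g a" by (rule subsetD[OF nbrs_mono[OF current_network_subset] that(1)])
    then show ?thesis
      using k that dropping_keeps[OF H _ that(2)] unfolding set_link_decisions[OF g] by (metis singletonD)
  qed
  have drops: "\<not> k (i, j)" if "j \<in> nbrs ?c i"
  proof -
    have "k (i, j) \<in> set_pmf (\<sigma>' i (Link_info (private_history g i H)) j)"
      using k that unfolding set_link_decisions[OF g] by presburger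
    then show ?thesis by (simp add: drop_partner_def)
  qed
  show "nbrs (remaining ?c k) a = nbrs h a"
  proof (intro set_eqI iffI)
    fix b assume b: "b \<in> nbrs (remaining ?c k) a"
    then have bc: "b \<in> nbrs ?c a" "k (a, b)" "k (b, a)" by (auto simp: nbrs_remaining)
    have "{a, b} \<noteq> {i, j}"
      using bc drops by (auto simp: doubleton_eq_iff mem_nbrs_commute)
    then show "b \<in> nbrs h a"
      using subsetD[OF nbrs_mono[OF current_network_subset] bc(1)] unfolding mem_nbrs_h by simp
  next
    fix b assume b: "b \<in> nbrs h a"
    then have "b \<in> nbrs g a" and ne: "{a, b} \<noteq> {i, j}" unfolding mem_nbrs_h by simp_all
    with b cur have "b \<in> nbrs ?c a" by auto
    note this ne
    then show "b \<in> nbrs (remaining ?c k) a"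
      using keeps[of b a] keeps[of a b] by (auto simp: nbrs_remaining mem_nbrs_commute insert_commute)
  qed
qed

lemma dropping_favor:
  assumes H: "dropping i j H" and f: "f \<in> set_pmf (nature S g)"
    and a: "a \<in> set_pmf (favor_decisions g \<sigma>' H k f)" and that: "\<not> (r = i \<and> f r = Some j)"
  shows "a r \<longleftrightarrow> f r \<noteq> None \<and> \<not> (r = j \<and> f r = Some i)"
proof (cases "f r")
  case None
  then show ?thesis using a unfolding set_favor_decisions[OF nature_dom_finite[OF g f]] by simp
next
  case (Some l)
  then have *: "a r \<in> set_pmf (\<sigma>' l (info_of g l (Favor_node H k f)) r)"
    using a unfolding set_favor_decisions[OF nature_dom_finite[OF g f]] by blast
  show ?thesis
  proof (cases "{l, r} = {i, j}")
    case True
    then have "l = i" "r = j" using that Some by (auto simp: doubleton_eq_iff)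
    then show ?thesis using * Some by (simp add: drop_partner_def)
  next
    case False
    then have "a r" using * dropping_coops[OF H nature_request(3)[OF g f Some] False] by simp
    moreover have "\<not> (r = j \<and> f r = Some i)" using False Some by auto
    ultimately show ?thesis using Some by simp
  qed
qed

text \<open>In period 0 \<open>i\<close> may also have asked \<open>j\<close>. The bilateral history
  is still empty for \<open>j\<close>, who therefore cooperates; this is the case that
  \<open>dropping_favor\<close> excludes.\<close>

lemma dropping_coop_first:
  assumes f: "f \<in> set_pmf (nature S g)" and a: "a \<in> set_pmf (favor_decisions g \<sigma>' [] keep_all f)"
  shows "a r \<longleftrightarrow> f r \<noteq> None \<and> \<not> (r = j \<and> f r = Some i)"
proof (cases "r = i \<and> f r = Some j")
  case True
  then have "a i \<in> set_pmf (\<sigma>' j (info_of g j (Favor_node [] keep_all f)) i)"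
    using a unfolding set_favor_decisions[OF nature_dom_finite[OF g f]] by blast
  then have "a i \<in> set_pmf (\<sigma> j (Favor_info (private_history g j []) (\<lambda>_. True) (own_plays j f)) i)"
    using ij by simp
  moreover have "i \<in> nbrs g j" using link ij by (auto simp: mem_nbrs_iff insert_commute)
  ultimately have "a i" using full_coop[of "[]" i j] by (simp add: full_history_def)
  then show ?thesis using True ij by auto
next
  case False
  then show ?thesis using dropping_favor[OF _ f a, of r] by (simp add: dropping_def)
qed

lemma dropping_stage_payoff:
  assumes f: "f \<in> set_pmf (nature S g)" "f j = Some i"
    and a: "\<And>r. a r \<longleftrightarrow> f r \<noteq> None \<and> \<not> (r = j \<and> f r = Some i)"
  shows "stage_payoff S i (Period keep_all f a) = coop_payoff i f + (cost S i - \<gamma>)"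
proof -
  let ?R = "{r \<in> players S. f r = Some i}"
  have "(\<Sum>r\<in>?R. if a r then - cost S i else - \<gamma>) = (\<Sum>r\<in>?R. - cost S i + (if r = j then cost S i - \<gamma> else 0))"
    using a f(2) by (intro sum.cong) auto
  also have "\<dots> = - cost S i * real (card ?R) + (cost S i - \<gamma>)"
    using finite_players ij f(2) by (simp add: sum.distrib sum_subtractf)
  finally show ?thesis using a[of i] ij by (auto simp: stage_payoff_def coop_payoff_def)
qed

lemma dropping_continuation:
  assumes M: "\<And>x. x \<in> set_pmf M \<Longrightarrow> \<exists>f\<in>set_pmf (nature S g). x = Favor_node [] keep_all f \<and> f j = Some i"
  shows "continuation_payoff S g \<sigma>' i M =
    measure_pmf.expectation M (\<lambda>x. case x of Favor_node _ _ f \<Rightarrow> coop_payoff i f | _ \<Rightarrow> 0)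
      + (cost S i - \<gamma>) + \<delta> / (1 - \<delta>) * payoff S h i"
proof (rule continuation_from_first_favors[OF h ij(2)])
  let ?Inv = "\<lambda>H. dropping i j H \<and> (current_network g H = g \<or> current_network g H = h)"
  fix x assume "x \<in> set_pmf M"
  then obtain f where f: "f \<in> set_pmf (nature S g)" "x = Favor_node [] keep_all f" "f j = Some i" using M by blast
  have "?Inv [Period keep_all f a] \<and> stage_payoff S i (Period keep_all f a) = coop_payoff i f + (cost S i - \<gamma>)"
    if a: "a \<in> set_pmf (favor_decisions g \<sigma>' [] keep_all f)" for a
  proof -
    have "?Inv [Period keep_all f a]" using f(1) dropping_coop_first[OF f(1) a] by (auto simp: dropping_def)
    then show ?thesis using dropping_stage_payoff[OF f(1,3) dropping_coop_first[OF f(1) a]] by blast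
  qed
  then show "\<exists>f. x = Favor_node [] keep_all f \<and> (\<forall>a\<in>set_pmf (favor_decisions g \<sigma>' [] keep_all f).
      ?Inv [Period keep_all f a] \<and> stage_payoff S i (Period keep_all f a) = coop_payoff i f + (cost S i - \<gamma>))"
    using f(2) by blast
next
  fix H k assume H: "dropping i j H \<and> (current_network g H = g \<or> current_network g H = h)"
    and k: "k \<in> set_pmf (link_decisions g \<sigma>' H)"
  show rem: "remaining (current_network g H) k = h" using dropping_remaining[OF _ _ k] H by blast
  fix f a assume f: "f \<in> set_pmf (nature S h)" and a: "a \<in> set_pmf (favor_decisions g \<sigma>' H k f)"
  have fg: "f \<in> set_pmf (nature S g)" by (rule nature_mono[OF g h_sub f])
  have "\<not> (r = j \<and> f r = Some i)" "\<not> (r = i \<and> f r = Some j)" for r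
    using nature_request(2)[OF h f] by (fastforce simp: mem_nbrs_h)+
  moreover from this(2) have "a r \<longleftrightarrow> f r \<noteq> None \<and> \<not> (r = j \<and> f r = Some i)" for r
    using dropping_favor[OF _ fg a] H by blast
  ultimately have ar: "a r \<longleftrightarrow> f r \<noteq> None" "\<not> (r = j \<and> f r = Some i)" for r by blast+
  have "dropping i j (Period k f a # H)" using H fg ar by (auto simp: dropping_def)
  then show "(dropping i j (Period k f a # H) \<and>
      (current_network g (Period k f a # H) = g \<or> current_network g (Period k f a # H) = h)) \<and>
      (\<forall>r. f r \<noteq> None \<longrightarrow> a r)"
    using rem ar(1) by simp
qed

text \<open>The information set contains a node that needs no tremble. A node reached by a link
  removal loses all weight against it in the limit, so \<open>i\<close> is sure that all links were
  kept and remains uncertain only about favors in which she takes no part.\<close>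

lemma belief_on_path:
  assumes cons: "consistent S g \<sigma> \<mu>" and f0: "f0 \<in> set_pmf (nature S g)"
    and I: "I = info_of g i (Favor_node [] keep_all f0)" "I \<in> info_sets S g i"
    and x: "x \<in> set_pmf (\<mu> i I)"
  shows "\<exists>f\<in>set_pmf (nature S g). x = Favor_node [] keep_all f \<and> own_plays i f = own_plays i f0"
proof -
  obtain \<tau> where mixed: "\<And>n. completely_mixed (\<tau> n)"
    and lim: "\<And>i I j b. (\<lambda>n. pmf (\<tau> n i I j) b) \<longlonglongrightarrow> pmf (\<sigma> i I j) b"
    and bel: "\<And>x. (\<lambda>n. pmf (cond_pmf (node_law S g (\<tau> n) I) {y. info_of g i y = I}) x) \<longlonglongrightarrow> pmf (\<mu> i I) x"
    using cons I(2) ij(2) unfolding consistent_def by blast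
  let ?A = "{y. info_of g i y = I}" and ?x0 = "Favor_node [] keep_all f0"
  have law: "node_law S g (\<tau> n) I = to_favor_node S g (\<tau> n) []" for n
    by (simp add: I(1) outcome_def bind_return_pmf)
  have pmf_law: "pmf (node_law S g (\<tau> n) I) (Favor_node [] k f)
      = pmf (link_decisions g (\<tau> n) []) k * pmf (nature S (remaining g k)) f" for n k f
    unfolding law pmf_to_favor_node by simp
  have x0: "0 < pmf (node_law S g (\<tau> n) I) ?x0" for n
    unfolding pmf_law using link_decisions_pos[OF g mixed] f0
    by (auto intro!: mult_pos_pos simp: set_pmf_iff pmf_positive)
  have ne: "set_pmf (node_law S g (\<tau> n) I) \<inter> ?A \<noteq> {}" for n
  proof -
    have "?x0 \<in> set_pmf (node_law S g (\<tau> n) I)" using x0[of n] unfolding set_pmf_iff by linarith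
    moreover have "?x0 \<in> ?A" using I(1) by simp
    ultimately show ?thesis by blast
  qed
  have cond: "pmf (cond_pmf (node_law S g (\<tau> n) I) ?A) x
      = (if x \<in> ?A then pmf (node_law S g (\<tau> n) I) x / measure_pmf.prob (node_law S g (\<tau> n) I) ?A else 0)" for n
    by (rule pmf_cond[OF ne])
  have pos: "pmf (\<mu> i I) x \<noteq> 0" using x by (simp add: set_pmf_iff)
  have xA: "info_of g i x = I"
  proof (rule ccontr)
    assume "info_of g i x \<noteq> I"
    then have "(\<lambda>n. 0) \<longlonglongrightarrow> pmf (\<mu> i I) x" using bel[of x] unfolding cond by simp
    then show False using pos by (simp add: LIMSEQ_const_iff)
  qed
  have not0: "\<not> (\<forall>n. pmf (node_law S g (\<tau> n) I) x = 0)"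
  proof
    assume zero: "\<forall>n. pmf (node_law S g (\<tau> n) I) x = 0"
    have "(\<lambda>n. 0) \<longlonglongrightarrow> pmf (\<mu> i I) x"
      using bel[of x] unfolding cond by (simp only: zero[rule_format] div_0 if_cancel)
    then show False using pos by (simp add: LIMSEQ_const_iff)
  qed
  then obtain n where "x \<in> set_pmf (to_favor_node S g (\<tau> n) [])" unfolding law by (auto simp: set_pmf_iff)
  then obtain k f where kf: "x = Favor_node [] k f" "f \<in> set_pmf (nature S (remaining g k))"
    by (auto simp: to_favor_node_def)
  have lim_link: "(\<lambda>n. pmf (link_decisions g (\<tau> n) []) k') \<longlonglongrightarrow> pmf (link_decisions g \<sigma> []) k'" for k'
    by (rule tendsto_link_decisions[OF g], rule lim)
  have "k = keep_all"
  proof (rule ccontr)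
    assume "k \<noteq> keep_all"
    then have "k \<notin> set_pmf (link_decisions g \<sigma> [])"
      using full_finish(2)[of "[]" k] by (auto simp: full_history_def)
    then have k0: "(\<lambda>n. pmf (link_decisions g (\<tau> n) []) k) \<longlonglongrightarrow> 0"
      using lim_link[of k] by (simp add: set_pmf_iff)
    have "set_pmf (link_decisions g \<sigma> []) = {keep_all}"
      using full_finish(2)[of "[]"] ex_set_pmf[of "link_decisions g \<sigma> []"] by (auto simp: full_history_def)
    then have "link_decisions g \<sigma> [] = return_pmf keep_all" by (simp add: set_pmf_subset_singleton[symmetric])
    then have k1: "(\<lambda>n. pmf (link_decisions g (\<tau> n) []) keep_all * pmf (nature S g) f0) \<longlonglongrightarrow> 1 * pmf (nature S g) f0"
      using lim_link[of keep_all] by (intro tendsto_mult) auto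
    have nz: "pmf (nature S g) f0 \<noteq> 0" using f0 by (simp add: set_pmf_iff)
    \<comment> \<open>This dominates the conditional probability of \<open>x\<close>: the numerator
      carries the vanishing tremble, and the denominator is the probability of the on-path node
      \<open>?x0\<close>, which tends to \<open>pmf (nature S g) f0\<close>.\<close>
    have ratio: "(\<lambda>n. pmf (link_decisions g (\<tau> n) []) k /
        (pmf (link_decisions g (\<tau> n) []) keep_all * pmf (nature S g) f0)) \<longlonglongrightarrow> 0"
      using tendsto_divide[OF k0 k1] nz by simp
    have "(\<lambda>n. pmf (cond_pmf (node_law S g (\<tau> n) I) ?A) x) \<longlonglongrightarrow> 0"
    proof (rule tendsto_sandwich[OF _ _ tendsto_const ratio])
      show "\<forall>\<^sub>F n in sequentially. pmf (cond_pmf (node_law S g (\<tau> n) I) ?A) x \<le>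
        pmf (link_decisions g (\<tau> n) []) k / (pmf (link_decisions g (\<tau> n) []) keep_all * pmf (nature S g) f0)"
      proof (intro always_eventually allI)
        fix n
        have "pmf (node_law S g (\<tau> n) I) x \<le> pmf (link_decisions g (\<tau> n) []) k"
          unfolding kf pmf_law by (rule mult_right_le_one_le) (auto simp: pmf_le_1)
        moreover have "pmf (node_law S g (\<tau> n) I) ?x0 \<le> measure_pmf.prob (node_law S g (\<tau> n) I) ?A"
          unfolding measure_pmf_single[symmetric] by (rule measure_pmf.finite_measure_mono) (auto simp: I(1))
        moreover have "pmf (node_law S g (\<tau> n) I) ?x0 = pmf (link_decisions g (\<tau> n) []) keep_all * pmf (nature S g) f0"
          unfolding pmf_law by simp
        ultimately show "pmf (cond_pmf (node_law S g (\<tau> n) I) ?A) x \<le>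
            pmf (link_decisions g (\<tau> n) []) k / (pmf (link_decisions g (\<tau> n) []) keep_all * pmf (nature S g) f0)"
          unfolding cond using xA x0[of n] by (auto intro!: frac_le)
      qed
    qed simp
    then show False using LIMSEQ_unique[OF bel[of x]] pos by simp
  qed
  then show ?thesis using kf xA I(1) by auto
qed

text \<open>Under the common belief the favors of period 0 contribute the same expected
  \<open>coop_payoff\<close> to both continuation payoffs and cancel. What remains is the saving
  from one refusal against the discounted loss of the link.\<close>

lemma equilibrium_link_bound:
  assumes "sequential_equilibrium S g \<sigma> \<mu>"
  shows "cost S i - \<gamma> \<le> \<delta> / (1 - \<delta>) * (payoff S g i - payoff S h i)"
proof -
  have "i \<in> nbrs g j" using link ij by (auto simp: mem_nbrs_iff insert_commute)
  then obtain f0 where f0: "f0 \<in> set_pmf (nature S g)" "f0 j = Some i" using exists_request[OF g] by blast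
  define I where "I = info_of g i (Favor_node [] keep_all f0)"
  have "[] \<in> set_pmf (outcome S g \<sigma> 0)" by (simp add: outcome_def)
  then have "Favor_node [] keep_all f0 \<in> set_pmf (node_law S g \<sigma> I)"
    using path_keep_all[of "[]" 0] f0(1) by (auto simp: I_def outcome_def to_favor_node_def intro!: bexI[of _ keep_all])
  then have I: "I \<in> info_sets S g i"
    unfolding info_sets_def mem_Collect_eq
  proof (intro exI conjI)
    show "info_of g i (Favor_node [] keep_all f0) = I" by (simp add: I_def)
    show "to_move g i (Favor_node [] keep_all f0)" using f0(2) by auto
  qed
  have M: "\<exists>f\<in>set_pmf (nature S g). x = Favor_node [] keep_all f \<and> f j = Some i" if x: "x \<in> set_pmf (\<mu> i I)" for x
  proof -
    have "consistent S g \<sigma> \<mu>" using assms by (simp add: sequential_equilibrium_def)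
    from belief_on_path[OF this f0(1) I_def I x] obtain f
      where f: "f \<in> set_pmf (nature S g)" "x = Favor_node [] keep_all f" "own_plays i f = own_plays i f0" by blast
    from f(3) have "own_plays i f j = own_plays i f0 j" by simp
    then have "f j = Some i" using f0(2) ij by (auto simp: own_plays_def split: if_splits)
    then show ?thesis using f by blast
  qed
  have "continuation_payoff S g \<sigma>' i (\<mu> i I) \<le> continuation_payoff S g \<sigma> i (\<mu> i I)"
    using assms I ij(2) unfolding sequential_equilibrium_def sequentially_rational_def by blast
  moreover have "\<exists>f\<in>set_pmf (nature S g). x = Favor_node [] keep_all f" if x: "x \<in> set_pmf (\<mu> i I)" for x
    using M[OF x] by blast
  ultimately show ?thesis
    using dropping_continuation[OF M] full_continuation[OF ij(2), of "\<mu> i I"] by (simp add: right_diff_distrib)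
qed

end

end

context favor_society
begin

lemma stable_imp_sustainable:
  assumes "stable S g" "{i, j} \<in> g"
  shows "sustainable S g i j"
proof -
  obtain \<sigma> \<mu> where \<sigma>: "network g" "bilaterally_measurable \<sigma>" "sequential_equilibrium S g \<sigma> \<mu>"
    "\<And>t H. H \<in> set_pmf (outcome S g \<sigma> t) \<Longrightarrow> current_network g H = g \<and>
       (\<forall>x\<in>set H. \<forall>r. provider x r \<noteq> None \<longrightarrow> coop x r)"
    using assms(1) unfolding stable_def bilateral_equilibrium_def by metis
  interpret cooperative_path S g \<sigma> by unfold_locales (use \<sigma> in blast)+
  have "{j, i} \<in> g" using assms(2) by (simp add: insert_commute)
  then show ?thesis
    using equilibrium_link_bound[OF assms(2) refl \<sigma>(3)] equilibrium_link_bound[OF \<open>{j, i} \<in> g\<close> refl \<sigma>(3)] assms(2)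
    by (auto simp: sustainable_def insert_commute)
qed

end

section \<open>Trigger strategies and consistent beliefs\<close>

text \<open>Only refused favors destroy trust: link decisions are not part of the bilateral history,
  so a measurable strategy cannot condition on them.\<close>

definition trusting :: "'a history \<Rightarrow> 'a \<Rightarrow> 'a \<Rightarrow> bool" where
  "trusting H k l \<longleftrightarrow> (\<forall>x\<in>set H. dealing x k l \<noteq> Some False \<and> dealing x l k \<noteq> Some False)"

definition trusts :: "'a \<Rightarrow> 'a info \<Rightarrow> 'a \<Rightarrow> bool" where
  "trusts i I j \<longleftrightarrow>
    (\<forall>(a, b)\<in>set (bilateral_history i j (case I of Link_info h \<Rightarrow> h | Favor_info h k f \<Rightarrow> h)).
       a \<noteq> Some False \<and> b \<noteq> Some False)"

definition trigger :: "'a profile" where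
  "trigger = (\<lambda>i I j. return_pmf (trusts i I j))"

text \<open>The shift by 2 keeps the rate strictly between 0 and 1 already at
  \<open>n = 0\<close>.\<close>

definition tremble_rate :: "nat \<Rightarrow> real" where
  "tremble_rate n = 1 / (real n + 2)"

definition trembling :: "nat \<Rightarrow> 'a profile" where
  "trembling n = (\<lambda>i I j. bernoulli_pmf (if trusts i I j then 1 - tremble_rate n else tremble_rate n))"

lemma trusting_commute: "trusting H k l = trusting H l k"
  by (auto simp: trusting_def)

lemma trusting_Nil [simp]: "trusting [] k l"
  by (simp add: trusting_def)

lemma trusting_Cons: "trusting (x # H) k l \<longleftrightarrow>
    dealing x k l \<noteq> Some False \<and> dealing x l k \<noteq> Some False \<and> trusting H k l"
  by (auto simp: trusting_def)

lemma trusts_iff: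
  assumes "i \<noteq> j"
  shows "trusts i (Link_info (private_history g i H)) j = trusting H i j"
    and "trusts i (Favor_info (private_history g i H) k f) j = trusting H i j"
  by (auto simp: trusts_def trusting_def bilateral_history_eq[OF assms])

lemma bilaterally_measurable_trigger: "bilaterally_measurable trigger"
  by (simp add: bilaterally_measurable_def trigger_def trusts_def)

lemma tremble_rate: "0 < tremble_rate n" "tremble_rate n < 1"
  by (auto simp: tremble_rate_def)

lemma tremble_rate_tendsto: "tremble_rate \<longlonglongrightarrow> 0"
  unfolding tremble_rate_def by real_asymp

lemma pmf_trembling: "pmf (trembling n i I j) b = (if b = trusts i I j then 1 - tremble_rate n else tremble_rate n)"
  using tremble_rate[of n] by (cases b) (auto simp: trembling_def)

lemma completely_mixed_trembling: "completely_mixed (trembling n)"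
  using tremble_rate by (auto simp: completely_mixed_def pmf_trembling)

lemma trembling_tendsto: "(\<lambda>n. pmf (trembling n i I j) b) \<longlonglongrightarrow> pmf (trigger i I j) b"
proof -
  have "(\<lambda>n. 1 - tremble_rate n) \<longlonglongrightarrow> 1 - 0" by (intro tendsto_intros tremble_rate_tendsto)
  then show ?thesis
    using tremble_rate_tendsto by (auto simp: pmf_trembling trigger_def indicator_def)
qed

subsection \<open>Orders of vanishing\<close>

text \<open>The exact order, with a positive limit constant, so that two nodes can be compared by
  their exponents. Positivity at every \<open>n\<close> ensures that the information sets can be
  conditioned on before the limit is taken.\<close>

definition vanishes :: "(nat \<Rightarrow> real) \<Rightarrow> nat \<Rightarrow> bool" where
  "vanishes p t \<longleftrightarrow> (\<forall>n. 0 < p n) \<and> (\<exists>L>0. (\<lambda>n. p n / tremble_rate n ^ t) \<longlonglongrightarrow> L)"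

lemma vanishes_const: "0 < c \<Longrightarrow> vanishes (\<lambda>_. c) 0"
  by (auto simp: vanishes_def)

lemma vanishes_mult:
  assumes "vanishes p s" "vanishes q t"
  shows "vanishes (\<lambda>n. p n * q n) (s + t)"
proof -
  obtain L M where pos: "0 < L" "0 < M" and lim: "(\<lambda>n. p n / tremble_rate n ^ s) \<longlonglongrightarrow> L" "(\<lambda>n. q n / tremble_rate n ^ t) \<longlonglongrightarrow> M"
    using assms by (auto simp: vanishes_def)
  have "0 < L * M" using pos by simp
  note tendsto_mult[OF lim]
  then have "(\<lambda>n. p n * q n / tremble_rate n ^ (s + t)) \<longlonglongrightarrow> L * M" by (simp add: power_add)
  then show ?thesis using assms \<open>0 < L * M\<close> by (auto simp: vanishes_def intro!: exI[of _ "L * M"])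
qed

lemma vanishes_prod:
  assumes "finite A"
  shows "vanishes (\<lambda>n. \<Prod>x\<in>A. if Q x then 1 - tremble_rate n else tremble_rate n) (card {x \<in> A. \<not> Q x})"
  using assms
proof (induction A)
  case empty
  then show ?case by (simp add: vanishes_const)
next
  case (insert y A)
  have "(\<lambda>n. 1 - tremble_rate n) \<longlonglongrightarrow> 1 - 0" by (intro tendsto_intros tremble_rate_tendsto)
  then have "vanishes (\<lambda>n. 1 - tremble_rate n) 0" using tremble_rate by (auto simp: vanishes_def intro!: exI[of _ 1])
  moreover have "vanishes tremble_rate 1"
    using tremble_rate by (auto simp: vanishes_def less_imp_neq[symmetric] intro!: exI[of _ 1])
  ultimately have "vanishes (\<lambda>n. if Q y then 1 - tremble_rate n else tremble_rate n) (if Q y then 0 else 1)"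
    by simp
  from vanishes_mult[OF this insert.IH]
  have "vanishes (\<lambda>n. \<Prod>x\<in>insert y A. if Q x then 1 - tremble_rate n else tremble_rate n)
      ((if Q y then 0 else 1) + card {x \<in> A. \<not> Q x})"
    using insert.hyps by simp
  moreover have "{x \<in> insert y A. \<not> Q x} = (if Q y then {x \<in> A. \<not> Q x} else insert y {x \<in> A. \<not> Q x})" by auto
  then have "card {x \<in> insert y A. \<not> Q x} = (if Q y then 0 else 1) + card {x \<in> A. \<not> Q x}"
    using insert.hyps by simp
  ultimately show ?case by simp
qed

text \<open>Division by the power of the tremble rate with the smallest exponent makes all weights
  converge, and only nodes with that exponent keep a positive one. The limit belief is the vector of
  these limit constants, normalized.\<close>

lemma limit_belief:
  fixes p :: "nat \<Rightarrow> 'b pmf"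
  assumes X: "finite X" "X \<noteq> {}" "X \<subseteq> A"
    and van: "\<And>x. x \<in> X \<Longrightarrow> vanishes (\<lambda>n. pmf (p n) x) (t x)"
    and zero: "\<And>x n. x \<in> A \<Longrightarrow> x \<notin> X \<Longrightarrow> pmf (p n) x = 0"
  shows "\<exists>\<mu>. (\<forall>x. (\<lambda>n. pmf (cond_pmf (p n) A) x) \<longlonglongrightarrow> pmf \<mu> x) \<and>
    (\<forall>x\<in>set_pmf \<mu>. x \<in> X \<and> (\<forall>y\<in>X. t x \<le> t y))"
proof -
  let ?e = tremble_rate
  obtain L where L: "\<And>x. x \<in> X \<Longrightarrow> 0 < L x" "\<And>x. x \<in> X \<Longrightarrow> (\<lambda>n. pmf (p n) x / ?e n ^ t x) \<longlonglongrightarrow> L x"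
    using van unfolding vanishes_def by metis
  define m where "m = Min (t ` X)"
  have m: "\<And>x. x \<in> X \<Longrightarrow> m \<le> t x" "\<exists>x\<in>X. t x = m"
  proof -
    show "\<And>x. x \<in> X \<Longrightarrow> m \<le> t x" using X(1) by (simp add: m_def)
    have "m \<in> t ` X" unfolding m_def using X(1,2) by (intro Min_in) auto
    then show "\<exists>x\<in>X. t x = m" by auto
  qed
  define w where "w x = (if x \<in> X \<and> t x = m then L x else 0)" for x
  define Z where "Z = sum w X"
  have w0: "0 \<le> w x" for x using L(1) by (auto simp: w_def less_imp_le)
  have Z0: "0 < Z"
  proof -
    obtain y where "y \<in> X" "t y = m" using m(2) by blast
    then have "0 < w y" using L(1) by (simp add: w_def)
    also have "w y \<le> Z" unfolding Z_def using X(1) \<open>y \<in> X\<close> w0 by (intro member_le_sum) auto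
    finally show ?thesis .
  qed
  have lim: "(\<lambda>n. pmf (p n) x / ?e n ^ m) \<longlonglongrightarrow> w x" if "x \<in> X" for x
  proof -
    have "(\<lambda>n. pmf (p n) x / ?e n ^ t x * ?e n ^ (t x - m)) \<longlonglongrightarrow> L x * 0 ^ (t x - m)"
      by (intro tendsto_intros L(2) that tremble_rate_tendsto)
    moreover have "pmf (p n) x / ?e n ^ t x * ?e n ^ (t x - m) = pmf (p n) x / ?e n ^ m" for n
    proof -
      have "?e n ^ t x = ?e n ^ m * ?e n ^ (t x - m)"
        using m(1)[OF that] by (simp flip: power_add)
      then show ?thesis using tremble_rate(1)[of n] by simp
    qed
    moreover have "L x * 0 ^ (t x - m) = w x"
      using that m(1)[OF that] by (auto simp: w_def)
    ultimately show ?thesis by simp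
  qed
  have pos: "0 < pmf (p n) x" if "x \<in> X" for x n using van[OF that] by (auto simp: vanishes_def)
  have ne: "set_pmf (p n) \<inter> A \<noteq> {}" for n
  proof -
    obtain x where "x \<in> X" using X(2) by blast
    then have "x \<in> set_pmf (p n)" using pos[of x n] by (simp add: set_pmf_iff)
    then show ?thesis using X(3) \<open>x \<in> X\<close> by blast
  qed
  have prob: "measure_pmf.prob (p n) A = (\<Sum>x\<in>X. pmf (p n) x)" for n
  proof -
    have "measure_pmf.prob (p n) A = measure_pmf.prob (p n) X"
      by (rule measure_prob_cong_0) (use zero X(3) in auto)
    then show ?thesis by (simp add: measure_measure_pmf_finite X(1))
  qed
  define \<mu> where "\<mu> = embed_pmf (\<lambda>x. w x / Z)"
  have "(\<integral>\<^sup>+x. ennreal (w x / Z) \<partial>count_space UNIV) = (\<Sum>x\<in>X. ennreal (w x / Z))"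
    using X(1) by (intro nn_integral_count_space') (auto simp: w_def)
  also have "\<dots> = ennreal (\<Sum>x\<in>X. w x / Z)"
    using w0 Z0 by (intro sum_ennreal) (auto intro: divide_nonneg_pos)
  also have "(\<Sum>x\<in>X. w x / Z) = 1"
    using Z0 by (simp add: Z_def flip: sum_divide_distrib)
  finally have pmf_\<mu>: "pmf \<mu> x = w x / Z" for x
    unfolding \<mu>_def using w0 Z0 by (intro pmf_embed_pmf) (auto intro: divide_nonneg_pos)
  have "(\<lambda>n. pmf (cond_pmf (p n) A) x) \<longlonglongrightarrow> pmf \<mu> x" for x
  proof (cases "x \<in> X")
    case True
    have "(\<lambda>n. (pmf (p n) x / ?e n ^ m) / (\<Sum>y\<in>X. pmf (p n) y / ?e n ^ m)) \<longlonglongrightarrow> w x / (\<Sum>y\<in>X. w y)"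
      using Z0 unfolding Z_def by (intro tendsto_divide tendsto_sum lim True) auto
    moreover have "(pmf (p n) x / ?e n ^ m) / (\<Sum>y\<in>X. pmf (p n) y / ?e n ^ m) = pmf (cond_pmf (p n) A) x" for n
      using True X(3) tremble_rate(1)[of n] by (auto simp: pmf_cond[OF ne] prob simp flip: sum_divide_distrib)
    ultimately show ?thesis by (simp add: pmf_\<mu> Z_def)
  next
    case False
    then have "pmf (cond_pmf (p n) A) x = 0" for n using zero[of x n] by (auto simp: pmf_cond[OF ne])
    then show ?thesis using False by (simp add: pmf_\<mu> w_def)
  qed
  moreover have "x \<in> X \<and> (\<forall>y\<in>X. t x \<le> t y)" if "x \<in> set_pmf \<mu>" for x
    using that m(1) by (auto simp: set_pmf_iff pmf_\<mu> w_def split: if_splits)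
  ultimately show ?thesis by blast
qed

text \<open>The game is a tree: a history determines its predecessor, so the sum over intermediate
  states has a single term and path probabilities become products.\<close>

lemma pmf_bind_unique:
  assumes "\<And>y. y \<in> set_pmf M \<Longrightarrow> z \<in> set_pmf (K y) \<Longrightarrow> y = x"
  shows "pmf (bind_pmf M K) z = pmf M x * pmf (K x) z"
proof -
  have "pmf (bind_pmf M K) z = measure_pmf.expectation M (\<lambda>y. indicator {x} y * pmf (K x) z)"
    unfolding pmf_bind
  proof (rule expectation_cong)
    fix y assume "y \<in> set_pmf M"
    then show "pmf (K y) z = indicator {x} y * pmf (K x) z"
      using assms by (cases "y = x") (auto simp: pmf_eq_0_set_pmf)
  qed
  then show ?thesis by (simp add: measure_pmf_single)
qed

subsection \<open>Trembles along a history\<close>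

definition link_trembles :: "'a network \<Rightarrow> 'a history \<Rightarrow> ('a \<times> 'a \<Rightarrow> bool) \<Rightarrow> ('a \<times> 'a) set" where
  "link_trembles g H k = {(i, j). j \<in> nbrs (current_network g H) i \<and> k (i, j) \<noteq> trusting H i j}"

definition favor_trembles :: "'a history \<Rightarrow> ('a \<Rightarrow> 'a option) \<Rightarrow> ('a \<Rightarrow> bool) \<Rightarrow> 'a set" where
  "favor_trembles H f a = {r \<in> dom f. a r \<noteq> trusting H (the (f r)) r}"

fun trembles :: "'a network \<Rightarrow> 'a history \<Rightarrow> nat" where
  "trembles g [] = 0"
| "trembles g (x # H) = trembles g H + card (link_trembles g H (kept x)) + card (favor_trembles H (provider x) (coop x))"

fun node_trembles :: "'a network \<Rightarrow> 'a node \<Rightarrow> nat" where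
  "node_trembles g (Link_node H) = trembles g H"
| "node_trembles g (Favor_node H k f) = trembles g H + card (link_trembles g H k)"

context favor_society
begin

text \<open>Reachability without reference to a profile. The defaults, \<open>True\<close> for
  absent links and \<open>False\<close> where no favor arises, are part of it, because otherwise one
  course of play would have several representations.\<close>

definition feasible_stage :: "'a network \<Rightarrow> 'a history \<Rightarrow> ('a \<times> 'a \<Rightarrow> bool) \<Rightarrow> ('a \<Rightarrow> 'a option) \<Rightarrow> bool" where
  "feasible_stage g H k f \<longleftrightarrow> (\<forall>i j. j \<notin> nbrs (current_network g H) i \<longrightarrow> k (i, j)) \<and>
     f \<in> set_pmf (nature S (remaining (current_network g H) k))"

fun feasible :: "'a network \<Rightarrow> 'a history \<Rightarrow> bool" where
  "feasible g [] \<longleftrightarrow> True"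
| "feasible g (x # H) \<longleftrightarrow> feasible g H \<and> feasible_stage g H (kept x) (provider x) \<and>
     (\<forall>r. provider x r = None \<longrightarrow> \<not> coop x r)"

fun node_feasible :: "'a network \<Rightarrow> 'a node \<Rightarrow> bool" where
  "node_feasible g (Link_node H) \<longleftrightarrow> feasible g H"
| "node_feasible g (Favor_node H k f) \<longleftrightarrow> feasible g H \<and> feasible_stage g H k f"

context
  fixes g :: "'a network"
  assumes g: "network g"
begin

lemmas cur = network_on_current[OF g]
lemmas rem = network_on_remaining[OF cur]

lemma set_to_favor_node:
  "x \<in> set_pmf (to_favor_node S g \<sigma> H) \<longleftrightarrow> (\<exists>k f. x = Favor_node H k f \<and> k \<in> set_pmf (link_decisions g \<sigma> H) \<and>
     f \<in> set_pmf (nature S (remaining (current_network g H) k)))"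
  by (auto simp: to_favor_node_def)

lemma to_favor_node_feasible:
  assumes "Favor_node H k f \<in> set_pmf (to_favor_node S g \<sigma> H)"
  shows "feasible_stage g H k f"
  using assms unfolding set_to_favor_node by (auto simp: set_link_decisions[OF g] feasible_stage_def)

lemma outcome_feasible: "H \<in> set_pmf (outcome S g \<sigma> t) \<Longrightarrow> feasible g H"
proof (erule set_outcome_induct)
  fix H H' assume H: "feasible g H" "H' \<in> set_pmf (finish_period S g \<sigma> (Link_node H))"
  then obtain k f a where H': "H' = Period k f a # H" "k \<in> set_pmf (link_decisions g \<sigma> H)"
    "f \<in> set_pmf (nature S (remaining (current_network g H) k))" "a \<in> set_pmf (favor_decisions g \<sigma> H k f)"
    unfolding set_finish_period by blast
  have "feasible_stage g H k f"
    by (rule to_favor_node_feasible) (use H' in \<open>auto simp: set_to_favor_node\<close>)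
  moreover have "\<not> a r" if "f r = None" for r
    using H'(4) that unfolding set_favor_decisions[OF nature_dom_finite[OF rem H'(3)]] by blast
  ultimately show "feasible g H'" using H by (simp add: H'(1))
qed simp

lemma node_law_feasible: "x \<in> set_pmf (node_law S g \<sigma> I) \<Longrightarrow> node_feasible g x"
  by (cases I) (auto simp: set_to_favor_node dest!: outcome_feasible intro!: to_favor_node_feasible)

lemma vanishes_link_decisions:
  assumes "\<And>i j. j \<notin> nbrs (current_network g H) i \<Longrightarrow> k (i, j)"
  shows "vanishes (\<lambda>n. pmf (link_decisions g (trembling n) H) k) (card (link_trembles g H k))"
proof -
  let ?L = "{(i, j). j \<in> nbrs (current_network g H) i}"
  let ?Q = "\<lambda>x. k x = trusting H (fst x) (snd x)"
  have "pmf (link_decisions g (trembling n) H) k = (\<Prod>x\<in>?L. if ?Q x then 1 - tremble_rate n else tremble_rate n)" for n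
    unfolding pmf_link_decisions[OF g] using assms
    by (auto intro!: prod.cong simp: pmf_trembling mem_nbrs_iff trusts_iff)
  moreover have "{x \<in> ?L. \<not> ?Q x} = link_trembles g H k" by (auto simp: link_trembles_def)
  ultimately show ?thesis using vanishes_prod[OF finite_links[OF g, of H], of ?Q] by simp
qed

lemma vanishes_favor_decisions:
  assumes f: "f \<in> set_pmf (nature S h)" "network h" and a: "\<And>r. f r = None \<Longrightarrow> \<not> a r"
  shows "vanishes (\<lambda>n. pmf (favor_decisions g (trembling n) H k f) a) (card (favor_trembles H f a))"
proof -
  have fin: "finite (dom f)" using nature_dom_finite[OF f(2,1)] .
  let ?Q = "\<lambda>r. a r = trusting H (the (f r)) r"
  have "pmf (favor_decisions g (trembling n) H k f) a = (\<Prod>r\<in>dom f. if ?Q r then 1 - tremble_rate n else tremble_rate n)" for n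
    unfolding favor_decisions_def pmf_Pi[OF fin] using a nature_request(5)[OF f(2,1), THEN not_sym]
    by (auto intro!: prod.cong simp: pmf_trembling trusts_iff dom_def)
  moreover have "{x \<in> dom f. \<not> ?Q x} = favor_trembles H f a" by (auto simp: favor_trembles_def)
  ultimately show ?thesis using vanishes_prod[OF fin, of ?Q] by simp
qed

lemma vanishes_to_favor_node:
  assumes "feasible_stage g H k f"
  shows "vanishes (\<lambda>n. pmf (to_favor_node S g (trembling n) H) (Favor_node H k f)) (card (link_trembles g H k))"
proof -
  have "vanishes (\<lambda>n. pmf (link_decisions g (trembling n) H) k * pmf (nature S (remaining (current_network g H) k)) f)
      (card (link_trembles g H k) + 0)"
    using assms by (intro vanishes_mult vanishes_link_decisions vanishes_const)
      (auto simp: feasible_stage_def pmf_positive)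
  then show ?thesis by (simp add: pmf_to_favor_node)
qed

lemma vanishes_outcome:
  assumes "feasible g H"
  shows "vanishes (\<lambda>n. pmf (outcome S g (trembling n) (length H)) H) (trembles g H)"
  using assms
proof (induction H)
  case Nil
  then show ?case by (simp add: outcome_def vanishes_const)
next
  case (Cons x H)
  obtain k f a where x: "x = Period k f a" by (cases x)
  have fs: "feasible_stage g H k f" and a: "\<And>r. f r = None \<Longrightarrow> \<not> a r"
    using Cons.prems by (auto simp: x)
  then have f: "f \<in> set_pmf (nature S (remaining (current_network g H) k))" by (simp add: feasible_stage_def)
  have "pmf (outcome S g \<sigma> (length (x # H))) (x # H) = pmf (outcome S g \<sigma> (length H)) H
      * (pmf (to_favor_node S g \<sigma> H) (Favor_node H k f) * pmf (favor_decisions g \<sigma> H k f) a)" for \<sigma>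
  proof -
    have "pmf (outcome S g \<sigma> (length (x # H))) (x # H)
        = pmf (outcome S g \<sigma> (length H)) H * pmf (finish_period S g \<sigma> (Link_node H)) (x # H)"
      unfolding outcome_def length_Cons advance.simps
      by (rule pmf_bind_unique) (auto simp: set_finish_period simp del: finish_period.simps)
    also have "pmf (finish_period S g \<sigma> (Link_node H)) (x # H)
        = pmf (to_favor_node S g \<sigma> H) (Favor_node H k f) * pmf (finish_favor g \<sigma> (Favor_node H k f)) (x # H)"
      unfolding finish_period.simps by (rule pmf_bind_unique) (auto simp: set_to_favor_node x)
    also have "pmf (finish_favor g \<sigma> (Favor_node H k f)) (x # H) = pmf (favor_decisions g \<sigma> H k f) a"
      unfolding finish_favor.simps x by (rule pmf_map_inj') (auto simp: inj_def)
    finally show ?thesis .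
  qed
  then show ?case
    using vanishes_mult[OF Cons.IH vanishes_mult[OF vanishes_to_favor_node[OF fs] vanishes_favor_decisions[OF f rem a, where H = H and k = k]]]
      Cons.prems by (simp add: x add.assoc)
qed

lemma length_private_history: "length (private_history g i H) = length H"
  by (induction H) auto

lemma vanishes_node_law:
  assumes "node_feasible g x" "info_of g i x = I"
  shows "vanishes (\<lambda>n. pmf (node_law S g (trembling n) I) x) (node_trembles g x)"
proof (cases x)
  case (Link_node H)
  then have "pmf (node_law S g \<sigma> I) x = pmf (outcome S g \<sigma> (length H)) H" for \<sigma>
    using assms(2) by (auto simp: length_private_history inj_def intro!: pmf_map_inj')
  then show ?thesis using vanishes_outcome assms(1) by (simp add: Link_node)
next
  case (Favor_node H k f)
  have "pmf (node_law S g \<sigma> I) x = pmf (outcome S g \<sigma> (length H)) H * pmf (to_favor_node S g \<sigma> H) x" for \<sigma>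
    using assms(2) unfolding Favor_node
    by (auto simp: length_private_history set_to_favor_node intro!: pmf_bind_unique)
  then show ?thesis
    using vanishes_mult[OF vanishes_outcome vanishes_to_favor_node] assms(1) by (simp add: Favor_node)
qed

lemma finite_nature: "finite (set_pmf (nature S h))" if "network h"
proof -
  have "finite (set_pmf (Pi_pmf R None (provider_law S h)))" if "R \<in> set_pmf (request_law S)" for R
    using finite_subset[OF request_subset[OF that] finite_players] nbrs_finite[OF \<open>network h\<close>]
    by (auto simp: set_Pi_pmf set_provider_law[OF \<open>network h\<close>] intro!: finite_PiE_dflt)
  moreover have "finite (set_pmf (request_law S))"
    by (rule finite_subset[of _ "Pow (players S)"]) (use request_subset finite_players in auto)
  ultimately show ?thesis by (auto simp: nature_def)
qed

lemma finite_to_favor_node: "finite (set_pmf (to_favor_node S g \<sigma> H))"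
proof -
  have "finite (set_pmf (link_decisions g \<sigma> H))"
    unfolding link_decisions_def set_Pi_pmf[OF finite_links[OF g]]
    by (rule finite_PiE_dflt[OF finite_links[OF g]]) simp
  then show ?thesis using finite_nature[OF rem] by (auto simp: to_favor_node_def)
qed

lemma finite_outcome: "finite (set_pmf (outcome S g \<sigma> t))"
proof (induction t)
  case (Suc t)
  have "finite (set_pmf (finish_favor g \<sigma> x))" if x: "x \<in> set_pmf (to_favor_node S g \<sigma> H)" for x H
  proof -
    obtain k f where "x = Favor_node H k f" "f \<in> set_pmf (nature S (remaining (current_network g H) k))"
      using x by (auto simp: set_to_favor_node)
    moreover from this have "finite (dom f)" using nature_dom_finite[OF rem] by blast
    then have "finite (set_pmf (favor_decisions g \<sigma> H k f))"
      unfolding favor_decisions_def by (simp add: set_Pi_pmf finite_PiE_dflt)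
    ultimately show ?thesis by simp
  qed
  then show ?case using Suc finite_to_favor_node by (auto simp: outcome_def)
qed (simp add: outcome_def)

lemma finite_node_law: "finite (set_pmf (node_law S g \<sigma> I))"
  using finite_outcome finite_to_favor_node by (cases I) auto

lemma trigger_belief:
  assumes "I \<in> info_sets S g i"
  shows "\<exists>\<mu>. (\<forall>x. (\<lambda>n. pmf (cond_pmf (node_law S g (trembling n) I) {y. info_of g i y = I}) x) \<longlonglongrightarrow> pmf \<mu> x) \<and>
    (\<forall>x\<in>set_pmf \<mu>. x \<in> {x. node_feasible g x \<and> info_of g i x = I} \<and>
       (\<forall>y\<in>{x. node_feasible g x \<and> info_of g i x = I}. node_trembles g x \<le> node_trembles g y))"
proof (rule limit_belief)
  let ?X = "{x. node_feasible g x \<and> info_of g i x = I}"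
  show "vanishes (\<lambda>n. pmf (node_law S g (trembling n) I) x) (node_trembles g x)" if "x \<in> ?X" for x
    using vanishes_node_law that by blast
  then have "0 < pmf (node_law S g (trembling 0) I) x" if "x \<in> ?X" for x
    using that unfolding vanishes_def by blast
  \<comment> \<open>Finiteness of the information set: its feasible nodes all lie in the finite
    support of the node law under the completely mixed \<open>trembling 0\<close>.\<close>
  then have "?X \<subseteq> set_pmf (node_law S g (trembling 0) I)"
    by (intro subsetI) (metis less_irrefl set_pmf_iff)
  then show "finite ?X" using finite_node_law finite_subset by blast
  show "?X \<noteq> {}" using assms node_law_feasible by (auto simp: info_sets_def)
  show "?X \<subseteq> {y. info_of g i y = I}" by blast
  show "pmf (node_law S g (trembling n) I) x = 0" if "x \<in> {y. info_of g i y = I}" "x \<notin> ?X" for x n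
    using that node_law_feasible by (auto simp: pmf_eq_0_set_pmf)
qed

end

end

subsection \<open>Beliefs about links among other players\<close>

text \<open>
  Replacing everything that does not concern \<open>i\<close> by uneventful play leaves the information of \<open>i\<close>
  unchanged and removes precisely the trembles in which \<open>i\<close> is not involved.
\<close>

definition own_kept :: "'a \<Rightarrow> ('a \<times> 'a \<Rightarrow> bool) \<Rightarrow> 'a \<times> 'a \<Rightarrow> bool" where
  "own_kept i k = (\<lambda>(a, b). a = i \<or> b = i \<longrightarrow> k (a, b))"

definition own_period :: "'a \<Rightarrow> 'a period \<Rightarrow> 'a period" where
  "own_period i x = Period (own_kept i (kept x)) (own_plays i (provider x))
     (\<lambda>r. (\<exists>l. own_plays i (provider x) r = Some l) \<and> coop x r)"

abbreviation own_history :: "'a \<Rightarrow> 'a history \<Rightarrow> 'a history" where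
  "own_history i \<equiv> map (own_period i)"

fun own_node :: "'a \<Rightarrow> 'a node \<Rightarrow> 'a node" where
  "own_node i (Link_node H) = Link_node (own_history i H)"
| "own_node i (Favor_node H k f) = Favor_node (own_history i H) (own_kept i k) (own_plays i f)"

lemma own_kept_simps [simp]:
  "own_kept i k (i, b) = k (i, b)" "own_kept i k (a, i) = k (a, i)"
  "a \<noteq> i \<Longrightarrow> b \<noteq> i \<Longrightarrow> own_kept i k (a, b)"
  by (auto simp: own_kept_def)

lemma own_period_simps [simp]:
  "kept (own_period i x) = own_kept i (kept x)" "provider (own_period i x) = own_plays i (provider x)"
  "coop (own_period i x) r \<longleftrightarrow> (\<exists>l. own_plays i (provider x) r = Some l) \<and> coop x r"
  by (simp_all add: own_period_def)

lemma own_plays_idem [simp]: "own_plays i (own_plays i f) = own_plays i f"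
  by (auto simp: own_plays_def fun_eq_iff)

lemma own_plays_Some_iff: "own_plays i f r = Some l \<longleftrightarrow> f r = Some l \<and> (r = i \<or> l = i)"
  by (auto simp: own_plays_def)

lemma link_own_history:
  "{a, b} \<in> current_network g (own_history i H) \<longleftrightarrow>
    (if a = i \<or> b = i then {a, b} \<in> current_network g H else {a, b} \<in> g)"
  by (induction H) (auto simp: link_remaining_iff)

lemma nbrs_own_history: "nbrs (current_network g (own_history i H)) i = nbrs (current_network g H) i"
  by (auto simp: nbrs_def link_own_history)

lemma private_own_history: "private_history g i (own_history i H) = private_history g i H"
proof (induction H)
  case (Cons x H)
  have "map_option (\<lambda>j. (j, coop (own_period i x) k)) (own_plays i (provider (own_period i x)) k)
      = map_option (\<lambda>j. (j, coop x k)) (own_plays i (provider x) k)" for k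
    by (cases "own_plays i (provider x) k") auto
  moreover have "nbrs (current_network g (own_history i (x # H))) i = nbrs (current_network g (x # H)) i"
    by (rule nbrs_own_history)
  ultimately show ?case using Cons by simp
qed simp

lemma info_of_own_node: "info_of g i (own_node i x) = info_of g i x"
  by (cases x) (simp_all add: private_own_history)

lemma trusting_own_history:
  assumes "a \<noteq> b"
  shows "trusting (own_history i H) a b \<longleftrightarrow> (a = i \<or> b = i \<longrightarrow> trusting H a b)"
proof -
  have "dealing (own_period i x) a b = (if a = i \<or> b = i then dealing x a b else None)" for x a b
    by (auto simp: dealing_def own_plays_Some_iff)
  then show ?thesis by (auto simp: trusting_def)
qed

lemma link_trembles_own:
  "link_trembles g (own_history i H) (own_kept i k) = {(a, b) \<in> link_trembles g H k. a = i \<or> b = i}"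
  by (force simp: link_trembles_def mem_nbrs_iff link_own_history trusting_own_history)

lemma favor_trembles_own:
  assumes "\<And>r l. f r = Some l \<Longrightarrow> r \<noteq> l"
  shows "favor_trembles (own_history i H) (own_plays i f) (\<lambda>r. (\<exists>l. own_plays i f r = Some l) \<and> a r)
    = {r \<in> favor_trembles H f a. r = i \<or> f r = Some i}"
proof (intro set_eqI)
  fix r
  show "r \<in> favor_trembles (own_history i H) (own_plays i f) (\<lambda>r. (\<exists>l. own_plays i f r = Some l) \<and> a r) \<longleftrightarrow>
      r \<in> {r \<in> favor_trembles H f a. r = i \<or> f r = Some i}"
  proof (cases "own_plays i f r")
    case None
    then show ?thesis by (auto simp: favor_trembles_def own_plays_def split: if_splits)
  next
    case (Some l)
    then have "f r = Some l" "r = i \<or> l = i" by (simp_all add: own_plays_Some_iff)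
    then show ?thesis
      using Some assms[of r l] trusting_own_history[of l r i H] by (auto simp: favor_trembles_def)
  qed
qed

text \<open>Presence of a link is not enough: if its owners distrust each other, trigger strategies
  remove it at the next link stage and the degrees of partners fall.\<close>

definition intact :: "'a \<Rightarrow> 'a network \<Rightarrow> 'a history \<Rightarrow> bool" where
  "intact i g H \<longleftrightarrow>
    (\<forall>a b. {a, b} \<in> g \<and> a \<noteq> i \<and> b \<noteq> i \<longrightarrow> {a, b} \<in> current_network g H \<and> trusting H a b)"

definition links_intact :: "'a \<Rightarrow> 'a network \<Rightarrow> 'a network \<Rightarrow> bool" where
  "links_intact i g h \<longleftrightarrow> (\<forall>a b. {a, b} \<in> g \<and> a \<noteq> i \<and> b \<noteq> i \<longrightarrow> {a, b} \<in> h)"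

fun node_intact :: "'a \<Rightarrow> 'a network \<Rightarrow> 'a node \<Rightarrow> bool" where
  "node_intact i g (Link_node H) \<longleftrightarrow> intact i g H"
| "node_intact i g (Favor_node H k f) \<longleftrightarrow> intact i g H \<and> links_intact i g (remaining (current_network g H) k)"

context favor_society
begin

context
  fixes g :: "'a network"
  assumes g: "network g"
begin

lemma feasible_stage_own:
  assumes "feasible_stage g H k f"
  shows "feasible_stage g (own_history i H) (own_kept i k) (own_plays i f)"
  unfolding feasible_stage_def
proof (intro conjI allI impI)
  fix a b assume "b \<notin> nbrs (current_network g (own_history i H)) a"
  then show "own_kept i k (a, b)"
    using assms by (auto simp: own_kept_def feasible_stage_def mem_nbrs_iff link_own_history)
next
  let ?h = "remaining (current_network g H) k" and ?h' = "remaining (current_network g (own_history i H)) (own_kept i k)"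
  have nets: "network ?h" "network ?h'"
    using network_on_remaining[OF network_on_current[OF g]] by blast+
  have "f \<in> set_pmf (nature S ?h)" using assms by (simp add: feasible_stage_def)
  then obtain R where R: "R \<in> set_pmf (request_law S)" "dom f \<subseteq> R" "\<And>r l. f r = Some l \<Longrightarrow> l \<in> nbrs ?h r"
    unfolding set_nature[OF nets(1)] by blast
  have "dom (own_plays i f) \<subseteq> R" using R(2) by (auto simp: own_plays_Some_iff)
  moreover have "l \<in> nbrs ?h' r" if "own_plays i f r = Some l" for r l
    using that R(3)[of r l] by (auto simp: own_plays_Some_iff mem_nbrs_iff link_remaining_iff link_own_history)
  ultimately show "own_plays i f \<in> set_pmf (nature S ?h')"
    unfolding set_nature[OF nets(2)] using R(1) by blast
qed

lemma feasible_own: "feasible g H \<Longrightarrow> feasible g (own_history i H)"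
  by (induction H) (auto intro: feasible_stage_own)

lemma node_feasible_own: "node_feasible g x \<Longrightarrow> node_feasible g (own_node i x)"
  by (cases x) (auto simp: feasible_own feasible_stage_own)

lemma finite_link_trembles: "finite (link_trembles g H k)"
  by (rule finite_subset[OF _ finite_links[OF g, of H]]) (auto simp: link_trembles_def)

lemma feasible_stage_dealers:
  assumes "feasible_stage g H k f"
  shows "finite (favor_trembles H' f a)" "f r = Some l \<Longrightarrow> r \<noteq> l" "f r = Some l \<Longrightarrow> {r, l} \<in> g"
    "f r = Some l \<Longrightarrow> {r, l} \<in> remaining (current_network g H) k"
proof -
  have n: "network (remaining (current_network g H) k)"
    using network_on_remaining[OF network_on_current[OF g]] by blast
  have f: "f \<in> set_pmf (nature S (remaining (current_network g H) k))"
    using assms by (simp add: feasible_stage_def)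
  show "finite (favor_trembles H' f a)"
    by (rule finite_subset[OF _ nature_dom_finite[OF n f]]) (auto simp: favor_trembles_def)
  show "f r = Some l \<Longrightarrow> r \<noteq> l" by (rule nature_request(5)[OF n f])
  show *: "f r = Some l \<Longrightarrow> {r, l} \<in> remaining (current_network g H) k"
    using nature_request(2)[OF n f] by (simp add: mem_nbrs_iff)
  show "f r = Some l \<Longrightarrow> {r, l} \<in> g"
    using * remaining_subset current_network_subset by (metis subsetD)
qed

lemma card_link_trembles_own:
  "card (link_trembles g (own_history i H) (own_kept i k)) \<le> card (link_trembles g H k)"
  unfolding link_trembles_own by (rule card_mono[OF finite_link_trembles]) auto

lemma card_favor_trembles_own:
  assumes "feasible_stage g H k f"
  shows "card (favor_trembles (own_history i H) (own_plays i f) (\<lambda>r. (\<exists>l. own_plays i f r = Some l) \<and> a r))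
    \<le> card (favor_trembles H f a)"
  by (rule card_mono[OF feasible_stage_dealers(1)[OF assms]])
    (subst favor_trembles_own, use feasible_stage_dealers(2)[OF assms] in auto)

lemma trembles_own_le: "feasible g H \<Longrightarrow> trembles g (own_history i H) \<le> trembles g H"
proof (induction H)
  case (Cons x H)
  then show ?case
    using card_link_trembles_own[of i H "kept x"] card_favor_trembles_own[of H "kept x" "provider x" i "coop x"]
    by (simp add: own_period_def[of i x])
qed simp

text \<open>The trembles of the replica are those of the original that involve \<open>i\<close>.
  Equal finite cardinality makes the two sets equal, so no decision between two other players
  deviated from trust.\<close>

lemma links_intact_step:
  assumes "intact i g H"
    and "card (link_trembles g (own_history i H) (own_kept i k)) = card (link_trembles g H k)"
  shows "links_intact i g (remaining (current_network g H) k)"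
  unfolding links_intact_def
proof (intro allI impI)
  fix a b assume ab: "{a, b} \<in> g \<and> a \<noteq> i \<and> b \<noteq> i"
  have sub: "link_trembles g (own_history i H) (own_kept i k) \<subseteq> link_trembles g H k"
    unfolding link_trembles_own by auto
  have "link_trembles g (own_history i H) (own_kept i k) = link_trembles g H k"
    by (rule card_subset_eq[OF finite_link_trembles sub assms(2)])
  then have *: "(c, d) \<notin> link_trembles g H k" if "c \<noteq> i" "d \<noteq> i" for c d
    using that unfolding link_trembles_own by auto
  have "{a, b} \<in> current_network g H" "trusting H a b" "a \<noteq> b"
    using assms(1) ab network_on_linkD[OF g] unfolding intact_def by blast+
  then show "{a, b} \<in> remaining (current_network g H) k"
    using *[of a b] *[of b a] ab
    by (simp add: link_trembles_def mem_nbrs_iff link_remaining_iff trusting_commute insert_commute)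
qed

text \<open>The replica is weakly cheaper in each of the three summands of \<open>trembles\<close>;
  if it is not cheaper in total, all three agree and the others never erred.\<close>

lemma intact_of_trembles_own:
  assumes "feasible g H" "trembles g H \<le> trembles g (own_history i H)"
  shows "intact i g H"
  using assms
proof (induction H)
  case (Cons x H)
  let ?f = "provider x" and ?a = "coop x"
  have fs: "feasible g H" "feasible_stage g H (kept x) ?f" using Cons.prems by auto
  note le = trembles_own_le[OF fs(1), of i] card_link_trembles_own[of i H "kept x"]
    card_favor_trembles_own[OF fs(2), where i = i and a = ?a]
  have "trembles g H + card (link_trembles g H (kept x)) + card (favor_trembles H ?f ?a)
      \<le> trembles g (own_history i H) + card (link_trembles g (own_history i H) (own_kept i (kept x)))
        + card (favor_trembles (own_history i H) (own_plays i ?f) (\<lambda>r. (\<exists>l. own_plays i ?f r = Some l) \<and> ?a r))"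
    using Cons.prems(2) by (simp add: own_period_def[of i x])
  then have eq: "trembles g H = trembles g (own_history i H)"
    "card (link_trembles g (own_history i H) (own_kept i (kept x))) = card (link_trembles g H (kept x))"
    "card (favor_trembles (own_history i H) (own_plays i ?f) (\<lambda>r. (\<exists>l. own_plays i ?f r = Some l) \<and> ?a r))
      = card (favor_trembles H ?f ?a)"
    using le by linarith+
  have H: "intact i g H" using Cons.IH fs eq by simp
  have links: "links_intact i g (remaining (current_network g H) (kept x))"
    by (rule links_intact_step[OF H eq(2)])
  have favors: "r \<notin> favor_trembles H ?f ?a" if "r \<noteq> i" "?f r \<noteq> Some i" for r
  proof -
    note own = favor_trembles_own[OF feasible_stage_dealers(2)[OF fs(2)], where i = i and H = H and a = ?a]
    have "{r \<in> favor_trembles H ?f ?a. r = i \<or> ?f r = Some i} = favor_trembles H ?f ?a"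
      by (rule card_subset_eq[OF feasible_stage_dealers(1)[OF fs(2)]]) (use eq(3) own in auto)
    then show ?thesis using that by auto
  qed
  have coop: "?a c" if "?f c = Some d" "c \<noteq> i" "d \<noteq> i" for c d
  proof -
    have "trusting H d c"
      using H feasible_stage_dealers(3)[OF fs(2) that(1)] that by (auto simp: intact_def trusting_commute)
    then show ?thesis using favors[of c] that by (auto simp: favor_trembles_def)
  qed
  show ?case
    unfolding intact_def
  proof (intro allI impI conjI)
    fix a b assume ab: "{a, b} \<in> g \<and> a \<noteq> i \<and> b \<noteq> i"
    then show "{a, b} \<in> current_network g (x # H)" using links by (simp add: links_intact_def)
    show "trusting (x # H) a b"
      using H ab coop[of a b] coop[of b a] unfolding trusting_Cons by (auto simp: intact_def dealing_def)
  qed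
qed (simp add: intact_def)

lemma node_intact_of_trembles_own:
  assumes "node_feasible g x" "node_trembles g x \<le> node_trembles g (own_node i x)"
  shows "node_intact i g x"
proof (cases x)
  case (Link_node H)
  then show ?thesis using assms intact_of_trembles_own by simp
next
  case (Favor_node H k f)
  have "trembles g H = trembles g (own_history i H)"
    "card (link_trembles g (own_history i H) (own_kept i k)) = card (link_trembles g H k)"
    using assms trembles_own_le[of H i] card_link_trembles_own[of i H k] by (simp_all add: Favor_node)
  then show ?thesis using assms intact_of_trembles_own[of H i] links_intact_step by (simp add: Favor_node)
qed

text \<open>The replica \<open>own_node i x\<close> lies in the same information set as
  \<open>x\<close>, so a node with the fewest trembles cannot need more of them than its
  replica.\<close>

lemma intact_belief:
  assumes "I \<in> info_sets S g i"
  shows "\<exists>\<mu>. (\<forall>x. (\<lambda>n. pmf (cond_pmf (node_law S g (trembling n) I) {y. info_of g i y = I}) x) \<longlonglongrightarrow> pmf \<mu> x) \<and>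
    (\<forall>x\<in>set_pmf \<mu>. node_feasible g x \<and> node_intact i g x)"
proof -
  let ?X = "{x. node_feasible g x \<and> info_of g i x = I}"
  obtain \<mu> where \<mu>: "\<forall>x. (\<lambda>n. pmf (cond_pmf (node_law S g (trembling n) I) {y. info_of g i y = I}) x) \<longlonglongrightarrow> pmf \<mu> x"
    "\<forall>x\<in>set_pmf \<mu>. x \<in> ?X \<and> (\<forall>y\<in>?X. node_trembles g x \<le> node_trembles g y)"
    using trigger_belief[OF g assms] by blast
  have "node_feasible g x \<and> node_intact i g x" if "x \<in> set_pmf \<mu>" for x
  proof -
    have x: "node_feasible g x" "info_of g i x = I" using \<mu>(2) that by auto
    then have "own_node i x \<in> ?X" using node_feasible_own info_of_own_node[of g i x] by simp
    then show ?thesis using \<mu>(2) that x node_intact_of_trembles_own by blast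
  qed
  with \<mu>(1) show ?thesis by blast
qed

text \<open>The single sequence \<open>trembling\<close> serves all players and information sets at
  once, so limit beliefs can be chosen for each information set separately.\<close>

lemma consistent_trigger:
  "\<exists>\<mu>. consistent S g trigger \<mu> \<and>
    (\<forall>i. \<forall>I\<in>info_sets S g i. \<forall>x\<in>set_pmf (\<mu> i I). node_feasible g x \<and> node_intact i g x)"
proof -
  let ?Q = "\<lambda>i I \<mu>. (\<forall>x. (\<lambda>n. pmf (cond_pmf (node_law S g (trembling n) I) {y. info_of g i y = I}) x) \<longlonglongrightarrow> pmf \<mu> x) \<and>
    (\<forall>x\<in>set_pmf \<mu>. node_feasible g x \<and> node_intact i g x)"
  define \<mu> where "\<mu> i I = (SOME \<mu>. ?Q i I \<mu>)" for i I
  have \<mu>: "?Q i I (\<mu> i I)" if "I \<in> info_sets S g i" for i I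
    unfolding \<mu>_def by (rule someI_ex) (rule intact_belief[OF that])
  have "consistent S g trigger \<mu>"
    unfolding consistent_def using completely_mixed_trembling trembling_tendsto \<mu> by blast
  then show ?thesis using \<mu> by blast
qed

end

end

subsection \<open>Optimality of trigger strategies in regular networks\<close>

lemma expectation_mono:
  fixes f h :: "'b \<Rightarrow> real"
  assumes "integrable (measure_pmf M) f" "integrable (measure_pmf M) h" "\<And>x. x \<in> set_pmf M \<Longrightarrow> f x \<le> h x"
  shows "measure_pmf.expectation M f \<le> measure_pmf.expectation M h"
  by (rule integral_mono_AE[OF assms(1,2)]) (auto intro!: AE_pmfI assms(3))

locale regular_network = favor_society S for S :: "'a society" +
  fixes g :: "'a network" and B :: nat
  assumes g: "network g" and regular: "\<And>i. i \<in> players S \<Longrightarrow> deg g i = B"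
    and surplus_B: "\<And>i. i \<in> players S \<Longrightarrow> 0 < B \<Longrightarrow> 0 \<le> surplus (cost S i) B B"
begin

context
  fixes i assumes i: "i \<in> players S"
begin

section \<open>The value of a number of bonds\<close>

abbreviation "c \<equiv> cost S i"

text \<open>When \<open>i\<close> loses a link, the degree of the former partner falls, but not that
  of the remaining ones; they keep asking at the rate of degree \<open>B\<close>. Hence the flow
  depends on the number \<open>m\<close> alone.\<close>

definition flow :: "nat \<Rightarrow> real" where
  "flow m = \<alpha> * v * (1 - q ^ m) - c * (real m * (\<alpha> * share B))"

text \<open>The value of \<open>m\<close> links in good standing, all of them with partners of degree \<open>B\<close>.\<close>

definition value_of :: "nat \<Rightarrow> real" where
  "value_of m = flow m / (1 - \<delta>)"

lemma value_of_eq: "flow m + \<delta> * value_of m = value_of m"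
  using params by (simp add: value_of_def field_simps)

lemma cost: "\<gamma> < c" "c < v" "0 < c" "0 < v"
  using cost_bounds[OF i] params by linarith+

text \<open>At an own degree of at most \<open>B\<close> the marginal benefit is at least that at
  \<open>B\<close>, so the single hypothesis on \<open>surplus (cost S i) B B\<close> covers all
  smaller numbers of bonds.\<close>

lemma value_of_Suc:
  assumes "Suc m \<le> B"
  shows "\<delta> * value_of m + (c - \<gamma>) \<le> \<delta> * value_of (Suc m)"
proof -
  have "0 \<le> surplus c B B" using surplus_B[OF i] assms by simp
  also have "\<dots> \<le> surplus c (Suc m) B" by (rule surplus_antimono_left) (use assms cost in auto)
  finally have "(1 - \<delta>) / \<delta> * (c - \<gamma>) \<le> \<alpha> * (v * q ^ m * p - c * share B)"
    by (simp add: surplus_nonneg_iff)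
  also have "\<dots> = flow (Suc m) - flow m"
    using power_Suc_diff[of m] by (simp add: flow_def algebra_simps)
  finally have "(c - \<gamma>) \<le> \<delta> / (1 - \<delta>) * (flow (Suc m) - flow m)"
    using params by (simp add: field_simps)
  moreover have "\<delta> * value_of (Suc m) - \<delta> * value_of m = \<delta> / (1 - \<delta>) * (flow (Suc m) - flow m)"
    by (simp add: value_of_def diff_divide_distrib right_diff_distrib)
  ultimately show ?thesis by linarith
qed

text \<open>Needed for several refusals at once: the request law may let many partners ask
  \<open>i\<close> in the same period.\<close>

lemma value_of_drop:
  assumes "x \<le> n" "n \<le> B"
  shows "\<delta> * value_of (n - x) + real x * (c - \<gamma>) \<le> \<delta> * value_of n"
  using assms(1)
proof (induction x)
  case (Suc x)
  have "\<delta> * value_of (n - Suc x) + (c - \<gamma>) \<le> \<delta> * value_of (Suc (n - Suc x))"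
    by (rule value_of_Suc) (use Suc assms in auto)
  also have "Suc (n - Suc x) = n - x" using Suc by simp
  finally show ?case using Suc by (simp add: algebra_simps)
qed simp

lemma value_of_mono: "m \<le> n \<Longrightarrow> n \<le> B \<Longrightarrow> value_of m \<le> value_of n"
proof -
  assume *: "m \<le> n" "n \<le> B"
  have "\<delta> * value_of (n - (n - m)) + real (n - m) * (c - \<gamma>) \<le> \<delta> * value_of n"
    by (rule value_of_drop) (use * in auto)
  moreover have "0 \<le> real (n - m) * (c - \<gamma>)" using cost by simp
  ultimately have "\<delta> * value_of m \<le> \<delta> * value_of n" using * by simp
  then show ?thesis using params by simp
qed

definition bonds :: "'a history \<Rightarrow> 'a set" where
  "bonds H = {j \<in> nbrs (current_network g H) i. trusting H i j}"

definition bonds_left :: "'a history \<Rightarrow> ('a \<times> 'a \<Rightarrow> bool) \<Rightarrow> 'a set" where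
  "bonds_left H k = {j \<in> nbrs (remaining (current_network g H) k) i. trusting H i j}"

definition bond_value :: "'a history \<Rightarrow> real" where
  "bond_value H = value_of (card (bonds H))"

text \<open>The value of a favor node under trigger play. Distrusted partners are included because
  off the path both sides may have trembled and kept a link without trust.\<close>

definition favor_value :: "'a history \<Rightarrow> ('a \<times> 'a \<Rightarrow> bool) \<Rightarrow> ('a \<Rightarrow> 'a option) \<Rightarrow> real" where
  "favor_value H k f = (if \<exists>l. f i = Some l \<and> trusting H i l then v else 0)
     + (\<Sum>r | r \<in> players S \<and> f r = Some i. if trusting H i r then - c else - \<gamma>)
     + \<delta> * value_of (card (bonds_left H k))"

lemma card_nbrs_le:
  assumes "X \<subseteq> nbrs g i"
  shows "finite X" "card X \<le> B"
  using assms finite_subset nbrs_finite[OF g, of i] card_mono[OF nbrs_finite[OF g] assms] regular[OF i]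
  by (auto simp: deg_def)

lemma bonds_subset: "bonds H \<subseteq> nbrs g i" "bonds_left H k \<subseteq> nbrs g i" "bonds_left H k \<subseteq> bonds H"
  using nbrs_mono[OF current_network_subset[of g H], of i] nbrs_mono[OF remaining_subset[of "current_network g H" k], of i]
  by (auto simp: bonds_def bonds_left_def)

lemma bond_value_bound: "\<bar>bond_value H\<bar> \<le> value_of B"
proof -
  have "value_of 0 = 0" by (simp add: value_of_def flow_def)
  then show ?thesis
    using value_of_mono[of 0 "card (bonds H)"] value_of_mono[of "card (bonds H)" B] card_nbrs_le(2)[OF bonds_subset(1)]
    unfolding bond_value_def by fastforce
qed

lemma step_bound: "\<bar>stage_payoff S i (hd H) + \<delta> * bond_value H\<bar> \<le> stage_bound i + \<delta> * value_of B"
proof -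
  have "\<bar>\<delta> * bond_value H\<bar> \<le> \<delta> * value_of B"
    using bond_value_bound[of H] params by (simp add: abs_mult)
  then show ?thesis using stage_payoff_bound[of i "hd H"] abs_triangle_ineq[of "stage_payoff S i (hd H)" "\<delta> * bond_value H"]
    by linarith
qed

section \<open>One-period comparison of a deviation with trigger play\<close>

abbreviation against :: "'a strategy \<Rightarrow> 'a profile" where
  "against s \<equiv> trigger(i := s)"

lemma rem: "network (remaining (current_network g H) k)"
  using network_on_remaining[OF network_on_current[OF g]] .

lemma against_favor:
  assumes f: "f \<in> set_pmf (nature S (remaining (current_network g H) k))"
    and a: "a \<in> set_pmf (favor_decisions g (against s) H k f)" and r: "f r = Some l"
  shows "l \<noteq> i \<Longrightarrow> a r \<longleftrightarrow> trusting H l r" and "s = trigger i \<Longrightarrow> a r \<longleftrightarrow> trusting H l r"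
proof -
  have "l \<noteq> r" using nature_request(5)[OF rem f r] by simp
  moreover have "a r \<in> set_pmf (against s l (info_of g l (Favor_node H k f)) r)"
    using a r unfolding set_favor_decisions[OF nature_dom_finite[OF rem f]] by blast
  ultimately show "l \<noteq> i \<Longrightarrow> a r \<longleftrightarrow> trusting H l r" and "s = trigger i \<Longrightarrow> a r \<longleftrightarrow> trusting H l r"
    by (auto simp: trigger_def trusts_iff split: if_splits)
qed

text \<open>Answers to the requests of \<open>i\<close> merely follow trust, so a trusted bond still
  present at the favor stage ends only through a refusal by \<open>i\<close> herself. Serving a
  distrusted partner restores nothing and costs more than the penalty.\<close>

lemma favor_stage:
  assumes f: "f \<in> set_pmf (nature S (remaining (current_network g H) k))"
    and a: "a \<in> set_pmf (favor_decisions g (against s) H k f)"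
  defines "H' \<equiv> Period k f a # H"
  shows "stage_payoff S i (hd H') + \<delta> * bond_value H' \<le> favor_value H k f"
    and "s = trigger i \<Longrightarrow> stage_payoff S i (hd H') + \<delta> * bond_value H' = favor_value H k f"
proof -
  let ?R = "{r. r \<in> players S \<and> f r = Some i}"
  \<comment> \<open>The trusted requesters whom \<open>i\<close> refuses: each saves her
    \<open>c - \<gamma>\<close> now and destroys one bond.\<close>
  define X where "X = {r. f r = Some i \<and> trusting H i r \<and> \<not> a r}"
  note req = nature_request[OF rem f]
  have ai: "a i \<longleftrightarrow> trusting H i l" if "f i = Some l" for l
    using against_favor(1)[OF f a that] req(5)[OF that] by (simp add: trusting_commute)
  have "bonds H' = bonds_left H k - X"
  proof (intro set_eqI iffI)
    fix j assume "j \<in> bonds H'"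
    then show "j \<in> bonds_left H k - X"
      by (auto simp: bonds_def bonds_left_def H'_def trusting_Cons dealing_def X_def split: if_splits)
  next
    fix j assume "j \<in> bonds_left H k - X"
    then show "j \<in> bonds H'"
      using ai[of j] by (auto simp: bonds_def bonds_left_def H'_def trusting_Cons dealing_def X_def)
  qed
  moreover have XB: "X \<subseteq> bonds_left H k"
    using req(3) by (auto simp: X_def bonds_left_def)
  moreover have finX: "finite X" using card_nbrs_le(1)[OF bonds_subset(2)] XB finite_subset by blast
  ultimately have bv: "bond_value H' = value_of (card (bonds_left H k) - card X)"
    by (simp add: bond_value_def card_Diff_subset)
  have drop: "\<delta> * bond_value H' + real (card X) * (c - \<gamma>) \<le> \<delta> * value_of (card (bonds_left H k))"
    unfolding bv using card_nbrs_le[OF bonds_subset(2)] XB by (intro value_of_drop card_mono) auto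
  have st: "stage_payoff S i (hd H') = (if \<exists>l. f i = Some l \<and> trusting H i l then v else 0)
      + (\<Sum>r\<in>?R. if a r then - c else - \<gamma>)"
    using ai by (cases "f i") (auto simp: stage_payoff_def H'_def)
  have "(\<Sum>r\<in>?R. if a r then - c else - \<gamma>)
      \<le> (\<Sum>r\<in>?R. (if trusting H i r then - c else - \<gamma>) + (if r \<in> X then c - \<gamma> else 0))"
    by (rule sum_mono) (use cost in \<open>auto simp: X_def\<close>)
  also have "\<dots> = (\<Sum>r\<in>?R. if trusting H i r then - c else - \<gamma>) + real (card X) * (c - \<gamma>)"
  proof -
    have "?R \<inter> X = X" using req(1) by (auto simp: X_def)
    then show ?thesis using finite_players by (simp add: sum.distrib sum.If_cases)
  qed
  finally show "stage_payoff S i (hd H') + \<delta> * bond_value H' \<le> favor_value H k f"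
    using drop unfolding st favor_value_def by linarith
  assume s: "s = trigger i"
  have "a r \<longleftrightarrow> trusting H i r" if "f r = Some i" for r using against_favor(2)[OF f a that s] .
  then have "X = {}" and "(\<Sum>r\<in>?R. if a r then - c else - \<gamma>) = (\<Sum>r\<in>?R. if trusting H i r then - c else - \<gamma>)"
    by (auto simp: X_def intro!: sum.cong)
  then show "stage_payoff S i (hd H') + \<delta> * bond_value H' = favor_value H k f"
    unfolding st favor_value_def bv by simp
qed

lemma intact_Cons:
  assumes "intact i g H" "links_intact i g (remaining (current_network g H) k)"
    and f: "f \<in> set_pmf (nature S (remaining (current_network g H) k))"
    and a: "a \<in> set_pmf (favor_decisions g (against s) H k f)"
  shows "intact i g (Period k f a # H)"
  unfolding intact_def
proof (intro allI impI conjI)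
  fix x y assume xy: "{x, y} \<in> g \<and> x \<noteq> i \<and> y \<noteq> i"
  then show "{x, y} \<in> current_network g (Period k f a # H)" using assms(2) by (simp add: links_intact_def)
  have "trusting H x y" using assms(1) xy by (simp add: intact_def)
  then show "trusting (Period k f a # H) x y"
    using against_favor(1)[OF f a, of x y] against_favor(1)[OF f a, of y x] xy
    by (auto simp: trusting_Cons dealing_def trusting_commute)
qed

text \<open>Whatever \<open>i\<close> decides, a distrusting partner removes the link on her own. So
  the links of \<open>i\<close> that survive the link stage are trusted ones, and \<open>i\<close>
  can only reduce their number further.\<close>

lemma against_links:
  assumes H: "intact i g H" and k: "k \<in> set_pmf (link_decisions g (against s) H)"
  shows "links_intact i g (remaining (current_network g H) k)"
    and "nbrs (remaining (current_network g H) k) i = bonds_left H k"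
    and "s = trigger i \<Longrightarrow> bonds_left H k = bonds H"
proof -
  let ?c = "current_network g H"
  have kt: "k (a, b) \<longleftrightarrow> trusting H a b" if "b \<in> nbrs ?c a" "a \<noteq> i \<or> s = trigger i" for a b
  proof -
    have "k (a, b) \<in> set_pmf (against s a (Link_info (private_history g a H)) b)"
      using k that(1) unfolding set_link_decisions[OF g] by presburger
    moreover have "a \<noteq> b" using that(1) by (auto simp: mem_nbrs_iff)
    ultimately show ?thesis using that(2) by (auto simp: trigger_def trusts_iff split: if_splits)
  qed
  show "links_intact i g (remaining ?c k)"
    unfolding links_intact_def
  proof (intro allI impI)
    fix a b assume ab: "{a, b} \<in> g \<and> a \<noteq> i \<and> b \<noteq> i"
    then have "{a, b} \<in> ?c" "trusting H a b" "a \<noteq> b"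
      using H network_on_linkD[OF g] unfolding intact_def by blast+
    then show "{a, b} \<in> remaining ?c k"
      using kt[of b a] kt[of a b] ab by (simp add: link_remaining_iff mem_nbrs_iff insert_commute trusting_commute)
  qed
  show "nbrs (remaining ?c k) i = bonds_left H k"
    using kt[of i] by (auto simp: bonds_left_def nbrs_remaining mem_nbrs_commute trusting_commute mem_nbrs_iff)
  assume "s = trigger i"
  then show "bonds_left H k = bonds H"
    using kt by (auto simp: bonds_left_def bonds_def nbrs_remaining mem_nbrs_commute trusting_commute)
qed

text \<open>Only links of \<open>i\<close> can be missing from \<open>h\<close>, and a current
  partner still has hers; every current partner thus keeps her whole neighborhood and its degree
  \<open>B\<close>.\<close>

lemma payoff_intact:
  assumes "links_intact i g h" "h \<subseteq> g"
  shows "payoff S h i = flow (card (nbrs h i))"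
proof -
  have "nbrs h j = nbrs g j" if "j \<in> nbrs h i" for j
  proof
    show "nbrs h j \<subseteq> nbrs g j" by (rule nbrs_mono[OF assms(2)])
    show "nbrs g j \<subseteq> nbrs h j"
    proof
      fix l assume l: "l \<in> nbrs g j"
      show "l \<in> nbrs h j"
      proof (cases "l = i")
        case True
        then show ?thesis using that by (simp add: mem_nbrs_commute)
      next
        case False
        then show ?thesis using that l assms(1) unfolding mem_nbrs_iff links_intact_def by blast
      qed
    qed
  qed
  moreover have "j \<in> players S" if "j \<in> nbrs h i" for j
    using that nbrs_subset[OF network_on_mono[OF g assms(2)]] by blast
  ultimately have "favor_prob S h j = \<alpha> * share B" if "j \<in> nbrs h i" for j
    using that regular[of j] by (simp add: favor_prob_eq deg_def)
  then show ?thesis by (simp add: payoff_def flow_def deg_def algebra_simps)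
qed

lemma expectation_favor_value:
  assumes H: "intact i g H" and k: "k \<in> set_pmf (link_decisions g (against s) H)"
  shows "measure_pmf.expectation (nature S (remaining (current_network g H) k)) (favor_value H k)
    = value_of (card (bonds_left H k))"
proof -
  let ?h = "remaining (current_network g H) k"
  note links = against_links(1,2)[OF H k]
  have "measure_pmf.expectation (nature S ?h) (favor_value H k)
      = measure_pmf.expectation (nature S ?h) (\<lambda>f. coop_payoff i f + \<delta> * value_of (card (bonds_left H k)))"
  proof (rule expectation_cong)
    fix f assume f: "f \<in> set_pmf (nature S ?h)"
    have "trusting H i l" if "l \<in> nbrs ?h i" for l
    proof -
      have "l \<in> bonds_left H k" using that links(2) by simp
      then show ?thesis by (simp add: bonds_left_def)
    qed
    then have t: "trusting H i l" if "f i = Some l \<or> f l = Some i" for l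
      using that nature_request(2,3)[OF rem f] by blast
    then have "(\<exists>l. f i = Some l \<and> trusting H i l) \<longleftrightarrow> f i \<noteq> None" by (cases "f i") auto
    moreover have "(\<Sum>r | r \<in> players S \<and> f r = Some i. if trusting H i r then - c else - \<gamma>)
        = (\<Sum>r | r \<in> players S \<and> f r = Some i. - c)"
      using t by (intro sum.cong) auto
    ultimately show "favor_value H k f = coop_payoff i f + \<delta> * value_of (card (bonds_left H k))"
      by (simp add: favor_value_def coop_payoff_def)
  qed
  also have "\<dots> = payoff S ?h i + \<delta> * value_of (card (bonds_left H k))"
    using expectation_coop_payoff[OF rem i] coop_payoff_integrable by simp
  also have "?h \<subseteq> g" using remaining_subset current_network_subset by blast
  then have "payoff S ?h i = flow (card (bonds_left H k))" using payoff_intact[OF links(1)] links(2) by simp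
  finally show ?thesis by (simp add: value_of_eq)
qed

lemma favor_step:
  assumes f: "f \<in> set_pmf (nature S (remaining (current_network g H) k))"
  shows "measure_pmf.expectation (favor_decisions g (against s) H k f)
      (\<lambda>a. stage_payoff S i (Period k f a) + \<delta> * bond_value (Period k f a # H)) \<le> favor_value H k f"
    and "s = trigger i \<Longrightarrow> measure_pmf.expectation (favor_decisions g (against s) H k f)
      (\<lambda>a. stage_payoff S i (Period k f a) + \<delta> * bond_value (Period k f a # H)) = favor_value H k f"
proof -
  let ?h = "\<lambda>a. stage_payoff S i (Period k f a) + \<delta> * bond_value (Period k f a # H)"
  let ?M = "favor_decisions g (against s) H k f"
  have "integrable (measure_pmf ?M) ?h"
    using step_bound[of "Period k f _ # H"] by (intro integrable_bounded_pmf) simp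
  then have "measure_pmf.expectation ?M ?h \<le> measure_pmf.expectation ?M (\<lambda>_. favor_value H k f)"
    using favor_stage(1)[OF f] by (intro expectation_mono) auto
  then show "measure_pmf.expectation ?M ?h \<le> favor_value H k f" by simp
  assume "s = trigger i"
  then have "measure_pmf.expectation ?M ?h = measure_pmf.expectation ?M (\<lambda>_. favor_value H k f)"
    using favor_stage(2)[OF f] by (intro expectation_cong) auto
  then show "measure_pmf.expectation ?M ?h = favor_value H k f" by simp
qed

text \<open>The Bellman inequality for the decision problem whose state is the number of bonds, with
  equality under trigger play.\<close>

lemma link_step:
  assumes H: "intact i g H"
  shows "measure_pmf.expectation (finish_period S g (against s) (Link_node H))
      (\<lambda>H'. stage_payoff S i (hd H') + \<delta> * bond_value H') \<le> bond_value H"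
    and "s = trigger i \<Longrightarrow> measure_pmf.expectation (finish_period S g (against s) (Link_node H))
      (\<lambda>H'. stage_payoff S i (hd H') + \<delta> * bond_value H') = bond_value H"
proof -
  let ?h = "\<lambda>H'. stage_payoff S i (hd H') + \<delta> * bond_value H'"
  let ?E = "measure_pmf.expectation" and ?\<sigma> = "against s"
  let ?F = "\<lambda>k f. ?E (favor_decisions g ?\<sigma> H k f) (\<lambda>a. ?h (Period k f a # H))"
  let ?G = "\<lambda>k. ?E (nature S (remaining (current_network g H) k)) (?F k)"
  have eq: "?E (finish_period S g ?\<sigma> (Link_node H)) ?h = ?E (link_decisions g ?\<sigma> H) ?G"
    unfolding finish_period_Link expectation_bind_pmf[where f = ?h, OF step_bound] by simp
  have bF: "\<bar>?F k f\<bar> \<le> stage_bound i + \<delta> * value_of B" for k f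
    by (rule expectation_abs_le) (rule step_bound)
  have bG: "\<bar>?G k\<bar> \<le> stage_bound i + \<delta> * value_of B" for k
    by (rule expectation_abs_le) (rule bF)
  have int: "integrable (measure_pmf (nature S (remaining (current_network g H) k))) (?F k)"
    "integrable (measure_pmf (nature S (remaining (current_network g H) k))) (favor_value H k)" for k
    by (rule integrable_bounded_pmf, rule bF) (rule integrable_measure_pmf_finite[OF finite_nature[OF g rem]])
  have "?G k \<le> bond_value H" if k: "k \<in> set_pmf (link_decisions g ?\<sigma> H)" for k
  proof -
    have "?G k \<le> ?E (nature S (remaining (current_network g H) k)) (favor_value H k)"
      using favor_step(1) by (intro expectation_mono int) auto
    also have "\<dots> = value_of (card (bonds_left H k))" by (rule expectation_favor_value[OF H k])
    also have "\<dots> \<le> bond_value H"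
      unfolding bond_value_def using card_nbrs_le[OF bonds_subset(1)] bonds_subset(3)
      by (intro value_of_mono card_mono) auto
    finally show ?thesis .
  qed
  then have "?E (link_decisions g ?\<sigma> H) ?G \<le> ?E (link_decisions g ?\<sigma> H) (\<lambda>_. bond_value H)"
    by (intro expectation_mono integrable_bounded_pmf[OF bG]) auto
  then show "?E (finish_period S g ?\<sigma> (Link_node H)) ?h \<le> bond_value H" unfolding eq by simp
  assume s: "s = trigger i"
  have "?G k = bond_value H" if k: "k \<in> set_pmf (link_decisions g ?\<sigma> H)" for k
  proof -
    have "?G k = ?E (nature S (remaining (current_network g H) k)) (favor_value H k)"
      using favor_step(2)[OF _ s] by (intro expectation_cong) auto
    also have "\<dots> = value_of (card (bonds_left H k))" by (rule expectation_favor_value[OF H k])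
    finally show ?thesis unfolding against_links(3)[OF H k s] bond_value_def .
  qed
  then have "?E (link_decisions g ?\<sigma> H) ?G = ?E (link_decisions g ?\<sigma> H) (\<lambda>_. bond_value H)"
    by (rule expectation_cong)
  then show "?E (finish_period S g ?\<sigma> (Link_node H)) ?h = bond_value H" unfolding eq by simp
qed

lemma intact_finish_period:
  assumes "intact i g H" "H' \<in> set_pmf (finish_period S g (against s) (Link_node H))"
  shows "intact i g H'"
  using assms(2) against_links(1)[OF assms(1)] intact_Cons[OF assms(1)] unfolding set_finish_period by blast

lemma node_intact_finish_period:
  assumes "node_feasible g x" "node_intact i g x" "H \<in> set_pmf (finish_period S g (against s) x)"
  shows "intact i g H"
proof (cases x)
  case (Link_node H0)
  then show ?thesis using assms intact_finish_period by simp
next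
  case (Favor_node H0 k f)
  then show ?thesis using assms intact_Cons[of H0 k f] by (auto simp: feasible_stage_def)
qed

lemma trigger_optimal:
  assumes M: "\<And>x. x \<in> set_pmf M \<Longrightarrow> node_feasible g x \<and> node_intact i g x"
  shows "continuation_payoff S g (against s) i M \<le> continuation_payoff S g trigger i M"
proof -
  let ?h = "\<lambda>H'. stage_payoff S i (hd H') + \<delta> * bond_value H'"
  let ?E = "measure_pmf.expectation"
  let ?G = "\<lambda>s x. ?E (finish_period S g (against s) x) ?h"
  have bind: "?E (bind_pmf M (finish_period S g (against s))) ?h = ?E M (?G s)" for s
    by (rule expectation_bind_pmf, rule step_bound)
  have init: "intact i g H" if "H \<in> set_pmf (bind_pmf M (finish_period S g (against s)))" for s H
    using that M node_intact_finish_period by auto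
  have "continuation_payoff S g (against s) i M \<le> ?E M (?G s)"
    unfolding bind[symmetric]
    by (rule continuation_payoff_signed_le[where e = 1, unfolded mult_1_left abs_one, OF _ refl,
          where Inv = "intact i g" and C = "value_of B"])
      (use bond_value_bound link_step(1) intact_finish_period init in blast)+
  \<comment> \<open>From the next period on \<open>bond_value\<close> bounds the deviation. The
    current period is compared here, because a node of the belief may lie at its link stage or at
    its favor stage.\<close>
  also have "\<dots> \<le> ?E M (?G (trigger i))"
  proof (rule expectation_mono)
    have "\<bar>?G s x\<bar> \<le> stage_bound i + \<delta> * value_of B" for s x
      by (rule expectation_abs_le) (rule step_bound)
    then show "integrable (measure_pmf M) (?G s)" "integrable (measure_pmf M) (?G (trigger i))"
      by (intro integrable_bounded_pmf; blast)+
    fix x assume "x \<in> set_pmf M"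
    then have x: "node_feasible g x" "node_intact i g x" using M by auto
    show "?G s x \<le> ?G (trigger i) x"
    proof (cases x)
      case (Link_node H)
      then have "intact i g H" using x by simp
      then show ?thesis using link_step(1)[of H s] link_step(2)[of H "trigger i"] unfolding Link_node by simp
    next
      case (Favor_node H k f)
      then have "f \<in> set_pmf (nature S (remaining (current_network g H) k))"
        using x by (simp add: feasible_stage_def)
      then show ?thesis using favor_step(1)[of f H k s] favor_step(2)[of f H k "trigger i"]
        unfolding Favor_node by simp
    qed
  qed
  also have "\<dots> = continuation_payoff S g (against (trigger i)) i M"
    unfolding bind[symmetric]
    by (rule continuation_payoff_eq[symmetric, where Inv = "intact i g" and C = "value_of B"])
      (use bond_value_bound link_step(2) intact_finish_period init in blast)+
  also have "against (trigger i) = trigger" by (rule fun_upd_triv)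
  finally show ?thesis .
qed

end

lemma trigger_equilibrium: "bilateral_equilibrium S g trigger"
  unfolding bilateral_equilibrium_def sequential_equilibrium_def sequentially_rational_def
  using bilaterally_measurable_trigger consistent_trigger[OF g] trigger_optimal by blast

lemma trigger_path:
  assumes "H \<in> set_pmf (outcome S g trigger t)"
  shows "current_network g H = g \<and> (\<forall>x\<in>set H. \<forall>r. provider x r \<noteq> None \<longrightarrow> coop x r)"
  using assms
proof (rule set_outcome_induct)
  fix H H' assume H: "current_network g H = g \<and> (\<forall>x\<in>set H. \<forall>r. provider x r \<noteq> None \<longrightarrow> coop x r)"
    and "H' \<in> set_pmf (finish_period S g trigger (Link_node H))"
  then obtain k f a where H': "H' = Period k f a # H" "k \<in> set_pmf (link_decisions g trigger H)"
    "f \<in> set_pmf (nature S (remaining g k))" "a \<in> set_pmf (favor_decisions g trigger H k f)"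
    unfolding set_finish_period by metis
  have t: "trusting H b b'" for b b' using H by (auto simp: trusting_def dealing_def)
  have "k (b, b')" for b b'
  proof (cases "b' \<in> nbrs g b")
    case True
    then have "b \<noteq> b'" by (auto simp: mem_nbrs_iff)
    have "k (b, b') \<in> set_pmf (trigger b (Link_info (private_history g b H)) b')"
      using H'(2) True H unfolding set_link_decisions[OF g] by metis
    then show ?thesis using \<open>b \<noteq> b'\<close> t[of b b'] by (simp add: trigger_def trusts_iff)
  next
    case False
    then show ?thesis using H'(2) H unfolding set_link_decisions[OF g] by metis
  qed
  then have k: "k = keep_all" by auto
  have "a r" if "f r = Some l" for r l
  proof -
    have f: "f \<in> set_pmf (nature S g)" using H'(3) by (simp add: k)
    have "a r \<in> set_pmf (trigger l (info_of g l (Favor_node H k f)) r)"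
      using H'(4) that unfolding set_favor_decisions[OF nature_dom_finite[OF g f]] by blast
    then show ?thesis using nature_request(5)[OF g f that, THEN not_sym] t[of l r] by (simp add: trigger_def trusts_iff)
  qed
  then show "current_network g H' = g \<and> (\<forall>x\<in>set H'. \<forall>r. provider x r \<noteq> None \<longrightarrow> coop x r)"
    using H by (auto simp: H'(1) k)
qed simp

lemma stable_regular: "stable S g"
  unfolding stable_def using g trigger_equilibrium trigger_path by blast

end

section \<open>Degrees and payoffs after a bilateral deviation\<close>

context favor_exchange
begin

text \<open>\<open>threshold\<close> and \<open>link_gain\<close> are the two sides of
  \<open>surplus\<close> in per-period units; a transfer is then simply added to the gain.\<close>

definition threshold :: "real \<Rightarrow> real" where
  "threshold c = (1 - \<delta>) / \<delta> * (c - \<gamma>)"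

definition link_gain :: "real \<Rightarrow> nat \<Rightarrow> nat \<Rightarrow> real" where
  "link_gain c a b = \<alpha> * (v * q ^ (a - 1) * p - c * share b)"

lemma surplus_iff_link_gain: "0 \<le> surplus c a b \<longleftrightarrow> threshold c \<le> link_gain c a b"
  by (simp add: surplus_nonneg_iff threshold_def link_gain_def)

lemma threshold_pos: "\<gamma> < c \<Longrightarrow> 0 < threshold c"
  using params by (simp add: threshold_def)

lemma threshold_iff: "c - \<gamma> \<le> \<delta> / (1 - \<delta>) * x \<longleftrightarrow> threshold c \<le> x"
  using params by (simp add: threshold_def field_simps)

text \<open>Each link between degree \<open>m\<close> and degree \<open>B\<close> is worth its cost
  against a partner of degree \<open>B\<close>; summation telescopes the benefits. A player in a
  regular network therefore never profits from merely shedding links.\<close>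

lemma share_le_of_degree_gap:
  assumes "0 \<le> surplus c B B" "\<gamma> < c" "0 \<le> v" "m \<le> B"
  shows "c * (real (B - m) * share B) \<le> v * (q ^ m - q ^ B)"
  using assms(4)
proof (induction m rule: inc_induct)
  case (step n)
  have "0 \<le> surplus c (Suc n) B"
    using assms(1) surplus_antimono_left[of "Suc n" B c B] assms(3) step by linarith
  then have "0 \<le> link_gain c (Suc n) B"
    using threshold_pos[OF assms(2)] by (simp add: surplus_iff_link_gain)
  then have "c * share B \<le> v * (q ^ n * p)"
    using params by (simp add: link_gain_def zero_le_mult_iff mult.assoc)
  also have "q ^ n * p = q ^ n - q ^ Suc n" by (rule power_Suc_diff[symmetric])
  finally have "c * share B \<le> v * (q ^ n - q ^ Suc n)" .
  moreover have "real (B - n) = real (B - Suc n) + 1" using step by (simp add: Suc_diff_Suc)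
  ultimately show ?case using step.IH by (simp add: algebra_simps)
qed simp

end

context favor_society
begin

section \<open>Degrees at the links of stable networks\<close>

lemma deg_pos: "network g \<Longrightarrow> {i, j} \<in> g \<Longrightarrow> 0 < deg g i"
  using nbrs_finite[of g i] network_on_linkD[of "players S" g i j] by (auto simp: deg_def card_gt_0_iff mem_nbrs_iff)

lemma payoff_eq:
  "payoff S g i = \<alpha> * v * (1 - q ^ deg g i) - cost S i * (\<alpha> * (\<Sum>j\<in>nbrs g i. share (deg g j)))"
  by (simp add: payoff_def favor_prob_eq sum_distrib_left)

lemma payoff_delete_link:
  assumes g: "network g" and link: "{i, j} \<in> g"
  shows "payoff S g i - payoff S (g - {{i, j}}) i = link_gain (cost S i) (deg g i) (deg g j)"
proof -
  let ?h = "g - {{i, j}}"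
  have ij: "i \<noteq> j" using network_on_linkD[OF g link] by simp
  have fin: "finite (nbrs g i)" and j: "j \<in> nbrs g i" using nbrs_finite[OF g] link ij by (auto simp: mem_nbrs_iff)
  have "nbrs ?h i = nbrs g i - {j}" using ij by (auto simp: mem_nbrs_iff doubleton_eq_iff)
  moreover have "deg ?h l = deg g l" if "l \<in> nbrs g i - {j}" for l
  proof -
    have "nbrs ?h l = nbrs g l" using that by (auto simp: mem_nbrs_iff doubleton_eq_iff)
    then show ?thesis by (simp add: deg_def)
  qed
  ultimately have "(\<Sum>l\<in>nbrs ?h i. share (deg ?h l)) = (\<Sum>l\<in>nbrs g i. share (deg g l)) - share (deg g j)"
    and "deg ?h i = deg g i - 1"
    using fin j by (simp_all add: sum_diff1 deg_def)
  moreover have "q ^ (deg g i - 1) - q ^ deg g i = q ^ (deg g i - 1) * p"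
    using deg_pos[OF g link] power_Suc_diff[of "deg g i - 1"] by simp
  then have "v * q ^ (deg g i - 1) * p = v * q ^ (deg g i - 1) - v * q ^ deg g i"
    by (metis mult.assoc right_diff_distrib)
  moreover have "payoff S g i - payoff S ?h i = \<alpha> * (v * q ^ deg ?h i - v * q ^ deg g i)
      - cost S i * (\<alpha> * ((\<Sum>l\<in>nbrs g i. share (deg g l)) - (\<Sum>l\<in>nbrs ?h i. share (deg ?h l))))"
    unfolding payoff_eq by (simp add: algebra_simps)
  ultimately show ?thesis unfolding link_gain_def by (simp add: right_diff_distrib mult.left_commute)
qed

lemma payoff_delete_link':
  "network g \<Longrightarrow> {i, j} \<in> g \<Longrightarrow>
    payoff S g j - payoff S (g - {{i, j}}) j = link_gain (cost S j) (deg g j) (deg g i)"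
  using payoff_delete_link[of g j i] by (simp add: insert_commute)

lemma sustainable_iff:
  assumes "network g" "{i, j} \<in> g"
  shows "sustainable S g i j \<longleftrightarrow>
    0 \<le> surplus (cost S i) (deg g i) (deg g j) \<and> 0 \<le> surplus (cost S j) (deg g j) (deg g i)"
proof -
  have "sustainable S g i j \<longleftrightarrow>
      cost S i - \<gamma> \<le> \<delta> / (1 - \<delta>) * (payoff S g i - payoff S (g - {{i, j}}) i) \<and>
      cost S j - \<gamma> \<le> \<delta> / (1 - \<delta>) * (payoff S g j - payoff S (g - {{i, j}}) j)"
    using assms(2) by (auto simp: sustainable_def)
  then show ?thesis
    unfolding payoff_delete_link[OF assms] payoff_delete_link'[OF assms] threshold_iff surplus_iff_link_gain .
qed

lemma stable_link_degree:
  assumes "stable S g" "{i, j} \<in> g"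
  shows "deg g i \<le> bound (cost S i) \<or> deg g i < deg g j \<and> deg g j \<le> bound (cost S j)"
proof -
  have g: "network g" using assms(1) by (simp add: stable_def)
  have ji: "{j, i} \<in> g" using assms(2) by (simp add: insert_commute)
  note s = stable_imp_sustainable[OF assms, unfolded sustainable_iff[OF g assms(2)]]
  have le: "deg g x \<le> bound (cost S x)"
    if "0 \<le> surplus (cost S x) (deg g x) (deg g y)" "{x, y} \<in> g" "deg g y \<le> deg g x" for x y
  proof -
    have x: "x \<in> players S" "0 < deg g x" "0 < deg g y"
      using network_on_linkD[OF g that(2)] deg_pos[OF g that(2)] deg_pos[OF g, of y x] that(2) by (auto simp: insert_commute)
    then have c: "\<gamma> < cost S x" "0 \<le> cost S x" using cost_bounds[of x] params by auto
    have "0 \<le> surplus (cost S x) (deg g x) (deg g x)"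
      using surplus_mono_right[OF c(2) x(3) that(3)] that(1) order_trans by blast
    then show ?thesis using surplus_diag_nonneg_iff[OF c(1) x(2)] by simp
  qed
  show ?thesis
  proof (cases "deg g j \<le> deg g i")
    case True then show ?thesis using le[of i j] s assms(2) by blast
  next
    case False then show ?thesis using le[of j i] s ji by auto
  qed
qed

lemma stable_degree_le:
  assumes "stable S g" "i \<in> players S" "\<gamma> < c" "\<And>j. j \<in> players S \<Longrightarrow> c \<le> cost S j"
  shows "deg g i \<le> bound c"
proof (cases "deg g i = 0")
  case False
  have g: "network g" using assms(1) by (simp add: stable_def)
  from False have "nbrs g i \<noteq> {}" by (auto simp: deg_def)
  then obtain j where "j \<in> nbrs g i" by blast
  then have ij: "{i, j} \<in> g" by (simp add: mem_nbrs_iff)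
  moreover have "bound (cost S x) \<le> bound c" if "x \<in> players S" for x
    using bound_antimono[OF assms(3) assms(4)[OF that]] .
  ultimately show ?thesis
    using stable_link_degree[OF assms(1) ij] network_on_linkD[OF g ij] by fastforce
qed simp

subsection \<open>Rewiring a pair of players\<close>

definition rewire :: "'a network \<Rightarrow> 'a \<Rightarrow> 'a set \<Rightarrow> 'a \<Rightarrow> 'a set \<Rightarrow> 'a network" where
  "rewire g i K j L = g - ((\<lambda>k. {i, k}) ` K \<union> (\<lambda>k. {j, k}) ` L) \<union> {{i, j}}"

lemma rewire_commute: "rewire g i K j L = rewire g j L i K"
  by (simp add: rewire_def insert_commute Un_commute)

context
  fixes g i j
  assumes g: "network g" and ij: "i \<in> players S" "j \<in> players S" "i \<noteq> j" and unlinked: "{i, j} \<notin> g"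
begin

lemma rewire_deviation:
  "network (rewire g i K j L)" "obtainable g i j (rewire g i K j L)" "{i, j} \<in> rewire g i K j L"
  using g ij unfolding network_on_def obtainable_def rewire_def by blast+

text \<open>By the disjointness no remaining neighbor of \<open>i\<close> loses a link to
  \<open>j\<close>. The degrees of these neighbors, and hence their request rates, are
  unchanged.\<close>

lemma rewire_payoff:
  assumes K: "K \<subseteq> nbrs g i" and L: "L \<subseteq> nbrs g j"
    and disj: "L \<inter> (nbrs g i - K) = {}"
  defines "h \<equiv> rewire g i K j L"
  shows "deg h i = Suc (deg g i - card K)"
    and "payoff S h i = \<alpha> * v * (1 - q ^ deg h i)
      - cost S i * (\<alpha> * ((\<Sum>l\<in>nbrs g i. share (deg g l)) - (\<Sum>l\<in>K. share (deg g l)) + share (deg h j)))"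
proof -
  have fin: "finite (nbrs g i)" using nbrs_finite[OF g] .
  have jn: "j \<notin> nbrs g i" using unlinked by (simp add: mem_nbrs_iff)
  have nh: "nbrs h i = insert j (nbrs g i - K)"
    using ij K by (auto simp: h_def rewire_def mem_nbrs_iff doubleton_eq_iff)
  then show "deg h i = Suc (deg g i - card K)"
    using fin jn K finite_subset[OF K fin] by (simp add: deg_def card_Diff_subset)
  have "deg h l = deg g l" if "l \<in> nbrs g i - K" for l
  proof -
    have "l \<noteq> i" "l \<noteq> j" "l \<notin> K" "l \<notin> L" using that disj jn by (auto simp: mem_nbrs_iff)
    then have "nbrs h l = nbrs g l" by (auto simp: h_def rewire_def mem_nbrs_iff doubleton_eq_iff)
    then show ?thesis by (simp add: deg_def)
  qed
  then have "(\<Sum>l\<in>nbrs h i. share (deg h l)) = share (deg h j) + (\<Sum>l\<in>nbrs g i - K. share (deg g l))"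
    using fin jn by (simp add: nh)
  also have "(\<Sum>l\<in>nbrs g i - K. share (deg g l)) = (\<Sum>l\<in>nbrs g i. share (deg g l)) - (\<Sum>l\<in>K. share (deg g l))"
    by (rule sum_diff[OF fin K])
  finally have "(\<Sum>l\<in>nbrs h i. share (deg h l))
      = (\<Sum>l\<in>nbrs g i. share (deg g l)) - (\<Sum>l\<in>K. share (deg g l)) + share (deg h j)" by simp
  then show "payoff S h i = \<alpha> * v * (1 - q ^ deg h i)
      - cost S i * (\<alpha> * ((\<Sum>l\<in>nbrs g i. share (deg g l)) - (\<Sum>l\<in>K. share (deg g l)) + share (deg h j)))"
    by (simp only: payoff_eq)
qed

lemma rewire_gain_add:
  assumes L: "L \<subseteq> nbrs g j" "L \<inter> nbrs g i = {}"
  defines "h \<equiv> rewire g i {} j L"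
  shows "deg h i = Suc (deg g i)"
    and "payoff S h i - payoff S g i = link_gain (cost S i) (deg h i) (deg h j)"
proof -
  have disj: "L \<inter> (nbrs g i - {}) = {}" using L by simp
  show d: "deg h i = Suc (deg g i)"
    using rewire_payoff(1)[OF empty_subsetI L(1) disj] by (simp add: h_def)
  have "payoff S h i = \<alpha> * v * (1 - q ^ deg h i)
      - cost S i * (\<alpha> * ((\<Sum>l\<in>nbrs g i. share (deg g l)) + share (deg h j)))"
    using rewire_payoff(2)[OF empty_subsetI L(1) disj] by (simp add: h_def)
  moreover have "v * q ^ deg g i * p = v * q ^ deg g i - v * q ^ Suc (deg g i)"
    using power_Suc_diff[of "deg g i"] by (metis mult.assoc right_diff_distrib)
  ultimately show "payoff S h i - payoff S g i = link_gain (cost S i) (deg h i) (deg h j)"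
    by (simp add: payoff_eq link_gain_def d algebra_simps)
qed

text \<open>With the own degree unchanged the benefit is unchanged, and only the request rates of
  the old and the new partner differ.\<close>

lemma rewire_gain_swap:
  assumes k: "k \<in> nbrs g i" and L: "L \<subseteq> nbrs g j" "L \<inter> (nbrs g i - {k}) = {}"
  defines "h \<equiv> rewire g i {k} j L"
  shows "deg h i = deg g i"
    and "payoff S h i - payoff S g i = cost S i * \<alpha> * (share (deg g k) - share (deg h j))"
proof -
  have K: "{k} \<subseteq> nbrs g i" using k by simp
  have "0 < deg g i" using k nbrs_finite[OF g] by (auto simp: deg_def card_gt_0_iff)
  then show d: "deg h i = deg g i"
    using rewire_payoff(1)[OF K L] by (simp add: h_def)
  show "payoff S h i - payoff S g i = cost S i * \<alpha> * (share (deg g k) - share (deg h j))"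
    using rewire_payoff(2)[OF K L] by (simp add: h_def[symmetric] payoff_eq d algebra_simps)
qed

end

section \<open>Joint deviations with transfers\<close>

lemma transfer_exists:
  assumes w: "0 < w\<^sub>i" "0 < (w\<^sub>j :: real)"
  shows "\<exists>t\<^sub>i t\<^sub>j. 0 \<le> t\<^sub>i \<and> 0 \<le> t\<^sub>j \<and> w\<^sub>j * t\<^sub>j - w\<^sub>i * t\<^sub>i = T"
proof (cases "0 \<le> T")
  case True
  then show ?thesis using w by (intro exI[of _ 0] exI[of _ "T / w\<^sub>j"]) simp
next
  case False
  then show ?thesis using w by (intro exI[of _ "- T / w\<^sub>i"] exI[of _ 0]) (simp add: divide_nonpos_pos)
qed

text \<open>
  A transfer between two players who can both pay splits the joint gain as needed: the hypotheses
  say that every lower bound on the transfer is below every upper bound.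
\<close>

lemma no_transfer_deviation:
  assumes st: "strongly_stable_with_transfers S N' g"
    and i: "i \<in> players S" "i \<in> N'" and j: "j \<in> players S" "j \<in> N'"
    and h: "network h" "obtainable g i j h" "{i, j} \<in> h" "{i, j} \<notin> g"
  defines "A\<^sub>i \<equiv> link_gain (cost S i) (deg h i) (deg h j)" and "A\<^sub>j \<equiv> link_gain (cost S j) (deg h j) (deg h i)"
    and "\<Delta>\<^sub>i \<equiv> payoff S h i - payoff S g i" and "\<Delta>\<^sub>j \<equiv> payoff S h j - payoff S g j"
    and "s\<^sub>i \<equiv> threshold (cost S i)" and "s\<^sub>j \<equiv> threshold (cost S j)"
  assumes ineqs: "s\<^sub>i + s\<^sub>j \<le> A\<^sub>i + A\<^sub>j" "s\<^sub>i \<le> A\<^sub>i + \<Delta>\<^sub>j" "s\<^sub>j \<le> A\<^sub>j + \<Delta>\<^sub>i" "0 < \<Delta>\<^sub>i + \<Delta>\<^sub>j"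
  shows False
proof -
  \<comment> \<open>The smallest net receipt per period that meets both requirements of
    \<open>i\<close>, sustainability and improvement; the inequalities then leave enough for both
    requirements of \<open>j\<close>.\<close>
  define T where "T = max (s\<^sub>i - A\<^sub>i) (- \<Delta>\<^sub>i)"
  have T: "s\<^sub>i \<le> A\<^sub>i + T" "s\<^sub>j \<le> A\<^sub>j - T" "0 \<le> \<Delta>\<^sub>i + T" "0 \<le> \<Delta>\<^sub>j - T"
    using ineqs unfolding T_def by (auto simp: max_def)
  have ji: "{j, i} \<in> h" using h(3) by (simp add: insert_commute)
  have w: "0 < favor_prob S h i" "0 < favor_prob S h j"
    using share_pos[OF deg_pos[OF h(1) h(3)]] share_pos[OF deg_pos[OF h(1) ji]] params by (auto simp: favor_prob_eq)
  then obtain t\<^sub>i t\<^sub>j where t: "0 \<le> t\<^sub>i" "0 \<le> t\<^sub>j" "favor_prob S h j * t\<^sub>j - favor_prob S h i * t\<^sub>i = T"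
    using transfer_exists by blast
  have pi: "payoff_with_transfers S h i j t\<^sub>i t\<^sub>j = payoff S h i + T"
    and pj: "payoff_with_transfers S h j i t\<^sub>j t\<^sub>i = payoff S h j - T"
    using t(3) by (simp_all add: payoff_with_transfers_def)
  have "sustainable_with_transfers S h i j t\<^sub>i t\<^sub>j"
    unfolding sustainable_with_transfers_def pi pj threshold_iff
    using h(3) T(1,2) payoff_delete_link[OF h(1,3)] payoff_delete_link'[OF h(1,3)]
    by (simp add: A\<^sub>i_def A\<^sub>j_def s\<^sub>i_def s\<^sub>j_def)
  moreover have "admissible_transfers N' i j t\<^sub>i t\<^sub>j" using t i j by (simp add: admissible_transfers_def)
  moreover have "payoff S g i \<le> payoff S h i + T" "payoff S g j \<le> payoff S h j - T"
    "payoff S g i < payoff S h i + T \<or> payoff S g j < payoff S h j - T"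
    using T ineqs(4) unfolding \<Delta>\<^sub>i_def \<Delta>\<^sub>j_def by linarith+
  ultimately show False
    using st i(1) j(1) h unfolding strongly_stable_with_transfers_def pi[symmetric] pj[symmetric] by blast
qed

lemma diff_nonempty_of_card_less:
  assumes "finite X" "card (X \<inter> Y) < card X"
  shows "\<exists>x\<in>X. x \<notin> Y"
  using assms by (metis IntI inf.absorb1 less_irrefl subsetI)

lemma unlinked_payers_full:
  assumes st: "strongly_stable_with_transfers S N' g"
    and i: "i \<in> players S" "i \<in> N'" and j: "j \<in> players S" "j \<in> N'" and ij: "i \<noteq> j" "{i, j} \<notin> g"
    and c: "cost S i = c" "cost S j = c" and b: "\<And>k. k \<in> players S \<Longrightarrow> deg g k \<le> bound c"
  shows "deg g i = bound c \<and> (\<forall>k\<in>nbrs g i. deg g k = bound c)"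
proof -
  have g: "network g" using st by (simp add: strongly_stable_with_transfers_def stable_def)
  let ?b = "bound c"
  have c0: "\<gamma> < c" "0 < c" using cost_bounds[OF i(1)] c params by auto
  have s0: "0 < threshold c" using threshold_pos[OF c0(1)] .
  have diag: "threshold c \<le> link_gain c m m" if "0 < m" "m \<le> ?b" for m
    using that surplus_diag_nonneg_iff[OF c0(1) that(1)] surplus_iff_link_gain by simp
  \<comment> \<open>Benefit depends on the own degree and cost on that of the partner. With equal
    costs the crossed gains therefore have the same sum as the two diagonal gains, each of which
    reaches the threshold.\<close>
  have cross: "threshold c + threshold c \<le> link_gain c m n + link_gain c n m" if "0 < m" "m \<le> ?b" "0 < n" "n \<le> ?b" for m n
    using diag[OF that(1,2)] diag[OF that(3,4)] by (simp add: link_gain_def algebra_simps)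
  have fin: "finite (nbrs g k)" for k using nbrs_finite[OF g] .
  have nb: "k \<in> players S" "0 < deg g k" if "k \<in> nbrs g l" for k l
  proof -
    show "k \<in> players S" using that nbrs_subset[OF g, of l] by blast
    show "0 < deg g k" using that deg_pos[OF g, of k l] by (simp add: mem_nbrs_iff insert_commute)
  qed
  have rev: "{j, i} \<notin> g" "j \<noteq> i" using ij by (auto simp: insert_commute)
  note pair = g i(1) j(1) ij and pair' = g j(1) i(1) rev(2) rev(1)
  \<comment> \<open>The player at the bound exchanges a neighbor for the one below it, who just adds
    a link. The neighbor \<open>k\<close> given up is not linked to \<open>y\<close>, so that no
    other partner of \<open>y\<close> changes degree.\<close>
  have part_full: False if full: "deg g x = ?b" and part: "deg g y < ?b"
    and x: "x \<in> players S" "x \<in> N'" "cost S x = c" and y: "y \<in> players S" "y \<in> N'" "cost S y = c"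
    and xy: "x \<noteq> y" "{x, y} \<notin> g" for x y
  proof -
    have "card (nbrs g x \<inter> nbrs g y) \<le> deg g y" using fin by (auto simp: deg_def intro: card_mono)
    then obtain k where k: "k \<in> nbrs g x" "k \<notin> nbrs g y"
      using diff_nonempty_of_card_less[of "nbrs g x" "nbrs g y"] fin full part by (auto simp: deg_def)
    let ?h = "rewire g x {k} y {}"
    have yx: "{y, x} \<notin> g" "y \<noteq> x" using xy by (auto simp: insert_commute)
    note gx = rewire_gain_swap[OF g x(1) y(1) xy k(1) empty_subsetI]
    note gy = rewire_gain_add[OF g y(1) x(1) yx(2,1), of "{k}", unfolded rewire_commute[of g y]]
    have dx: "deg ?h x = ?b" and dy: "deg ?h y = Suc (deg g y)" and
      Dx: "payoff S ?h x - payoff S g x = c * \<alpha> * (share (deg g k) - share (Suc (deg g y)))" and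
      Dy: "payoff S ?h y - payoff S g y = link_gain c (Suc (deg g y)) ?b"
      using gx gy k full x y by auto
    have sk: "share ?b \<le> share (deg g k)" using nb[OF k(1)] b by (intro share_antimono) auto
    let ?m = "Suc (deg g y)"
    have m: "0 < ?m" "?m \<le> ?b" "0 < ?b" using part by auto
    have "c * \<alpha> * share ?b \<le> c * \<alpha> * share (deg g k)" using sk c0 params by (intro mult_left_mono) auto
    \<comment> \<open>The new partner of \<open>x\<close> may ask more often than \<open>k\<close>
      did, but \<open>y\<close> obtains a partner of degree \<open>?b\<close>, who asks less often
      than one of degree \<open>?m\<close>. The second effect makes up for the first, and the total
      is at least a diagonal gain.\<close>
    then have tot: "link_gain c ?m ?m \<le> (payoff S ?h x - payoff S g x) + link_gain c ?m ?b"
      unfolding Dx by (simp add: link_gain_def algebra_simps)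
    show False
    proof (rule no_transfer_deviation[OF st x(1,2) y(1,2), of ?h])
      show "network ?h" "obtainable g x y ?h" "{x, y} \<in> ?h" by (rule rewire_deviation[OF g x(1) y(1) xy])+
    qed (use xy cross[of ?b ?m] m diag[of ?m] tot s0 in \<open>auto simp: dx dy Dy x(3) y(3)\<close>)
  qed
  have full: "deg g i = ?b"
  proof (rule ccontr)
    assume "deg g i \<noteq> ?b"
    then have "deg g i < ?b" using b[OF i(1)] by simp
    moreover from this have "deg g j \<noteq> ?b" using part_full[of j i] i j c rev by blast
    ultimately have less: "deg g i < ?b" "deg g j < ?b" using b[OF j(1)] by auto
    let ?h = "rewire g i {} j {}" and ?m = "Suc (deg g i)" and ?n = "Suc (deg g j)"
    note gi = rewire_gain_add[OF pair empty_subsetI]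
    note gj = rewire_gain_add[OF pair' empty_subsetI, unfolded rewire_commute[of g j]]
    have d: "deg ?h i = ?m" "deg ?h j = ?n" "payoff S ?h i - payoff S g i = link_gain c ?m ?n"
      "payoff S ?h j - payoff S g j = link_gain c ?n ?m"
      using gi gj c by auto
    show False
    proof (rule no_transfer_deviation[OF st i j, of ?h])
      show "network ?h" "obtainable g i j ?h" "{i, j} \<in> ?h" by (rule rewire_deviation[OF pair])+
    qed (use ij cross[of ?m ?n] less s0 in \<open>auto simp: d c\<close>)
  qed
  moreover have "deg g j = ?b"
    using part_full[of i j] i j c ij b[OF j(1)] full by fastforce
  ultimately have eq: "deg g i = deg g j" by simp
  have "deg g k = ?b" if k: "k \<in> nbrs g i" for k
  proof (rule ccontr)
    assume "deg g k \<noteq> ?b"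
    then have kb: "deg g k < ?b" "0 < deg g k" using b nb[OF k] by fastforce+
    \<comment> \<open>Either both players drop the common neighbor \<open>k\<close>, or each drops
      one whom the other does not have. In both cases the neighbors that remain keep their degrees.
      Equal degrees of \<open>i\<close> and \<open>j\<close> supply a suitable
      \<open>l\<close>.\<close>
    have "\<exists>l\<in>nbrs g j. (l = k \<or> l \<notin> nbrs g i) \<and> (k = l \<or> k \<notin> nbrs g j)"
    proof (cases "k \<in> nbrs g j")
      case False
      have "nbrs g j \<inter> nbrs g i \<subseteq> nbrs g i - {k}" using False by auto
      then have "card (nbrs g j \<inter> nbrs g i) \<le> card (nbrs g i - {k})" using fin by (intro card_mono) auto
      then have "card (nbrs g j \<inter> nbrs g i) < card (nbrs g j)"
        using k fin eq kb(1) full by (simp add: deg_def)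
      then show ?thesis using diff_nonempty_of_card_less[of "nbrs g j" "nbrs g i"] fin False by auto
    qed auto
    then obtain l where l: "l \<in> nbrs g j" "l = k \<or> l \<notin> nbrs g i" "k = l \<or> k \<notin> nbrs g j" by blast
    let ?h = "rewire g i {k} j {l}"
    note gi = rewire_gain_swap[OF pair k, of "{l}"]
    note gj = rewire_gain_swap[OF pair' l(1), of "{k}", unfolded rewire_commute[of g j]]
    have d: "deg ?h i = ?b" "deg ?h j = ?b"
      "payoff S ?h i - payoff S g i = c * \<alpha> * (share (deg g k) - share ?b)"
      "payoff S ?h j - payoff S g j = c * \<alpha> * (share (deg g l) - share ?b)"
      using gi gj c eq k l full by auto
    have "share ?b < share (deg g k)" "share ?b \<le> share (deg g l)"
      using kb share_strict_antimono nb[OF l(1)] b by (auto intro: share_antimono)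
    then have D: "0 < c * \<alpha> * (share (deg g k) - share ?b)" "0 \<le> c * \<alpha> * (share (deg g l) - share ?b)"
      using c0 params by auto
    show False
    proof (rule no_transfer_deviation[OF st i j, of ?h])
      show "network ?h" "obtainable g i j ?h" "{i, j} \<in> ?h" by (rule rewire_deviation[OF pair])+
    qed (use ij diag[of ?b] kb D in \<open>auto simp: d c\<close>)
  qed
  then show ?thesis using full by blast
qed

section \<open>Joint deviations without transfers\<close>

lemma no_deviation:
  assumes st: "strongly_stable S g" and i: "i \<in> players S" and j: "j \<in> players S"
    and h: "network h" "obtainable g i j h" "{i, j} \<in> h" "{i, j} \<notin> g"
    and s: "0 \<le> surplus (cost S i) (deg h i) (deg h j)" "0 \<le> surplus (cost S j) (deg h j) (deg h i)"
    and D: "0 < payoff S h i - payoff S g i" "0 < payoff S h j - payoff S g j"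
  shows False
proof -
  have "sustainable S h i j" unfolding sustainable_iff[OF h(1,3)] using s by blast
  moreover have "payoff S g i \<le> payoff S h i" "payoff S g j \<le> payoff S h j" "payoff S g i < payoff S h i"
    using D by auto
  ultimately show False using st i j h unfolding strongly_stable_def by blast
qed

text \<open>With equal degrees and costs both gains from the new link are diagonal, so each player
  gains by herself and nothing has to be transferred.\<close>

lemma equal_degree_linked:
  assumes st: "strongly_stable S g" and i: "i \<in> players S" and j: "j \<in> players S" and ij: "i \<noteq> j"
    and c: "cost S i = c" "cost S j = c" and d: "deg g i = d" "deg g j = d" "d < bound c"
  shows "{i, j} \<in> g"
proof (rule ccontr)
  assume un: "{i, j} \<notin> g"
  have g: "network g" using st by (simp add: strongly_stable_def stable_def)
  have un': "{j, i} \<notin> g" "j \<noteq> i" using un ij by (auto simp: insert_commute)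
  have c0: "\<gamma> < c" using cost_bounds[OF i] c by auto
  let ?h = "rewire g i {} j {}"
  note gi = rewire_gain_add[OF g i j ij un empty_subsetI]
  note gj = rewire_gain_add[OF g j i un'(2,1) empty_subsetI, unfolded rewire_commute[of g j]]
  have e: "deg ?h i = Suc d" "deg ?h j = Suc d"
    "payoff S ?h i - payoff S g i = link_gain c (Suc d) (Suc d)"
    "payoff S ?h j - payoff S g j = link_gain c (Suc d) (Suc d)"
    using gi gj c d by auto
  have s: "0 \<le> surplus c (Suc d) (Suc d)" using surplus_diag_nonneg_iff[OF c0, of "Suc d"] d(3) by simp
  have pos: "0 < link_gain c (Suc d) (Suc d)" using s threshold_pos[OF c0] by (simp add: surplus_iff_link_gain)
  show False
    by (rule no_deviation[OF st i j rewire_deviation[OF g i j ij un, of "{}" "{}"] un])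
      (use s pos in \<open>simp_all add: e c\<close>)
qed

text \<open>Both would exchange a neighbor below the bound for a partner at the bound, who asks less
  often. Their own degrees stay put, so the new link is sustainable on the diagonal.\<close>

lemma full_with_low_neighbor_linked:
  assumes st: "strongly_stable S g" and i: "i \<in> players S" and j: "j \<in> players S" and ij: "i \<noteq> j"
    and c: "cost S i = c" "cost S j = c" and d: "deg g i = bound c" "deg g j = bound c"
    and k: "k \<in> nbrs g i" "deg g k < bound c" and l: "l \<in> nbrs g j" "deg g l < bound c"
  shows "{i, j} \<in> g"
proof (rule ccontr)
  assume un: "{i, j} \<notin> g"
  have g: "network g" using st by (simp add: strongly_stable_def stable_def)
  have un': "{j, i} \<notin> g" "j \<noteq> i" using un ij by (auto simp: insert_commute)
  have c0: "\<gamma> < c" "0 < c" using cost_bounds[OF i] c params by auto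
  let ?b = "bound c"
  \<comment> \<open>A low neighbor shared by \<open>i\<close> and \<open>j\<close> is dropped by
    both; if neither \<open>k\<close> nor \<open>l\<close> is shared, each drops her own. Either way
    the neighbors that remain are unaffected.\<close>
  obtain k' l' where kl: "k' \<in> nbrs g i" "deg g k' < ?b" "l' \<in> nbrs g j" "deg g l' < ?b"
    "l' = k' \<or> l' \<notin> nbrs g i" "k' = l' \<or> k' \<notin> nbrs g j"
    using k l by blast
  let ?h = "rewire g i {k'} j {l'}"
  note gi = rewire_gain_swap[OF g i j ij un kl(1), of "{l'}"]
  note gj = rewire_gain_swap[OF g j i un'(2,1) kl(3), of "{k'}", unfolded rewire_commute[of g j]]
  have e: "deg ?h i = ?b" "deg ?h j = ?b"
    "payoff S ?h i - payoff S g i = c * \<alpha> * (share (deg g k') - share ?b)"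
    "payoff S ?h j - payoff S g j = c * \<alpha> * (share (deg g l') - share ?b)"
    using gi gj c d kl by auto
  have "0 < deg g k'" "0 < deg g l'"
    using deg_pos[OF g, of k' i] deg_pos[OF g, of l' j] kl by (auto simp: mem_nbrs_iff insert_commute)
  then have pos: "0 < c * \<alpha> * (share (deg g k') - share ?b)" "0 < c * \<alpha> * (share (deg g l') - share ?b)"
    using kl share_strict_antimono c0 params by auto
  have s: "0 \<le> surplus c ?b ?b" using surplus_diag_nonneg_iff[OF c0(1), of ?b] kl(2) by simp
  show False
    by (rule no_deviation[OF st i j rewire_deviation[OF g i j ij un, of "{k'}" "{l'}"] un])
      (use s pos in \<open>simp_all add: e c\<close>)
qed

end

section \<open>Strong stability of regular networks\<close>

context favor_society
begin

context
  fixes g i j g' and B :: nat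
  assumes g: "network g" and regular: "\<And>k. k \<in> players S \<Longrightarrow> deg g k = B"
    and g': "network g'" "obtainable g i j g'" "{i, j} \<in> g'"
begin

lemma obtained_players: "i \<in> players S" "j \<in> players S" "i \<noteq> j"
  using network_on_linkD[OF g'(1,3)] by auto

lemma obtained_nbrs:
  "nbrs g' i - {j} \<subseteq> nbrs g i" "nbrs g' j - {i} \<subseteq> nbrs g j"
  "l \<noteq> i \<Longrightarrow> l \<noteq> j \<Longrightarrow> nbrs g' l \<subseteq> nbrs g l"
proof -
  have *: "b \<in> nbrs g a" if b: "b \<in> nbrs g' a" and ne: "{a, b} \<noteq> {i, j}" for a b
  proof -
    have "{a, b} \<in> g'" "b \<noteq> a" using b by (simp_all add: mem_nbrs_iff)
    moreover from this(1) have "{a, b} \<in> g" using g'(2) ne unfolding obtainable_def by (metis DiffI)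
    ultimately show ?thesis by (simp add: mem_nbrs_iff)
  qed
  show "nbrs g' i - {j} \<subseteq> nbrs g i" by (intro subsetI *) (auto simp: doubleton_eq_iff)
  show "nbrs g' j - {i} \<subseteq> nbrs g j" by (intro subsetI *) (auto simp: doubleton_eq_iff)
  show "nbrs g' l \<subseteq> nbrs g l" if "l \<noteq> i" "l \<noteq> j"
    using that by (intro subsetI *) (auto simp: doubleton_eq_iff)
qed

lemma obtained_degree: "deg g' i \<le> Suc B"
proof -
  have "card (nbrs g' i) \<le> card (insert j (nbrs g i))"
    using obtained_nbrs(1) nbrs_finite[OF g] by (intro card_mono) auto
  also have "\<dots> \<le> Suc (deg g i)" using nbrs_finite[OF g, of i] by (simp add: deg_def card_insert_if)
  finally show ?thesis using regular[OF obtained_players(1)] by (simp add: deg_def)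
qed

text \<open>Third players can only lose links in the deviation, so the old neighbors that
  \<open>i\<close> retains ask at least as often as at degree \<open>B\<close>.\<close>

lemma obtained_payoff_le:
  "payoff S g' i \<le> \<alpha> * (v * (1 - q ^ deg g' i) - cost S i * (real (deg g' i - 1) * share B + share (deg g' j)))"
proof -
  have fin: "finite (nbrs g' i)" using nbrs_finite[OF g'(1)] .
  have j: "j \<in> nbrs g' i" using g'(3) obtained_players by (simp add: mem_nbrs_iff)
  have "share B \<le> share (deg g' l)" if l: "l \<in> nbrs g' i - {j}" for l
  proof -
    have l': "l \<in> players S" "l \<noteq> i" "l \<noteq> j" using l nbrs_subset[OF g'(1), of i] by (auto simp: mem_nbrs_iff)
    have "deg g' l \<le> deg g l"
      using obtained_nbrs(3)[OF l'(2,3)] nbrs_finite[OF g] by (auto simp: deg_def intro: card_mono)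
    moreover have "0 < deg g' l" using deg_pos[OF g'(1), of l i] l by (simp add: mem_nbrs_iff insert_commute)
    ultimately show ?thesis using regular[OF l'(1)] by (intro share_antimono) auto
  qed
  then have "(\<Sum>l\<in>nbrs g' i - {j}. share B) \<le> (\<Sum>l\<in>nbrs g' i - {j}. share (deg g' l))" by (rule sum_mono)
  then have "real (deg g' i - 1) * share B + share (deg g' j) \<le> (\<Sum>l\<in>nbrs g' i. share (deg g' l))"
    using fin j by (simp add: deg_def sum.remove)
  then have "cost S i * (real (deg g' i - 1) * share B + share (deg g' j)) \<le> cost S i * (\<Sum>l\<in>nbrs g' i. share (deg g' l))"
    using cost_bounds[OF obtained_players(1)] params by (intro mult_left_mono) auto
  then have "\<alpha> * (v * (1 - q ^ deg g' i) - cost S i * (\<Sum>l\<in>nbrs g' i. share (deg g' l)))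
      \<le> \<alpha> * (v * (1 - q ^ deg g' i) - cost S i * (real (deg g' i - 1) * share B + share (deg g' j)))"
    using params by (intro mult_left_mono) auto
  then show ?thesis by (simp add: payoff_eq algebra_simps)
qed

lemma regular_payoff: "payoff S g i = \<alpha> * (v * (1 - q ^ B) - cost S i * (real B * share B))"
proof -
  have "(\<Sum>l\<in>nbrs g i. share (deg g l)) = (\<Sum>l\<in>nbrs g i. share B)"
    using regular nbrs_subset[OF g, of i] by (intro sum.cong) auto
  then show ?thesis using regular[OF obtained_players(1)] by (simp add: payoff_eq deg_def algebra_simps)
qed

text \<open>By \<open>share_le_of_degree_gap\<close> shedding links does not pay. A gain can only
  come from a new partner who asks less often than one of degree \<open>B\<close>, and
  \<open>min\<close> sets it to zero otherwise.\<close>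

lemma obtained_gain_low:
  assumes s: "0 \<le> surplus (cost S i) B B" and d: "deg g' i \<le> B" and n: "deg g' j \<le> Suc B"
  shows "payoff S g' i - payoff S g i \<le> cost S i * \<alpha> * (share B - min (share B) (share (deg g' j)))"
proof -
  let ?c = "cost S i" and ?m = "deg g' i"
  have c: "\<gamma> < ?c" "0 < ?c" "0 \<le> v" using cost_bounds[OF obtained_players(1)] params by auto
  have m: "0 < ?m" using deg_pos[OF g'(1,3)] .
  have gap: "?c * (real (B - ?m) * share B) \<le> v * (q ^ ?m - q ^ B)"
    by (rule share_le_of_degree_gap[OF s c(1,3) d])
  have "payoff S g' i - payoff S g i \<le>
      \<alpha> * (v * (1 - q ^ ?m) - ?c * (real (?m - 1) * share B + share (deg g' j)))
      - \<alpha> * (v * (1 - q ^ B) - ?c * (real B * share B))"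
    using obtained_payoff_le regular_payoff by simp
  also have "\<dots> = \<alpha> * (?c * (real (B - ?m) * share B) - v * (q ^ ?m - q ^ B)) + ?c * \<alpha> * (share B - share (deg g' j))"
    using m d by (simp add: of_nat_diff algebra_simps)
  also have "\<dots> \<le> 0 + ?c * \<alpha> * (share B - min (share B) (share (deg g' j)))"
    using gap params c by (intro add_mono mult_left_mono) (auto simp: mult_nonneg_nonpos)
  finally show ?thesis by simp
qed

end

text \<open>
  A player who exceeds degree \<open>B\<close> asks for compensation of more than what the partner gains from
  being asked less often, while only partners with costs at most those of the player can pay.
\<close>

lemma no_exceeding_partner:
  assumes g: "network g" and regular: "\<And>k. k \<in> players S \<Longrightarrow> deg g k = B"
    and s: "0 \<le> surplus (cost S j) B B" "surplus (cost S i) (Suc B) (Suc B) < 0"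
    and g': "network g'" "obtainable g i j g'" "{i, j} \<in> g'"
    and t: "0 \<le> t\<^sub>i" "0 \<le> t\<^sub>j" "0 < t\<^sub>j \<Longrightarrow> cost S j \<le> cost S i"
    and d: "deg g' i = Suc B" "deg g' j \<le> B"
    and sust: "threshold (cost S i) \<le> payoff_with_transfers S g' i j t\<^sub>i t\<^sub>j - payoff S (g' - {{i, j}}) i"
    and better: "payoff S g j \<le> payoff_with_transfers S g' j i t\<^sub>j t\<^sub>i"
  shows False
proof -
  have ji: "{j, i} \<in> g'" "obtainable g j i g'" using g'(2,3) by (auto simp: insert_commute obtainable_def)
  let ?m = "deg g' j"
  define T where "T = favor_prob S g' j * t\<^sub>j - favor_prob S g' i * t\<^sub>i"
  have ij: "i \<in> players S" "j \<in> players S" using network_on_linkD[OF g'(1,3)] by auto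
  have c: "0 < cost S i" "0 < cost S j" using cost_bounds ij params by fastforce+
  have m: "0 < ?m" using deg_pos[OF g'(1) ji(1)] .
  have "threshold (cost S i) \<le> link_gain (cost S i) (Suc B) ?m + T"
    using sust payoff_delete_link[OF g'(1,3)] d(1) by (simp add: payoff_with_transfers_def T_def)
  moreover have "link_gain (cost S i) (Suc B) (Suc B) < threshold (cost S i)"
    using s(2) surplus_iff_link_gain[of "cost S i" "Suc B" "Suc B"] by linarith
  \<comment> \<open>At degrees \<open>Suc B\<close> on both sides \<open>i\<close> would fall short
    of her threshold. Since \<open>j\<close> has a smaller degree and asks more often, the net
    receipt must exceed the whole extra cost of these requests.\<close>
  ultimately have T: "cost S i * \<alpha> * (share ?m - share (Suc B)) < T"
    by (simp add: link_gain_def algebra_simps)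
  have sh: "share (Suc B) \<le> share B" "share B \<le> share ?m"
    using m d(2) by (auto intro: share_antimono)
  have "0 \<le> cost S i * \<alpha> * (share ?m - share (Suc B))" using sh c params by simp
  then have "0 < T" using T by linarith
  moreover have "0 \<le> favor_prob S g' i * t\<^sub>i" using t share_nonneg params by (simp add: favor_prob_eq)
  ultimately have "0 < t\<^sub>j" using t(2) by (cases "t\<^sub>j = 0") (auto simp: T_def)
  then have cc: "cost S j \<le> cost S i" using t(3) by blast
  have "T \<le> payoff S g' j - payoff S g j"
    using better by (simp add: payoff_with_transfers_def T_def)
  \<comment> \<open>All that \<open>j\<close> can gain is that \<open>i\<close>, at degree
    \<open>Suc B\<close>, asks less often than a partner of degree \<open>B\<close>.\<close>
  also have "\<dots> \<le> cost S j * \<alpha> * (share B - share (Suc B))"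
    using obtained_gain_low[OF g regular g'(1) ji(2,1) s(1) d(2)] d(1) sh by simp
  also have "\<dots> \<le> cost S i * \<alpha> * (share ?m - share (Suc B))"
    using cc c sh params by (intro mult_mono) auto
  finally show False using T by simp
qed

text \<open>If both new degrees are at most \<open>B\<close>, neither payoff rises and a transfer
  only shifts payoff from one side to the other. If both are \<open>Suc B\<close>, transfers cancel
  in the sum of the two sustainability conditions, while both diagonal surpluses are negative. The
  mixed cases are those of \<open>no_exceeding_partner\<close>.\<close>

lemma regular_strongly_stable_with_transfers:
  assumes st: "stable S g" and regular: "\<And>k. k \<in> players S \<Longrightarrow> deg g k = B"
    and s: "\<And>k. k \<in> players S \<Longrightarrow> 0 < B \<Longrightarrow> 0 \<le> surplus (cost S k) B B"
      "\<And>k. k \<in> players S \<Longrightarrow> surplus (cost S k) (Suc B) (Suc B) < 0"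
    and payers: "\<And>k l. k \<in> N' \<Longrightarrow> l \<in> players S \<Longrightarrow> cost S k \<le> cost S l"
  shows "strongly_stable_with_transfers S N' g"
  unfolding strongly_stable_with_transfers_def
proof (intro conjI st notI, elim bexE exE conjE)
  fix i j t\<^sub>i t\<^sub>j g'
  assume ij: "i \<in> players S" "j \<in> players S" and t: "admissible_transfers N' i j t\<^sub>i t\<^sub>j"
    and g': "network g'" "obtainable g i j g'" "{i, j} \<in> g'" "{i, j} \<notin> g"
    and sus: "sustainable_with_transfers S g' i j t\<^sub>i t\<^sub>j"
    and better: "payoff S g i \<le> payoff_with_transfers S g' i j t\<^sub>i t\<^sub>j" "payoff S g j \<le> payoff_with_transfers S g' j i t\<^sub>j t\<^sub>i"
    and strict: "payoff_with_transfers S g' i j t\<^sub>i t\<^sub>j > payoff S g i \<or> payoff_with_transfers S g' j i t\<^sub>j t\<^sub>i > payoff S g j"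
  have g: "network g" using st by (simp add: stable_def)
  have ji: "{j, i} \<in> g'" "obtainable g j i g'" using g'(2,3) by (auto simp: insert_commute obtainable_def)
  have del: "g' - {{j, i}} = g' - {{i, j}}" by (simp add: insert_commute)
  have si: "threshold (cost S i) \<le> payoff_with_transfers S g' i j t\<^sub>i t\<^sub>j - payoff S (g' - {{i, j}}) i"
    and sj: "threshold (cost S j) \<le> payoff_with_transfers S g' j i t\<^sub>j t\<^sub>i - payoff S (g' - {{j, i}}) j"
    using sus unfolding sustainable_with_transfers_def del threshold_iff by blast+
  have di: "0 < deg g' i" "deg g' i \<le> Suc B" and dj: "0 < deg g' j" "deg g' j \<le> Suc B"
    using deg_pos[OF g'(1,3)] deg_pos[OF g'(1) ji(1)] obtained_degree[OF g regular g'(1,2,3)]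
      obtained_degree[OF g regular g'(1) ji(2,1)] by auto
  consider "deg g' i \<le> B" "deg g' j \<le> B" | "deg g' i = Suc B" "deg g' j = Suc B"
    | "deg g' i = Suc B" "deg g' j \<le> B" | "deg g' i \<le> B" "deg g' j = Suc B"
    using di dj by linarith
  then show False
  proof cases
    case 1
    then have "0 < B" using di by simp
    have "share B \<le> share (deg g' i)" "share B \<le> share (deg g' j)" using 1 di dj by (auto intro: share_antimono)
    then have "payoff S g' i \<le> payoff S g i" "payoff S g' j \<le> payoff S g j"
      using obtained_gain_low[OF g regular g'(1,2,3) s(1)[OF ij(1) \<open>0 < B\<close>] 1(1) dj(2)]
        obtained_gain_low[OF g regular g'(1) ji(2,1) s(1)[OF ij(2) \<open>0 < B\<close>] 1(2) di(2)] by auto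
    then show False using better strict by (auto simp: payoff_with_transfers_def)
  next
    case 2
    have "link_gain (cost S k) (Suc B) (Suc B) < threshold (cost S k)" if "k \<in> players S" for k
      using s(2)[OF that] surplus_iff_link_gain[of "cost S k" "Suc B" "Suc B"] by linarith
    from this[OF ij(1)] this[OF ij(2)] show False
      using si sj payoff_delete_link[OF g'(1,3)] payoff_delete_link[OF g'(1) ji(1)] 2
      by (simp add: payoff_with_transfers_def)
  next
    case 3
    have "0 < B" using 3 dj by simp
    show False
      by (rule no_exceeding_partner[OF g regular s(1)[OF ij(2) \<open>0 < B\<close>] s(2)[OF ij(1)] g'(1,2,3) _ _ _ 3 si better(2)])
        (use t payers ij in \<open>auto simp: admissible_transfers_def\<close>)
  next
    case 4
    have "0 < B" using 4 di by simp
    show False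
      by (rule no_exceeding_partner[OF g regular s(1)[OF ij(1) \<open>0 < B\<close>] s(2)[OF ij(2)] g'(1) ji(2,1) _ _ _ 4(2,1) sj better(1)])
        (use t payers ij in \<open>auto simp: admissible_transfers_def\<close>)
  qed
qed

section \<open>Counting exceptional players\<close>

lemma card_clique_le:
  assumes "network g" "X \<subseteq> players S" "\<And>i j. i \<in> X \<Longrightarrow> j \<in> X \<Longrightarrow> i \<noteq> j \<Longrightarrow> {i, j} \<in> g"
    "\<And>i. i \<in> X \<Longrightarrow> deg g i \<le> d"
  shows "card X \<le> Suc d"
proof (cases "X = {}")
  case False
  then obtain x where x: "x \<in> X" by blast
  have finX: "finite X" using assms(2) finite_players finite_subset by blast
  have "X - {x} \<subseteq> nbrs g x"
  proof
    fix y assume y: "y \<in> X - {x}"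
    then show "y \<in> nbrs g x" using assms(3)[OF x, of y] by (auto simp: mem_nbrs_iff)
  qed
  then have "card (X - {x}) \<le> deg g x" using nbrs_finite[OF assms(1)] by (auto simp: deg_def intro: card_mono)
  then show ?thesis using x finX assms(4)[OF x] by (simp add: card_Diff_singleton)
qed simp

text \<open>For each \<open>d\<close> below the bound the players of degree \<open>d\<close> form a
  clique, hence number at most \<open>Suc d\<close>, which does not exceed the bound; there are
  \<open>bound c\<close> such values of \<open>d\<close>.\<close>

lemma card_low_degree_le:
  assumes st: "strongly_stable S g" and X: "X \<subseteq> players S" "\<And>i. i \<in> X \<Longrightarrow> cost S i = c"
  shows "card {i \<in> X. deg g i < bound c} \<le> bound c * bound c"
proof -
  have g: "network g" using st by (simp add: strongly_stable_def stable_def)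
  have finX: "finite X" using X(1) finite_players finite_subset by blast
  have "card {i \<in> X. deg g i = d} \<le> bound c" if d: "d < bound c" for d
  proof -
    have "card {i \<in> X. deg g i = d} \<le> Suc d"
    proof (rule card_clique_le[OF g])
      fix i j assume "i \<in> {i \<in> X. deg g i = d}" "j \<in> {i \<in> X. deg g i = d}" "i \<noteq> j"
      then show "{i, j} \<in> g" using X by (intro equal_degree_linked[OF st _ _ _ _ _ _ _ d]) auto
    qed (use X(1) in auto)
    then show ?thesis using d by simp
  qed
  then have "(\<Sum>d<bound c. card {i \<in> X. deg g i = d}) \<le> (\<Sum>d<bound c. bound c)" by (intro sum_mono) auto
  moreover have "{i \<in> X. deg g i < bound c} = (\<Union>d<bound c. {i \<in> X. deg g i = d})" by auto
  then have "card {i \<in> X. deg g i < bound c} \<le> (\<Sum>d<bound c. card {i \<in> X. deg g i = d})"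
    using card_UN_le[of "{..<bound c}" "\<lambda>d. {i \<in> X. deg g i = d}"] by simp
  ultimately show ?thesis by simp
qed

end

lemma ratio_tendsto_1:
  fixes A :: "nat \<Rightarrow> 'b set"
  assumes fin: "\<And>n. finite (A n)" and inf: "filterlim (\<lambda>n. card (A n)) at_top sequentially"
    and exc: "\<And>n. card {i \<in> A n. \<not> Q n i} \<le> C"
  shows "(\<lambda>n. real (card {i \<in> A n. Q n i}) / real (card (A n))) \<longlonglongrightarrow> 1"
proof (rule tendsto_sandwich[where f = "\<lambda>n. 1 - real C / real (card (A n))" and h = "\<lambda>_. 1"])
  have split: "card {i \<in> A n. Q n i} + card {i \<in> A n. \<not> Q n i} = card (A n)" for n
    using fin[of n] by (subst card_Un_disjoint[symmetric]) (auto intro: arg_cong[where f = card])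
  have pos: "\<forall>\<^sub>F n in sequentially. 0 < card (A n)"
    using filterlim_at_top[THEN iffD1, OF inf, rule_format, of 1] by eventually_elim simp
  then show "\<forall>\<^sub>F n in sequentially. 1 - real C / real (card (A n)) \<le> real (card {i \<in> A n. Q n i}) / real (card (A n))"
  proof eventually_elim
    case (elim n)
    have "real (card (A n)) \<le> real (card {i \<in> A n. Q n i}) + real C" using split[of n] exc[of n] by linarith
    then have "(real (card (A n)) - real C) / real (card (A n)) \<le> real (card {i \<in> A n. Q n i}) / real (card (A n))"
      by (intro divide_right_mono) auto
    then show ?case using elim by (simp add: diff_divide_distrib)
  qed
  show "\<forall>\<^sub>F n in sequentially. real (card {i \<in> A n. Q n i}) / real (card (A n)) \<le> 1"
    using pos
  proof eventually_elim
    case (elim n)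
    then show ?case using split[of n] by (simp add: divide_le_eq_1)
  qed
  have "filterlim (\<lambda>n. real (card (A n))) at_top sequentially"
    using inf by (rule filterlim_compose[OF filterlim_real_sequentially])
  then have "(\<lambda>n. real C / real (card (A n))) \<longlonglongrightarrow> 0"
    by (intro tendsto_divide_0[OF tendsto_const] filterlim_at_top_imp_at_infinity)
  then show "(\<lambda>n. 1 - real C / real (card (A n))) \<longlonglongrightarrow> 1"
    using tendsto_diff[OF tendsto_const, of _ 0 sequentially "1::real"] by fastforce
qed simp

section \<open>Rich and poor players\<close>

locale two_classes = favor_society S for S :: "'a society" +
  fixes c\<^sub>r c\<^sub>p :: real and N\<^sub>r N\<^sub>p :: "'a set"
  assumes costs: "\<gamma> < c\<^sub>r" "c\<^sub>r < c\<^sub>p" and partition: "players S = N\<^sub>r \<union> N\<^sub>p" "N\<^sub>r \<inter> N\<^sub>p = {}"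
    and cost_rich: "\<And>i. i \<in> N\<^sub>r \<Longrightarrow> cost S i = c\<^sub>r" and cost_poor: "\<And>i. i \<in> N\<^sub>p \<Longrightarrow> cost S i = c\<^sub>p"
begin

lemma degree_le_rich: "stable S g \<Longrightarrow> i \<in> players S \<Longrightarrow> deg g i \<le> bound c\<^sub>r"
  by (erule stable_degree_le) (use costs partition cost_rich cost_poor in auto)

text \<open>By \<open>stable_link_degree\<close> a degree above the own bound requires a partner of
  still higher degree within her own bound, and a poor partner has the same bound.\<close>

lemma high_degree_poor:
  assumes "stable S g" "i \<in> N\<^sub>p" "bound c\<^sub>p < deg g i"
  shows "\<exists>j\<in>N\<^sub>r. {i, j} \<in> g"
proof -
  have g: "network g" using assms(1) by (simp add: stable_def)
  have "nbrs g i \<noteq> {}" using assms(3) by (auto simp: deg_def)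
  then obtain j where "j \<in> nbrs g i" by blast
  then have ij: "{i, j} \<in> g" by (simp add: mem_nbrs_iff)
  have "j \<in> N\<^sub>r"
  proof (rule ccontr)
    assume "j \<notin> N\<^sub>r"
    then have "j \<in> N\<^sub>p" using network_on_linkD[OF g ij] partition by blast
    then show False using stable_link_degree[OF assms(1) ij] cost_poor assms(2,3) by simp
  qed
  then show ?thesis using ij by blast
qed

text \<open>The poor end of the link either respects the lower bound of the poor or has a degree
  strictly below that of its rich partner.\<close>

lemma poor_neighbor_degree:
  assumes "stable S g" "bound c\<^sub>p < bound c\<^sub>r" "i \<in> N\<^sub>r" "deg g i = bound c\<^sub>r" "k \<in> nbrs g i" "k \<in> N\<^sub>p"
  shows "deg g k < bound c\<^sub>r"
proof -
  have ki: "{k, i} \<in> g" using assms(5) by (simp add: mem_nbrs_iff insert_commute)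
  show ?thesis
    using stable_link_degree[OF assms(1) ki] cost_poor[OF assms(6)] cost_rich[OF assms(3)] assms(2,4) by auto
qed

lemma rich_homophily:
  assumes st: "strongly_stable_with_transfers S N\<^sub>r g" and less: "bound c\<^sub>p < bound c\<^sub>r"
    and many: "bound c\<^sub>r < card N\<^sub>r" and i: "i \<in> N\<^sub>r"
  shows "deg g i = bound c\<^sub>r" "nbrs g i \<subseteq> N\<^sub>r"
proof -
  have sg: "stable S g" and g: "network g" using st by (auto simp: strongly_stable_with_transfers_def stable_def)
  let ?b = "bound c\<^sub>r"
  have fin: "finite (nbrs g i)" "finite N\<^sub>r" using nbrs_finite[OF g] finite_players partition by auto
  \<comment> \<open>With too few rich neighbors, \<open>many\<close> leaves a rich player
    \<open>j\<close> who is not linked to \<open>i\<close>, and \<open>unlinked_payers_full\<close>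
    applies to this pair.\<close>
  have full: "deg g i = ?b \<and> (\<forall>k\<in>nbrs g i. deg g k = ?b)" if d: "card (nbrs g i \<inter> N\<^sub>r) < ?b"
  proof -
    have "card (insert i (nbrs g i \<inter> N\<^sub>r)) \<le> ?b" using d fin by (simp add: card_insert_if)
    then have "\<not> N\<^sub>r \<subseteq> insert i (nbrs g i \<inter> N\<^sub>r)"
      using many card_mono[of "insert i (nbrs g i \<inter> N\<^sub>r)" N\<^sub>r] fin by auto
    then obtain j where j: "j \<in> N\<^sub>r" "j \<noteq> i" "j \<notin> nbrs g i" by blast
    show ?thesis
      by (rule unlinked_payers_full[OF st, of i j])
        (use i j partition cost_rich degree_le_rich[OF sg] in \<open>auto simp: mem_nbrs_iff\<close>)
  qed
  have le: "card (nbrs g i \<inter> N\<^sub>r) \<le> deg g i" using fin by (auto simp: deg_def intro: card_mono)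
  have db: "deg g i \<le> ?b" using degree_le_rich[OF sg] i partition by blast
  show d: "deg g i = ?b" using full le db by fastforce
  show "nbrs g i \<subseteq> N\<^sub>r"
  proof (rule ccontr)
    assume "\<not> nbrs g i \<subseteq> N\<^sub>r"
    then obtain k where k: "k \<in> nbrs g i" "k \<notin> N\<^sub>r" by blast
    then have "k \<in> N\<^sub>p" using nbrs_subset[OF g, of i] partition by blast
    have "card (nbrs g i \<inter> N\<^sub>r) < card (nbrs g i)" using fin k by (intro psubset_card_mono) auto
    then have "deg g k = ?b" using full d k by (simp add: deg_def)
    then show False using poor_neighbor_degree[OF sg less i d k(1) \<open>k \<in> N\<^sub>p\<close>] by simp
  qed
qed

text \<open>The first summand counts rich players below the bound. The second bounds the clique of
  rich players at the bound who have a poor neighbor.\<close>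

definition exceptions :: nat where
  "exceptions = bound c\<^sub>r * bound c\<^sub>r + Suc (bound c\<^sub>r)"

lemma card_mixed_rich_le:
  assumes st: "strongly_stable S g" and less: "bound c\<^sub>p < bound c\<^sub>r"
  shows "card {i \<in> N\<^sub>r. \<not> nbrs g i \<subseteq> N\<^sub>r} \<le> exceptions"
proof -
  have sg: "stable S g" and g: "network g" using st by (auto simp: strongly_stable_def stable_def)
  let ?b = "bound c\<^sub>r"
  let ?L = "{i \<in> N\<^sub>r. deg g i < ?b}" and ?F = "{i \<in> N\<^sub>r. deg g i = ?b \<and> \<not> nbrs g i \<subseteq> N\<^sub>r}"
  have fin: "finite N\<^sub>r" using finite_players partition by auto
  have low: "\<exists>k\<in>nbrs g i. deg g k < ?b" if "i \<in> ?F" for i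
    using that poor_neighbor_degree[OF sg less] nbrs_subset[OF g, of i] partition by blast
  have "card ?F \<le> Suc ?b"
  proof (rule card_clique_le[OF g])
    fix i j assume ij: "i \<in> ?F" "j \<in> ?F" "i \<noteq> j"
    from low[OF ij(1)] low[OF ij(2)] obtain k l where
      "k \<in> nbrs g i" "deg g k < ?b" "l \<in> nbrs g j" "deg g l < ?b" by blast
    then show "{i, j} \<in> g"
      using ij(3) cost_rich partition(1) ij(1,2)
      by (intro full_with_low_neighbor_linked[OF st, where c = c\<^sub>r and k = k and l = l]) simp_all
  qed (use partition in auto)
  moreover have "card ?L \<le> ?b * ?b"
    by (rule card_low_degree_le[OF st]) (use partition cost_rich in auto)
  moreover have "{i \<in> N\<^sub>r. \<not> nbrs g i \<subseteq> N\<^sub>r} \<subseteq> ?L \<union> ?F"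
    using degree_le_rich[OF sg] partition by force
  then have "card {i \<in> N\<^sub>r. \<not> nbrs g i \<subseteq> N\<^sub>r} \<le> card ?L + card ?F"
    using fin by (intro order_trans[OF card_mono card_Un_le]) auto
  ultimately show ?thesis by (simp add: exceptions_def)
qed

text \<open>A poor player with a rich neighbor is a neighbor of one of the few mixed rich players,
  each of whom has at most \<open>bound c\<^sub>r\<close> links.\<close>

lemma card_mixed_poor_le:
  assumes st: "strongly_stable S g" and less: "bound c\<^sub>p < bound c\<^sub>r"
  shows "card {i \<in> N\<^sub>p. \<not> nbrs g i \<subseteq> N\<^sub>p} \<le> exceptions * bound c\<^sub>r"
proof -
  have sg: "stable S g" and g: "network g" using st by (auto simp: strongly_stable_def stable_def)
  let ?M = "{i \<in> N\<^sub>r. \<not> nbrs g i \<subseteq> N\<^sub>r}"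
  have fin: "finite ?M" using finite_players partition by auto
  have "{i \<in> N\<^sub>p. \<not> nbrs g i \<subseteq> N\<^sub>p} \<subseteq> (\<Union>j\<in>?M. nbrs g j)"
  proof
    fix i assume i: "i \<in> {i \<in> N\<^sub>p. \<not> nbrs g i \<subseteq> N\<^sub>p}"
    then obtain j where "j \<in> nbrs g i" "j \<notin> N\<^sub>p" by blast
    then have "j \<in> N\<^sub>r" "i \<in> nbrs g j" using nbrs_subset[OF g, of i] partition by (auto simp: mem_nbrs_commute)
    then show "i \<in> (\<Union>j\<in>?M. nbrs g j)" using i partition by blast
  qed
  then have "card {i \<in> N\<^sub>p. \<not> nbrs g i \<subseteq> N\<^sub>p} \<le> card (\<Union>j\<in>?M. nbrs g j)"
    using fin nbrs_finite[OF g] by (intro card_mono) auto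
  also have "\<dots> \<le> (\<Sum>j\<in>?M. card (nbrs g j))" by (rule card_UN_le[OF fin])
  also have "\<dots> \<le> (\<Sum>j\<in>?M. bound c\<^sub>r)"
    using degree_le_rich[OF sg] partition by (intro sum_mono) (auto simp: deg_def)
  also have "\<dots> \<le> exceptions * bound c\<^sub>r" using card_mixed_rich_le[OF st less] by simp
  finally show ?thesis .
qed

lemma card_rich_exceptions_le:
  assumes "strongly_stable S g"
  shows "card {i \<in> N\<^sub>r. deg g i \<noteq> bound c\<^sub>r} \<le> bound c\<^sub>r * bound c\<^sub>r"
proof -
  have "stable S g" using assms by (simp add: strongly_stable_def)
  then have "{i \<in> N\<^sub>r. deg g i \<noteq> bound c\<^sub>r} = {i \<in> N\<^sub>r. deg g i < bound c\<^sub>r}"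
    using degree_le_rich partition by force
  then show ?thesis using card_low_degree_le[OF assms, of N\<^sub>r c\<^sub>r] partition cost_rich by simp
qed

text \<open>Poor players below their bound are counted by degree cliques; those above it have a rich
  neighbor and are among the mixed ones.\<close>

lemma card_poor_exceptions_le:
  assumes st: "strongly_stable S g" and less: "bound c\<^sub>p < bound c\<^sub>r"
  shows "card {i \<in> N\<^sub>p. deg g i \<noteq> bound c\<^sub>p} \<le> bound c\<^sub>p * bound c\<^sub>p + exceptions * bound c\<^sub>r"
proof -
  have sg: "stable S g" using st by (simp add: strongly_stable_def)
  let ?L = "{i \<in> N\<^sub>p. deg g i < bound c\<^sub>p}" and ?M = "{i \<in> N\<^sub>p. \<not> nbrs g i \<subseteq> N\<^sub>p}"
  have fin: "finite N\<^sub>p" using finite_players partition by auto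
  have "i \<in> ?L \<union> ?M" if i: "i \<in> N\<^sub>p" "deg g i \<noteq> bound c\<^sub>p" for i
  proof (cases "deg g i < bound c\<^sub>p")
    case False
    then obtain j where "j \<in> N\<^sub>r" "{i, j} \<in> g" using high_degree_poor[OF sg i(1)] i(2) by force
    then have "j \<in> nbrs g i" "j \<notin> N\<^sub>p" using i(1) partition by (auto simp: mem_nbrs_iff)
    then show ?thesis using i(1) by blast
  qed (use i in simp)
  then have "card {i \<in> N\<^sub>p. deg g i \<noteq> bound c\<^sub>p} \<le> card ?L + card ?M"
    using fin by (intro order_trans[OF card_mono card_Un_le]) auto
  moreover have "card ?L \<le> bound c\<^sub>p * bound c\<^sub>p"
    by (rule card_low_degree_le[OF st]) (use partition cost_poor in auto)
  ultimately show ?thesis using card_mixed_poor_le[OF st less] by linarith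
qed

end

lemma two_classesI:
  assumes "rich_poor_society P c\<^sub>r c\<^sub>p N\<^sub>r N\<^sub>p S" "penalty P < c\<^sub>r" "c\<^sub>r < c\<^sub>p"
  shows "two_classes S c\<^sub>r c\<^sub>p N\<^sub>r N\<^sub>p"
proof -
  have "penalty S = penalty P"
    using assms(1) by (auto simp: rich_poor_society_def favor_params.truncate_def)
  then show ?thesis
    using assms by unfold_locales (auto simp: rich_poor_society_def)
qed

lemma bound_society:
  assumes "rich_poor_society P c\<^sub>r c\<^sub>p N\<^sub>r N\<^sub>p S"
  shows "favor_exchange.bound S c = cooperation_bound P c"
proof -
  have "valid_params S" "favor_params.truncate S = P"
    using assms by (auto simp: rich_poor_society_def valid_society_def)
  then show ?thesis by (simp add: favor_exchange.bound_def favor_exchange_def)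
qed

text \<open>In the second part a nonempty rich class has more than
  \<open>cooperation_bound P c\<^sub>r\<close> members, as otherwise its members could not have that
  many links within the class. In the third part the number of exceptions is bounded independently
  of the size of the society, so the fraction within a class tends to 1 when that class itself
  grows.\<close>

theorem proposition6:
  fixes P :: favor_params and c\<^sub>r c\<^sub>p :: real
  assumes "valid_params P"
    and "penalty P < c\<^sub>r" and "c\<^sub>r < c\<^sub>p" and "c\<^sub>p < benefit P"
  shows
    "(c_tilde P c\<^sub>p < c\<^sub>r \<longrightarrow>
        cooperation_bound P c\<^sub>r = cooperation_bound P c\<^sub>p \<and>
        (\<forall>(S :: 'a society) N\<^sub>r N\<^sub>p g.
           rich_poor_society P c\<^sub>r c\<^sub>p N\<^sub>r N\<^sub>p S \<longrightarrow> network_on (players S) g \<longrightarrow>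
           (\<forall>i\<in>players S. deg g i = cooperation_bound P c\<^sub>r) \<longrightarrow>
           strongly_stable_with_transfers S N\<^sub>r g))
     \<and>
     (c\<^sub>r < c_tilde P c\<^sub>p \<longrightarrow>
        (\<forall>(S :: 'a society) N\<^sub>r N\<^sub>p g.
           rich_poor_society P c\<^sub>r c\<^sub>p N\<^sub>r N\<^sub>p S \<longrightarrow>
           (N\<^sub>r \<noteq> {} \<longrightarrow> cooperation_bound P c\<^sub>r < card N\<^sub>r) \<longrightarrow>
           strongly_stable_with_transfers S N\<^sub>r g \<longrightarrow>
           (\<forall>i\<in>N\<^sub>r. deg g i = cooperation_bound P c\<^sub>r) \<and>
           (\<forall>i\<in>N\<^sub>r. \<forall>j\<in>N\<^sub>p. {i, j} \<notin> g) \<and>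
           (\<forall>i\<in>N\<^sub>p. deg g i \<le> cooperation_bound P c\<^sub>p)))
     \<and>
     (c\<^sub>r < c_tilde P c\<^sub>p \<longrightarrow>
        (\<forall>(S :: nat \<Rightarrow> 'a society) N\<^sub>r N\<^sub>p g.
           (\<forall>n. rich_poor_society P c\<^sub>r c\<^sub>p (N\<^sub>r n) (N\<^sub>p n) (S n) \<and> strongly_stable (S n) (g n)) \<longrightarrow>
           filterlim (\<lambda>n. card (players (S n))) at_top sequentially \<longrightarrow>
           (filterlim (\<lambda>n. card (N\<^sub>r n)) at_top sequentially \<longrightarrow>
              (\<lambda>n. real (card {i \<in> N\<^sub>r n. deg (g n) i = cooperation_bound P c\<^sub>r})
                    / real (card (N\<^sub>r n))) \<longlonglongrightarrow> 1) \<and>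
           (filterlim (\<lambda>n. card (N\<^sub>p n)) at_top sequentially \<longrightarrow>
              (\<lambda>n. real (card {i \<in> N\<^sub>p n. deg (g n) i = cooperation_bound P c\<^sub>p})
                    / real (card (N\<^sub>p n))) \<longlonglongrightarrow> 1) \<and>
           (\<lambda>n. real (card {i \<in> players (S n).
                        (i \<in> N\<^sub>r n \<longrightarrow> nbrs (g n) i \<subseteq> N\<^sub>r n) \<and> (i \<in> N\<^sub>p n \<longrightarrow> nbrs (g n) i \<subseteq> N\<^sub>p n)})
                 / real (card (players (S n)))) \<longlonglongrightarrow> 1))"
proof -
  interpret params: favor_exchange P by unfold_locales (rule assms(1))
  let ?B = "cooperation_bound P"
  have B: "params.bound c = ?B c" for c by (simp add: params.bound_def)
  have first: "strongly_stable_with_transfers S N\<^sub>r g"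
    if low: "c_tilde P c\<^sub>p < c\<^sub>r" and S: "rich_poor_society P c\<^sub>r c\<^sub>p N\<^sub>r N\<^sub>p S" and g: "network_on (players S) g"
      and regular: "\<forall>i\<in>players S. deg g i = ?B c\<^sub>r"
    for S :: "'a society" and N\<^sub>r N\<^sub>p g
  proof -
    interpret two_classes S c\<^sub>r c\<^sub>p N\<^sub>r N\<^sub>p by (rule two_classesI[OF S assms(2,3)])
    have eq: "?B c\<^sub>r = ?B c\<^sub>p"
      using params.bound_eq_of_c_tilde_less[OF assms(2,3)] low by (simp add: B)
    have bd: "bound (cost S k) = ?B c\<^sub>r" if "k \<in> players S" for k
      using that eq partition cost_rich cost_poor bound_society[OF S] by auto
    have s: "0 \<le> surplus (cost S k) m m \<longleftrightarrow> m \<le> ?B c\<^sub>r" if "k \<in> players S" "0 < m" for k m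
      using surplus_diag_nonneg_iff[of "cost S k" m] cost_bounds[OF that(1)] that bd[OF that(1)] by simp
    interpret regular_network S g "?B c\<^sub>r"
      by unfold_locales (use g regular s in auto)
    show ?thesis
    proof (rule regular_strongly_stable_with_transfers[OF stable_regular, of "?B c\<^sub>r"])
      show "surplus (cost S k) (Suc (?B c\<^sub>r)) (Suc (?B c\<^sub>r)) < 0" if "k \<in> players S" for k
        using s[OF that, of "Suc (?B c\<^sub>r)"] by simp
      show "cost S k \<le> cost S l" if "k \<in> N\<^sub>r" "l \<in> players S" for k l
        using that cost_rich cost_poor partition costs by force
    qed (use regular s in auto)
  qed
  have second: "(\<forall>i\<in>N\<^sub>r. deg g i = ?B c\<^sub>r) \<and> (\<forall>i\<in>N\<^sub>r. \<forall>j\<in>N\<^sub>p. {i, j} \<notin> g) \<and> (\<forall>i\<in>N\<^sub>p. deg g i \<le> ?B c\<^sub>p)"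
    if high: "c\<^sub>r < c_tilde P c\<^sub>p" and S: "rich_poor_society P c\<^sub>r c\<^sub>p N\<^sub>r N\<^sub>p S"
      and many: "N\<^sub>r \<noteq> {} \<longrightarrow> ?B c\<^sub>r < card N\<^sub>r" and st: "strongly_stable_with_transfers S N\<^sub>r g"
    for S :: "'a society" and N\<^sub>r N\<^sub>p g
  proof -
    interpret two_classes S c\<^sub>r c\<^sub>p N\<^sub>r N\<^sub>p by (rule two_classesI[OF S assms(2,3)])
    note bs = bound_society[OF S]
    have less: "bound c\<^sub>p < bound c\<^sub>r"
      using params.bound_less_of_less_c_tilde[OF assms(2,3)] high by (simp add: B bs)
    have rich: "deg g i = ?B c\<^sub>r" "nbrs g i \<subseteq> N\<^sub>r" if "i \<in> N\<^sub>r" for i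
      using rich_homophily[OF st less _ that] many that by (auto simp: bs)
    have sep: "{i, j} \<notin> g" if "i \<in> N\<^sub>r" "j \<in> N\<^sub>p" for i j
    proof
      assume "{i, j} \<in> g"
      then have "j \<in> nbrs g i" using that partition by (auto simp: mem_nbrs_iff)
      then show False using rich(2)[OF that(1)] that(2) partition by blast
    qed
    have "deg g i \<le> ?B c\<^sub>p" if i: "i \<in> N\<^sub>p" for i
    proof (rule ccontr)
      assume "\<not> deg g i \<le> ?B c\<^sub>p"
      then have "bound c\<^sub>p < deg g i" by (simp add: bs)
      moreover have "stable S g" using st by (simp add: strongly_stable_with_transfers_def)
      ultimately show False using high_degree_poor[OF _ i] sep[OF _ i] by (metis insert_commute)
    qed
    then show ?thesis using rich sep by blast
  qed
  have third: "(filterlim (\<lambda>n. card (N\<^sub>r n)) at_top sequentially \<longrightarrow>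
              (\<lambda>n. real (card {i \<in> N\<^sub>r n. deg (g n) i = ?B c\<^sub>r}) / real (card (N\<^sub>r n))) \<longlonglongrightarrow> 1) \<and>
           (filterlim (\<lambda>n. card (N\<^sub>p n)) at_top sequentially \<longrightarrow>
              (\<lambda>n. real (card {i \<in> N\<^sub>p n. deg (g n) i = ?B c\<^sub>p}) / real (card (N\<^sub>p n))) \<longlonglongrightarrow> 1) \<and>
           (\<lambda>n. real (card {i \<in> players (S n).
                        (i \<in> N\<^sub>r n \<longrightarrow> nbrs (g n) i \<subseteq> N\<^sub>r n) \<and> (i \<in> N\<^sub>p n \<longrightarrow> nbrs (g n) i \<subseteq> N\<^sub>p n)})
                 / real (card (players (S n)))) \<longlonglongrightarrow> 1"
    if high: "c\<^sub>r < c_tilde P c\<^sub>p"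
      and S: "\<And>n. rich_poor_society P c\<^sub>r c\<^sub>p (N\<^sub>r n) (N\<^sub>p n) (S n) \<and> strongly_stable (S n) (g n)"
      and inf: "filterlim (\<lambda>n. card (players (S n))) at_top sequentially"
    for S :: "nat \<Rightarrow> 'a society" and N\<^sub>r N\<^sub>p g
  proof -
    let ?own = "\<lambda>n i. (i \<in> N\<^sub>r n \<longrightarrow> nbrs (g n) i \<subseteq> N\<^sub>r n) \<and> (i \<in> N\<^sub>p n \<longrightarrow> nbrs (g n) i \<subseteq> N\<^sub>p n)"
    \<comment> \<open>The value of \<open>exceptions\<close>, stated in terms of \<open>P\<close> to
      make visible that it is the same for all \<open>n\<close>.\<close>
    define K where "K = ?B c\<^sub>r * ?B c\<^sub>r + Suc (?B c\<^sub>r)"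
    have counts: "finite (players (S n))" "finite (N\<^sub>r n)" "finite (N\<^sub>p n)"
      "card {i \<in> N\<^sub>r n. deg (g n) i \<noteq> ?B c\<^sub>r} \<le> ?B c\<^sub>r * ?B c\<^sub>r"
      "card {i \<in> N\<^sub>p n. deg (g n) i \<noteq> ?B c\<^sub>p} \<le> ?B c\<^sub>p * ?B c\<^sub>p + K * ?B c\<^sub>r"
      "card {i \<in> players (S n). \<not> ?own n i} \<le> K + K * ?B c\<^sub>r" for n
    proof -
      interpret two_classes "S n" c\<^sub>r c\<^sub>p "N\<^sub>r n" "N\<^sub>p n"
        by (rule two_classesI[OF _ assms(2,3)]) (use S in blast)
      have st: "strongly_stable (S n) (g n)" using S by blast
      have bs: "bound c = ?B c" for c using S bound_society by blast
      have less: "bound c\<^sub>p < bound c\<^sub>r"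
        using params.bound_less_of_less_c_tilde[OF assms(2,3)] high by (simp add: B bs)
      have K: "exceptions = K" by (simp add: exceptions_def K_def bs)
      show fin: "finite (players (S n))" by (rule finite_players)
      then show "finite (N\<^sub>r n)" "finite (N\<^sub>p n)" using partition by auto
      show "card {i \<in> N\<^sub>r n. deg (g n) i \<noteq> ?B c\<^sub>r} \<le> ?B c\<^sub>r * ?B c\<^sub>r"
        using card_rich_exceptions_le[OF st] by (simp add: bs)
      show "card {i \<in> N\<^sub>p n. deg (g n) i \<noteq> ?B c\<^sub>p} \<le> ?B c\<^sub>p * ?B c\<^sub>p + K * ?B c\<^sub>r"
        using card_poor_exceptions_le[OF st less] by (simp add: bs K)
      let ?Mr = "{i \<in> N\<^sub>r n. \<not> nbrs (g n) i \<subseteq> N\<^sub>r n}" and ?Mp = "{i \<in> N\<^sub>p n. \<not> nbrs (g n) i \<subseteq> N\<^sub>p n}"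
      have "{i \<in> players (S n). \<not> ?own n i} \<subseteq> ?Mr \<union> ?Mp" by blast
      then have "card {i \<in> players (S n). \<not> ?own n i} \<le> card ?Mr + card ?Mp"
        using fin partition by (intro order_trans[OF card_mono card_Un_le]) auto
      then show "card {i \<in> players (S n). \<not> ?own n i} \<le> K + K * ?B c\<^sub>r"
        using card_mixed_rich_le[OF st less] card_mixed_poor_le[OF st less] by (simp add: bs K)
    qed
    show ?thesis
      by (intro conjI impI ratio_tendsto_1[OF counts(2) _ counts(4)] ratio_tendsto_1[OF counts(3) _ counts(5)]
          ratio_tendsto_1[OF counts(1) inf counts(6)])
  qed
  have bounds_eq: "?B c\<^sub>r = ?B c\<^sub>p" if "c_tilde P c\<^sub>p < c\<^sub>r"
    using params.bound_eq_of_c_tilde_less[OF assms(2,3)] that by (simp add: B)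
  show ?thesis (is "?A \<and> ?C \<and> ?D")
  proof (rule conjI[OF _ conjI])
    show ?A by (intro impI conjI allI) (rule bounds_eq, assumption, rule first)
    show ?C by (intro impI allI) (rule second)
    show ?D by (intro impI allI) (rule third, auto)
  qed
qed

end
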